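(* For every plane triangulation $T$, the following statements are equivalent: (i) $T$ is $t$-perfect; (ii) $T$ does not contain any loose odd wheel as an induced subgraph; (iii) $T$ is perfect and contains no $K_4$ as a subgraph.
   Context: All graphs are finite, simple and undirected. A plane triangulation is a graph embedded in the plane in which every face (including the outer face) is bounded by a triangle. A graph $G$ is perfect if for every induced subgraph $H$ of $G$ the chromatic number of $H$ equals its clique number. A graph $G$ is $t$-perfect if the polytope in $\mathbb{R}^{V(G)}$ defined by $x_v\ge 0$ for every $v\in V(G)$, $x_u+x_v\le 1$ for every edge $uv\in E(G)$, and $\sum_{v\in V(C)}x_v\le (|V(C)|-1)/2$ for every induced odd cycle $C$ of $G$, is integral. A loose wheel is a graph formed by a cycle $C$ and a vertex $v\notin V(C)$ that has at least three neighbours on $C$ (and no other edges); a segment of the loose wheel is a path of $C$ joining two neighbours of $v$ and containing no other neighbour of $v$. A loose odd wheel is a loose wheel in which $C$ has odd length and at least three of the segments have odd length. *)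

theory Defs
  imports "HOL-Analysis.Analysis" "HOL-Library.Ramsey"
begin

section \<open>Finite simple graphs\<close>

text \<open>A graph is given by its vertex set \<open>V\<close> and its set \<open>E\<close> of two-element edges.
  Cliques are those of \<^theory>\<open>HOL-Library.Ramsey\<close>.\<close>

definition sgraph :: "'a set \<Rightarrow> 'a set set \<Rightarrow> bool" where
  "sgraph V E \<longleftrightarrow> finite V \<and> (\<forall>e\<in>E. e \<subseteq> V \<and> card e = 2)"

definition induced_edges :: "'a set set \<Rightarrow> 'a set \<Rightarrow> 'a set set" where
  "induced_edges E S = {e \<in> E. e \<subseteq> S}"

definition is_cycle :: "'a list \<Rightarrow> bool" where
  "is_cycle C \<longleftrightarrow> distinct C \<and> 3 \<le> length C"

definition cycle_edges :: "'a list \<Rightarrow> 'a set set" where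
  "cycle_edges C = {{C ! i, C ! (Suc i mod length C)} | i. i < length C}"

definition induced_cycle :: "'a set \<Rightarrow> 'a set set \<Rightarrow> 'a list \<Rightarrow> bool" where
  "induced_cycle V E C \<longleftrightarrow>
     is_cycle C \<and> set C \<subseteq> V \<and> induced_edges E (set C) = cycle_edges C"

section \<open>Plane triangulations\<close>

text \<open>The embedding sends a vertex \<open>v\<close> to the point \<open>pos v\<close> and an edge \<open>e\<close> to the simple
  arc \<open>crv e\<close>, parametrised in either direction.\<close>

definition plane_graph ::
  "'a set \<Rightarrow> 'a set set \<Rightarrow> ('a \<Rightarrow> complex) \<Rightarrow> ('a set \<Rightarrow> real \<Rightarrow> complex) \<Rightarrow> bool" where
  "plane_graph V E pos crv \<longleftrightarrow>
     sgraph V E \<and> inj_on pos V \<and>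
     (\<forall>e\<in>E. arc (crv e) \<and> {pathstart (crv e), pathfinish (crv e)} = pos ` e) \<and>
     (\<forall>e\<in>E. \<forall>v\<in>V. pos v \<in> path_image (crv e) \<longrightarrow> v \<in> e) \<and>
     (\<forall>e\<in>E. \<forall>f\<in>E. e \<noteq> f \<longrightarrow>
        path_image (crv e) \<inter> path_image (crv f) \<subseteq> pos ` (e \<inter> f))"

definition drawing ::
  "'a set \<Rightarrow> 'a set set \<Rightarrow> ('a \<Rightarrow> complex) \<Rightarrow> ('a set \<Rightarrow> real \<Rightarrow> complex) \<Rightarrow> complex set" where
  "drawing V E pos crv = pos ` V \<union> (\<Union>e\<in>E. path_image (crv e))"

definition faces ::
  "'a set \<Rightarrow> 'a set set \<Rightarrow> ('a \<Rightarrow> complex) \<Rightarrow> ('a set \<Rightarrow> real \<Rightarrow> complex) \<Rightarrow> complex set set" where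
  "faces V E pos crv = components (- drawing V E pos crv)"

definition plane_triangulation ::
  "'a set \<Rightarrow> 'a set set \<Rightarrow> ('a \<Rightarrow> complex) \<Rightarrow> ('a set \<Rightarrow> real \<Rightarrow> complex) \<Rightarrow> bool" where
  "plane_triangulation V E pos crv \<longleftrightarrow>
     plane_graph V E pos crv \<and>
     (\<forall>F \<in> faces V E pos crv. \<exists>a b c.
        a \<noteq> b \<and> b \<noteq> c \<and> a \<noteq> c \<and> {a, b} \<in> E \<and> {b, c} \<in> E \<and> {a, c} \<in> E \<and>
        frontier F = path_image (crv {a, b}) \<union> path_image (crv {b, c}) \<union> path_image (crv {a, c}))"

section \<open>Perfect graphs\<close>

definition colourable :: "'a set \<Rightarrow> 'a set set \<Rightarrow> nat \<Rightarrow> bool" where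
  "colourable V E k \<longleftrightarrow>
     (\<exists>f :: 'a \<Rightarrow> nat. f ` V \<subseteq> {..<k} \<and> (\<forall>u\<in>V. \<forall>v\<in>V. {u, v} \<in> E \<longrightarrow> f u \<noteq> f v))"

definition chromatic_number :: "'a set \<Rightarrow> 'a set set \<Rightarrow> nat" where
  "chromatic_number V E = (LEAST k. colourable V E k)"

definition clique_number :: "'a set \<Rightarrow> 'a set set \<Rightarrow> nat" where
  "clique_number V E = Max {card K | K. K \<subseteq> V \<and> clique K E}"

definition perfect :: "'a set \<Rightarrow> 'a set set \<Rightarrow> bool" where
  "perfect V E \<longleftrightarrow>
     (\<forall>S \<subseteq> V. chromatic_number S (induced_edges E S) = clique_number S (induced_edges E S))"

definition contains_K4 :: "'a set \<Rightarrow> 'a set set \<Rightarrow> bool" where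
  "contains_K4 V E \<longleftrightarrow> (\<exists>K \<subseteq> V. card K = 4 \<and> clique K E)"

section \<open>t-perfect graphs\<close>

text \<open>\<open>\<real>\<^sup>V\<close> is the coordinate subspace of \<open>real ^ 'a\<close> of the vectors vanishing
  outside \<open>V\<close>.\<close>

definition t_polytope :: "'a::finite set \<Rightarrow> 'a set set \<Rightarrow> (real ^ 'a) set" where
  "t_polytope V E = {x.
     (\<forall>v. v \<notin> V \<longrightarrow> x $ v = 0) \<and>
     (\<forall>v\<in>V. 0 \<le> x $ v) \<and>
     (\<forall>u v. {u, v} \<in> E \<longrightarrow> x $ u + x $ v \<le> 1) \<and>
     (\<forall>C. induced_cycle V E C \<and> odd (length C) \<longrightarrow>
        (\<Sum>v\<in>set C. x $ v) \<le> (real (length C) - 1) / 2)}"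

definition integral_polytope :: "(real ^ 'a::finite) set \<Rightarrow> bool" where
  "integral_polytope P \<longleftrightarrow> (\<forall>x. x extreme_point_of P \<longrightarrow> (\<forall>i. x $ i \<in> \<int>))"

definition t_perfect :: "'a::finite set \<Rightarrow> 'a set set \<Rightarrow> bool" where
  "t_perfect V E \<longleftrightarrow> integral_polytope (t_polytope V E)"

section \<open>Loose odd wheels\<close>

text \<open>The segments of a loose wheel with rim \<open>C\<close> whose hub has neighbourhood \<open>N\<close>, as vertex
  lists read in the cyclic order of \<open>C\<close>. A path of \<open>C\<close> with at least one edge has exactly one
  such reading, so every segment is counted once. The number of edges of \<open>P\<close>
  is \<open>length P - 1\<close>.\<close>

definition segments :: "'a list \<Rightarrow> 'a set \<Rightarrow> 'a list set" where
  "segments C N = {P. \<exists>i k. i < length C \<and> 2 \<le> k \<and> k \<le> length C \<and>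
     P = take k (rotate i C) \<and> hd P \<in> N \<and> last P \<in> N \<and>
     (\<forall>u \<in> set P - {hd P, last P}. u \<notin> N)}"

definition loose_wheel :: "'a list \<Rightarrow> 'a \<Rightarrow> 'a set \<Rightarrow> 'a set \<Rightarrow> 'a set set \<Rightarrow> bool" where
  "loose_wheel C v N W F \<longleftrightarrow>
     is_cycle C \<and> v \<notin> set C \<and> N \<subseteq> set C \<and> 3 \<le> card N \<and>
     W = insert v (set C) \<and> F = cycle_edges C \<union> {{v, u} | u. u \<in> N}"

definition loose_odd_wheel :: "'a set \<Rightarrow> 'a set set \<Rightarrow> bool" where
  "loose_odd_wheel W F \<longleftrightarrow>
     (\<exists>C v N. loose_wheel C v N W F \<and> odd (length C) \<and>
        3 \<le> card {P \<in> segments C N. odd (length P - 1)})"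

definition has_induced_loose_odd_wheel :: "'a set \<Rightarrow> 'a set set \<Rightarrow> bool" where
  "has_induced_loose_odd_wheel V E \<longleftrightarrow> (\<exists>S \<subseteq> V. loose_odd_wheel S (induced_edges E S))"

end

theory Submission
  imports Defs
begin

text \<open>
  The implication to t-perfection is the weighted colouring theorem for perfect graphs. A loose odd
  wheel with hub \<open>v\<close> and rim \<open>C\<close> of length \<open>2 * k + 1\<close> refutes t-perfection by the inequality
  \<open>x\<^sub>v + x(C) \<le> k\<close>, valid for stable sets but not for the t-polytope, and its rim is an odd hole or part of
  a K4. Conversely suppose that a triangulation has no loose odd wheel. Then all links are bipartite, which
  makes it possible to orient the edges such that every triangle becomes a directed cycle: the
  obstruction is a cochain modulo 2 vanishing on faces. Likewise modulo 3, this orientation \<open>s\<close> integrates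
  to a 3-colouring. It remains to exclude odd holes, and in fact the sum of \<open>s\<close> along every hole
  vanishes. In a counterexample \<open>C\<close> with as few inner faces as possible, replacing an arc of \<open>C\<close> by
  a chordless path in the link of a vertex \<open>u\<close> inside gives a smaller hole. Comparing the sums shows that
  neighbours of \<open>u\<close> on \<open>C\<close> are pairwise adjacent, for otherwise \<open>u\<close> is the hub of a loose odd
  wheel with rim \<open>C\<close>. Then one can also use the link of a vertex of \<open>C\<close> itself, and gets that \<open>s\<close> is
  constant along \<open>C\<close> and that \<open>C\<close> has length 3.
\<close>

section \<open>Walks and cycles\<close>

text \<open>The obstacle in the final steps is chords: a path in the link of \<open>u\<close> that
  replaces an arc of \<open>C\<close> must have no neighbour on the rest of \<open>C\<close>. If
  \<open>u\<close> is inside and forms a smaller hole with the arc, this is automatic, since the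
  path runs inside that hole and is cut off from the rest of \<open>C\<close>. If \<open>u\<close>
  lies on \<open>C\<close>, a chord would make its inner end a hub with two nonadjacent neighbours
  on \<open>C\<close>; hence hubs are treated first. The numbers come from
  \<open>2 * s p q = s u p - s u q\<close>, valid in every triangle \<open>u p q\<close>: the sum
  along a path in the link of \<open>u\<close> depends only on its ends. Comparing holes, the sum
  \<open>W\<close> of \<open>C\<close> becomes 3/2 times a sum or difference of two signs, so it is
  0, 3 or -3. Around a hub each arc with inner vertices adds \<open>W\<close> to a telescoping sum,
  so there can be only one such arc. Topology enters only through a locale of incidence facts about
  the faces inside a cycle. They rest on the Jordan curve theorem and, for the bound of two faces at
  an edge, on Janiszewski's theorem.\<close>

fun walk_edges :: "'a list \<Rightarrow> 'a set set" where
  "walk_edges (x # y # zs) = insert {x, y} (walk_edges (y # zs))"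
| "walk_edges _ = {}"

fun walk_sum :: "('a \<Rightarrow> 'a \<Rightarrow> int) \<Rightarrow> 'a list \<Rightarrow> int" where
  "walk_sum s (x # y # zs) = s x y + walk_sum s (y # zs)"
| "walk_sum s _ = 0"

lemma walk_edges_append: "walk_edges (xs @ x # ys) = walk_edges (xs @ [x]) \<union> walk_edges (x # ys)"
  by (induction xs rule: walk_edges.induct) auto

lemma walk_sum_append: "walk_sum s (xs @ x # ys) = walk_sum s (xs @ [x]) + walk_sum s (x # ys)"
  by (induction s xs rule: walk_sum.induct) auto

lemma walk_edges_snoc2: "walk_edges (xs @ [x, y]) = insert {x, y} (walk_edges (xs @ [x]))"
  using walk_edges_append[of xs x "[y]"] by auto

lemma walk_sum_snoc2: "walk_sum s (xs @ [x, y]) = walk_sum s (xs @ [x]) + s x y"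
  using walk_sum_append[of s xs x "[y]"] by auto

lemma walk_edges_rev: "walk_edges (rev xs) = walk_edges xs"
  by (induction xs rule: walk_edges.induct) (auto simp: walk_edges_snoc2 insert_commute)

lemma walk_edges_subset: "e \<in> walk_edges xs \<Longrightarrow> e \<subseteq> set xs"
  by (induction xs rule: walk_edges.induct) auto

lemma walk_edges_nth: "walk_edges xs = {{xs ! i, xs ! Suc i} | i. Suc i < length xs}"
proof (induction xs rule: walk_edges.induct)
  case (1 x y zs)
  have "{{(x # y # zs) ! i, (x # y # zs) ! Suc i} | i. Suc i < length (x # y # zs)} =
      insert {x, y} {{(y # zs) ! i, (y # zs) ! Suc i} | i. Suc i < length (y # zs)}" (is "?L = ?R")
  proof
    show "?L \<subseteq> ?R"
    proof
      fix e assume "e \<in> ?L"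
      then obtain i where "e = {(x # y # zs) ! i, (x # y # zs) ! Suc i}" "Suc i < length (x # y # zs)"
        by auto
      then show "e \<in> ?R" by (cases i) auto
    qed
    show "?R \<subseteq> ?L"
    proof
      fix e assume "e \<in> ?R"
      then consider "e = {x, y}" | i where "e = {(y # zs) ! i, (y # zs) ! Suc i}" "Suc i < length (y # zs)"
        by auto
      then show "e \<in> ?L"
      proof cases
        case 1 then show ?thesis by (intro CollectI exI[of _ 0]) auto
      next
        case (2 i) then show ?thesis by (intro CollectI exI[of _ "Suc i"]) auto
      qed
    qed
  qed
  with 1 show ?case by simp
qed auto

lemma walk_sum_nth: "walk_sum s xs = (\<Sum>i<length xs - 1. s (xs ! i) (xs ! Suc i))"
proof (induction s xs rule: walk_sum.induct)
  case (1 s x y zs)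
  then show ?case by (simp add: sum.lessThan_Suc_shift del: sum.lessThan_Suc)
qed auto

text \<open>The closed walk around a cycle \<open>C\<close> is written \<open>C @ [hd C]\<close>;
  the index wraps around only in its last step.\<close>

lemma closed_nth:
  assumes "i < length C"
  shows "(C @ [hd C]) ! i = C ! i" "(C @ [hd C]) ! Suc i = C ! (Suc i mod length C)"
  using assms by (auto simp: nth_append hd_conv_nth mod_if dest: le_antisym)

lemma cycle_edges_walk: "cycle_edges C = walk_edges (C @ [hd C])"
  unfolding cycle_edges_def walk_edges_nth by (auto simp: closed_nth) (metis closed_nth)+

lemma cycle_sum_nth: "walk_sum s (C @ [hd C]) = (\<Sum>i<length C. s (C ! i) (C ! (Suc i mod length C)))"
  unfolding walk_sum_nth by (auto simp: closed_nth intro!: sum.cong)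

text \<open>The form in which cycles are cut and arcs are exchanged later: two vertices
  \<open>p\<close> and \<open>q\<close> and the two arcs between them, the second of which contains
  the closing edge.\<close>

lemma cycle_edges_append: "cycle_edges (p # P @ q # Q) = walk_edges (p # P @ [q]) \<union> walk_edges (q # Q @ [p])"
  unfolding cycle_edges_walk using walk_edges_append[of "p # P" q "Q @ [p]"] by simp

lemma cycle_sum_append:
  "walk_sum s ((p # P @ q # Q) @ [p]) = walk_sum s (p # P @ [q]) + walk_sum s (q # Q @ [p])"
  using walk_sum_append[of s "p # P" q "Q @ [p]"] by simp

lemma cycle_edges_swap: "cycle_edges (A @ B) = cycle_edges (B @ A)"
proof (cases "A = [] \<or> B = []")
  case False
  then obtain p P q Q where "A = p # P" "B = q # Q" by (meson list.exhaust)
  then show ?thesis by (simp add: cycle_edges_append Un_commute)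
qed auto

lemma cycle_sum_swap: "walk_sum s ((A @ B) @ [hd (A @ B)]) = walk_sum s ((B @ A) @ [hd (B @ A)])"
proof (cases "A = [] \<or> B = []")
  case False
  then obtain p P q Q where "A = p # P" "B = q # Q" by (meson list.exhaust)
  then show ?thesis using cycle_sum_append[of s p P q Q] cycle_sum_append[of s q Q p P] by simp
qed auto

lemma cycle_edges_rotate: "cycle_edges (rotate k C) = cycle_edges C"
  by (metis append_take_drop_id cycle_edges_swap rotate_drop_take)

lemma cycle_sum_rotate:
  "walk_sum s (rotate k C @ [hd (rotate k C)]) = walk_sum s (C @ [hd C])"
  by (metis append_take_drop_id cycle_sum_swap rotate_drop_take)

lemma rotate_to:
  assumes "x \<in> set C"
  obtains k D where "rotate k C = x # D"
proof -
  obtain A B where "C = A @ x # B" using assms by (meson split_list)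
  then have "rotate (length A) C = x # B @ A" by (simp add: rotate_append)
  then show ?thesis using that by blast
qed

lemma walk_sum_parity:
  assumes "\<And>x y. {x, y} \<in> walk_edges xs \<Longrightarrow> odd (s x y)" "xs \<noteq> []"
  shows "even (walk_sum s xs) \<longleftrightarrow> odd (length xs)"
  using assms
proof (induction s xs rule: walk_sum.induct)
  case (1 s x y zs)
  have "even (walk_sum s (y # zs)) \<longleftrightarrow> odd (length (y # zs))" using 1 by auto
  moreover have "odd (s x y)" using 1 by auto
  ultimately show ?case by simp
qed auto

text \<open>Divisibility by \<open>d\<close> of \<open>s x y + s y x\<close> is antisymmetry modulo
  \<open>d\<close>; it is used with 2 and 3.\<close>

lemma walk_sum_rev_dvd:
  assumes "\<And>x y. {x, y} \<in> walk_edges xs \<Longrightarrow> d dvd s x y + s y x"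
  shows "d dvd walk_sum s xs + walk_sum s (rev xs)"
  using assms
proof (induction s xs rule: walk_sum.induct)
  case (1 s x y zs)
  have "d dvd walk_sum s (y # zs) + walk_sum s (rev (y # zs))" using 1 by auto
  moreover have "d dvd s x y + s y x" using 1 by auto
  ultimately have "d dvd (walk_sum s (y # zs) + walk_sum s (rev (y # zs))) + (s x y + s y x)"
    by (rule dvd_add)
  then show ?case by (simp add: walk_sum_snoc2 algebra_simps)
qed auto

text \<open>In a walk of minimal length a repeated vertex or a chord would allow a shortcut.\<close>

lemma shortest_walk:
  assumes "xs \<noteq> []" "hd xs = p" "last xs = q" "walk_edges xs \<subseteq> E" "set xs \<subseteq> X"
  obtains ys where "ys \<noteq> []" "hd ys = p" "last ys = q" "walk_edges ys \<subseteq> E" "set ys \<subseteq> X" "distinct ys"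
    "\<And>x y. x \<in> set ys \<Longrightarrow> y \<in> set ys \<Longrightarrow> x \<noteq> y \<Longrightarrow> {x, y} \<in> E \<Longrightarrow> {x, y} \<in> walk_edges ys"
proof -
  define Q where "Q ys \<longleftrightarrow> ys \<noteq> [] \<and> hd ys = p \<and> last ys = q \<and> walk_edges ys \<subseteq> E \<and> set ys \<subseteq> X" for ys
  obtain ys where ys: "Q ys" and min: "\<And>zs. Q zs \<Longrightarrow> length ys \<le> length zs"
    using assms ex_has_least_nat[of Q xs length] by (auto simp: Q_def)
  have dist: "distinct ys"
  proof (rule ccontr)
    assume "\<not> distinct ys"
    then obtain A y B D where d: "ys = A @ [y] @ B @ [y] @ D" using not_distinct_decomp by blast
    have "Q (A @ [y] @ D)"
      using ys walk_edges_append[of A y D] walk_edges_append[of "A @ y # B" y D] walk_edges_append[of A y "B @ y # D"]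
      unfolding Q_def d by (cases A; cases D) auto
    then show False using min d by fastforce
  qed
  have ind: "{x, y} \<in> walk_edges ys" if "x \<in> set ys" "y \<in> set ys" "x \<noteq> y" "{x, y} \<in> E" for x y
  proof -
    have main: "{u, v} \<in> walk_edges ys" if "{u, v} \<in> E" and d: "ys = A @ [u] @ B @ [v] @ D" for u v A B D
    proof (cases "B = []")
      case True then show ?thesis using d walk_edges_append[of A u "v # D"] by simp
    next
      case False
      have "Q (A @ [u, v] @ D)"
        using ys that(1) walk_edges_append[of A u "v # D"] walk_edges_append[of "A @ u # B" v D]
          walk_edges_append[of A u "B @ v # D"]
        unfolding Q_def d by (cases A; cases D) auto
      then show ?thesis using min[of "A @ [u, v] @ D"] d False by (cases B) auto
    qed
    obtain A F where A: "ys = A @ x # F" using split_list[OF \<open>x \<in> set ys\<close>] by blast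
    show ?thesis
    proof (cases "y \<in> set F")
      case True
      then obtain B D where "F = B @ y # D" by (meson split_list)
      then show ?thesis using main[of x y A B D] that A by simp
    next
      case False
      then have "y \<in> set A" using that A by auto
      then obtain B D where "A = B @ y # D" by (meson split_list)
      then show ?thesis using main[of y x B D F] that A by (simp add: insert_commute)
    qed
  qed
  show ?thesis using that ys dist ind unfolding Q_def by blast
qed

section \<open>Closed walks and potentials\<close>

lemma walk_edges_append_walks:
  "xs \<noteq> [] \<Longrightarrow> ys \<noteq> [] \<Longrightarrow>
    walk_edges (xs @ ys) = insert {last xs, hd ys} (walk_edges xs \<union> walk_edges ys)"
  by (induction xs rule: walk_edges.induct) (auto simp: neq_Nil_conv)

lemma walk_sum_append_walks:
  "xs \<noteq> [] \<Longrightarrow> ys \<noteq> [] \<Longrightarrow>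
    walk_sum s (xs @ ys) = walk_sum s xs + s (last xs) (hd ys) + walk_sum s ys"
  by (induction s xs rule: walk_sum.induct) (auto simp: neq_Nil_conv)

lemma walk_sum_telescope: "xs \<noteq> [] \<Longrightarrow> walk_sum (\<lambda>x y. f y - f x) xs = f (last xs) - f (hd xs)"
  by (induction "\<lambda>x y. f y - f x" xs rule: walk_sum.induct) auto

lemma walk_sum_const: "walk_sum (\<lambda>x y. c) xs = c * int (length xs - 1)"
  by (induction "\<lambda>(x::'a) (y::'a). c" xs rule: walk_sum.induct) (auto simp: algebra_simps)

text \<open>A closed walk that repeats a vertex splits there into two shorter ones. What remains are
  cycles and the walk to and fro along an edge, which antisymmetry settles; a closed walk on one
  vertex would need a loop.\<close>

lemma closed_walk_sum_dvd:
  assumes E: "\<And>e. e \<in> E \<Longrightarrow> card e = 2"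
    and anti: "\<And>x y. {x, y} \<in> E \<Longrightarrow> d dvd s x y + s y x"
    and cyc: "\<And>C. is_cycle C \<Longrightarrow> cycle_edges C \<subseteq> E \<Longrightarrow> d dvd walk_sum s (C @ [hd C])"
    and C: "C \<noteq> []" "cycle_edges C \<subseteq> E"
  shows "d dvd walk_sum s (C @ [hd C])"
  using C
proof (induction "length C" arbitrary: C rule: less_induct)
  case less
  show ?case
  proof (cases "distinct C")
    case True
    consider x where "C = [x]" | x y where "C = [x, y]" | "3 \<le> length C"
      using less.prems(1) by (cases C rule: walk_edges.cases) (auto simp: Suc_le_eq numeral_eq_Suc)
    then show ?thesis
    proof cases
      case (1 x)
      then show ?thesis using less.prems E[of "{x}"] by (auto simp: cycle_edges_walk)
    next
      case (2 x y)
      then show ?thesis using less.prems anti[of x y] by (auto simp: cycle_edges_walk)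
    next
      case 3
      then show ?thesis using True less.prems cyc by (auto simp: is_cycle_def)
    qed
  next
    case False
    then obtain A y B D where d: "C = A @ [y] @ B @ [y] @ D" using not_distinct_decomp by blast
    let ?C = "y # B @ y # (D @ A)"
    have r: "rotate (length A) C = ?C" unfolding d by (simp add: rotate_append)
    have "cycle_edges ?C = cycle_edges C" using cycle_edges_rotate[of "length A" C] r by simp
    then have "cycle_edges (y # B) \<subseteq> E" "cycle_edges (y # D @ A) \<subseteq> E"
      using less.prems(2) cycle_edges_append[of y B y "D @ A"] by (auto simp: cycle_edges_walk)
    then have "d dvd walk_sum s (y # B @ [y])" "d dvd walk_sum s (y # (D @ A) @ [y])"
      using less.hyps[of "y # B"] less.hyps[of "y # D @ A"] by (auto simp: d)
    then have "d dvd walk_sum s (?C @ [hd ?C])"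
      using cycle_sum_append[of s y B y "D @ A"] by simp
    then show ?thesis using cycle_sum_rotate[of s "length A" C] r by simp
  qed
qed

text \<open>Integration: if all closed walks have sum 0 modulo \<open>d\<close>, the sum along a
  walk from a fixed root depends only on its end.\<close>

lemma potential_exists:
  fixes s :: "'a \<Rightarrow> 'a \<Rightarrow> int"
  assumes anti: "\<And>x y. {x, y} \<in> E \<Longrightarrow> d dvd s x y + s y x"
    and cyc: "\<And>C. C \<noteq> [] \<Longrightarrow> cycle_edges C \<subseteq> E \<Longrightarrow> d dvd walk_sum s (C @ [hd C])"
  obtains p :: "'a \<Rightarrow> int" where "\<And>x y. {x, y} \<in> E \<Longrightarrow> d dvd p y - p x - s x y"
proof -
  define W where "W x y xs \<longleftrightarrow> xs \<noteq> [] \<and> hd xs = x \<and> last xs = y \<and> walk_edges xs \<subseteq> E" for x y xs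
  define r where "r x = (SOME z. \<exists>xs. W z x xs)" for x
  define w where "w x = (SOME xs. W (r x) x xs)" for x
  define p where "p x = walk_sum s (w x)" for x
  have ext: "\<exists>xs. W z y xs" if "W z x xs" "{x, y} \<in> E" for x y z xs
    using that walk_edges_append_walks[of xs "[y]"] by (intro exI[of _ "xs @ [y]"]) (auto simp: W_def)
  have W: "W (r x) x (w x)" for x
  proof -
    have "W x x [x]" by (simp add: W_def)
    then have "\<exists>z xs. W z x xs" by blast
    then have "\<exists>xs. W (r x) x xs" unfolding r_def by (rule someI_ex)
    then show ?thesis unfolding w_def by (rule someI_ex)
  qed
  have "d dvd p y - p x - s x y" if e: "{x, y} \<in> E" for x y
  proof -
    have e': "{y, x} \<in> E" using e by (simp add: insert_commute)
    \<comment> \<open>Adjacent vertices can be reached from the same roots, so the choice operator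
      picks the same root for both.\<close>
    have "(\<exists>xs. W z x xs) = (\<exists>xs. W z y xs)" for z using ext e e' by blast
    then have r: "r x = r y" by (simp add: r_def)
    note wx = W[of x, unfolded W_def] and wy = W[of y, unfolded W_def]
    let ?D = "w x @ butlast (rev (w y))"
    \<comment> \<open>The closed walk goes along \<open>w x\<close>, over the edge
      \<open>x y\<close> and back along \<open>w y\<close>. The root at its end is dropped because
      the list of a closed walk names its base point once.\<close>
    have "butlast (rev (w y)) @ [r x] = rev (w y)"
      using wy r by (metis append_butlast_last_id last_rev rev_is_Nil_conv)
    moreover have "hd ?D = r x" using wx by simp
    ultimately have D: "?D @ [hd ?D] = w x @ rev (w y)" by simp
    have hr: "hd (rev (w y)) = y" using wy by (simp add: hd_rev)
    have "cycle_edges ?D \<subseteq> E"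
      unfolding cycle_edges_walk D using wx wy e hr
      by (subst walk_edges_append_walks) (auto simp: walk_edges_rev)
    then have "d dvd walk_sum s (w x @ rev (w y))" using cyc[of ?D] D wx by auto
    then have 1: "d dvd p x + s x y + walk_sum s (rev (w y))"
      using wx wy hr by (subst (asm) walk_sum_append_walks) (auto simp: p_def)
    have 2: "d dvd p y + walk_sum s (rev (w y))"
      unfolding p_def by (rule walk_sum_rev_dvd) (use anti wy in auto)
    have "d dvd (p y + walk_sum s (rev (w y))) - (p x + s x y + walk_sum s (rev (w y)))"
      using 2 1 by (rule dvd_diff)
    then show ?thesis by (simp add: algebra_simps)
  qed
  then show ?thesis using that by blast
qed

section \<open>Arcs and chords of cycles\<close>

lemma walk_edges_inner:
  assumes "e \<in> walk_edges (p # P @ [q])" "P \<noteq> []"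
  shows "e \<inter> set P \<noteq> {}"
proof -
  obtain i where i: "Suc i < length (p # P @ [q])" "e = {(p # P @ [q]) ! i, (p # P @ [q]) ! Suc i}"
    using assms(1) unfolding walk_edges_nth by auto
  show ?thesis
  proof (cases i)
    case 0
    then show ?thesis using i assms(2) by (auto simp: nth_append)
  next
    case (Suc j)
    then show ?thesis using i by (auto simp: nth_append)
  qed
qed

lemma cycle_edge_endpoints:
  assumes "distinct (p # P @ q # Q)" "{p, q} \<in> cycle_edges (p # P @ q # Q)"
  shows "P = [] \<or> Q = []"
  using assms walk_edges_inner[of "{p, q}" p P q] walk_edges_inner[of "{p, q}" q Q p]
  by (auto simp: cycle_edges_append)

lemma cycle_split2:
  assumes "x \<in> set C" "y \<in> set C" "x \<noteq> y" "distinct C"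
  obtains k P Q where "rotate k C = x # P @ y # Q" "distinct (x # P @ y # Q)"
proof -
  obtain k D where k: "rotate k C = x # D" using rotate_to[OF assms(1)] .
  then have "y \<in> set D" using assms by (metis set_ConsD set_rotate)
  then obtain P Q where "D = P @ y # Q" by (meson split_list)
  then show ?thesis using that k assms(4) by (metis distinct_rotate)
qed

lemma cycle_nbr:
  assumes "distinct (x # D)" "2 \<le> length D" "{x, y} \<in> cycle_edges (x # D)"
  shows "y = hd D \<or> y = last D"
proof -
  obtain z D' where D: "D = z # D'" using assms(2) by (cases D) auto
  have D': "D' \<noteq> []" using assms(2) D by auto
  have "walk_edges (z # D' @ [x]) = insert {last (z # D'), x} (walk_edges (z # D'))"
    using walk_edges_append_walks[of "z # D'" "[x]"] by auto
  then have "{x, y} = {x, z} \<or> {x, y} = {last (z # D'), x} \<or> {x, y} \<in> walk_edges (z # D')"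
    using assms(3) by (simp add: cycle_edges_walk D)
  then show ?thesis using walk_edges_subset[of "{x, y}" "z # D'"] assms(1) D by (auto simp: doubleton_eq_iff)
qed

text \<open>One of the arcs between \<open>x\<close> and \<open>z\<close> is the edge
  \<open>x z\<close>, so \<open>y\<close> lies on the other. There \<open>y\<close> is adjacent to
  both ends along the cycle, which leaves no room for further vertices.\<close>

lemma cycle_triangle:
  assumes C: "is_cycle C" and d: "x \<noteq> y" "y \<noteq> z" "x \<noteq> z"
    and e: "{x, y} \<in> cycle_edges C" "{y, z} \<in> cycle_edges C" "{x, z} \<in> cycle_edges C"
  shows "length C = 3"
proof -
  have dist: "distinct C" and n: "3 \<le> length C" using C by (auto simp: is_cycle_def)
  have sub: "e \<subseteq> set C" if "e \<in> cycle_edges C" for e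
    using that walk_edges_subset[of e "C @ [hd C]"] n by (cases C) (auto simp: cycle_edges_walk)
  have in_C: "x \<in> set C" "y \<in> set C" "z \<in> set C" using sub[OF e(1)] sub[OF e(2)] by auto
  obtain k P Q where k: "rotate k C = x # P @ z # Q" "distinct (x # P @ z # Q)"
    using cycle_split2[OF in_C(1,3) d(3) dist] .
  have ce: "cycle_edges (x # P @ z # Q) = cycle_edges C" using cycle_edges_rotate[of k C] k by simp
  have set: "set (x # P @ z # Q) = set C" using k by (metis set_rotate)
  have len: "length (x # P @ z # Q) = length C" using k by (metis length_rotate)
  have PQ: "P = [] \<or> Q = []" using cycle_edge_endpoints[OF k(2)] e(3) ce by simp
  have "y \<in> set P \<union> set Q" using in_C(2) set d by auto
  then consider A B where "P = A @ y # B" "Q = []" | A B where "Q = A @ y # B" "P = []"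
    using PQ by (auto dest!: split_list)
  then show ?thesis
  proof cases
    case 1
    have "A = []" using cycle_edge_endpoints[of x A y "B @ [z]"] k(2) 1 e(1) ce by auto
    moreover have "B = []"
      using cycle_edge_endpoints[of y B z "x # A"] k(2) 1 e(2) ce cycle_edges_swap[of "x # A" "y # B @ [z]"] by auto
    ultimately show ?thesis using len 1 by simp
  next
    case 2
    have "B = []" using cycle_edge_endpoints[of x "z # A" y B] k(2) 2 e(1) ce by auto
    moreover have "A = []"
      using cycle_edge_endpoints[of z A y "B @ [x]"] k(2) 2 e(2) ce cycle_edges_swap[of "[x]" "z # A @ y # B"]
      by (auto simp: insert_commute)
    ultimately show ?thesis using len 2 by simp
  qed
qed

lemma cycle_edges_subset: "e \<in> cycle_edges C \<Longrightarrow> e \<subseteq> set C"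
  unfolding cycle_edges_def by auto (metis length_pos_if_in_set mod_less_divisor nth_mem length_greater_0_conv list.size(3) not_less_zero)+

lemma induced_cycle_rotate: "induced_cycle V E (rotate k C) \<longleftrightarrow> induced_cycle V E C"
  by (simp add: induced_cycle_def is_cycle_def cycle_edges_rotate)

text \<open>A shortest odd closed walk is an induced cycle. If there is no odd closed walk, the
  constant function 1 has a potential modulo 2, which is a bipartition.\<close>

lemma odd_cycle_or_bipartite:
  assumes E: "\<And>e. e \<in> E \<Longrightarrow> card e = 2"
  obtains C where "induced_cycle S E C" "odd (length C)"
  | f :: "'a \<Rightarrow> int" where "\<And>x y. x \<in> S \<Longrightarrow> y \<in> S \<Longrightarrow> {x, y} \<in> E \<Longrightarrow> odd (f y - f x)"
proof -
  define Q where "Q C \<longleftrightarrow> C \<noteq> [] \<and> cycle_edges C \<subseteq> induced_edges E S \<and> odd (length C)" for C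
  show ?thesis
  proof (cases "\<exists>C. Q C")
    case False
    have "2 dvd walk_sum (\<lambda>x y. 1) (C @ [hd C])" if "C \<noteq> []" "cycle_edges C \<subseteq> induced_edges E S" for C
      using that False by (auto simp: Q_def walk_sum_const)
    from potential_exists[of "induced_edges E S" 2 "\<lambda>x y. 1", OF _ this]
    obtain p :: "'a \<Rightarrow> int" where "\<And>x y. {x, y} \<in> induced_edges E S \<Longrightarrow> 2 dvd p y - p x - 1" by auto
    then have "odd (p y - p x)" if "x \<in> S" "y \<in> S" "{x, y} \<in> E" for x y
      using that unfolding induced_edges_def by fastforce
    then show ?thesis using that(2) by blast
  next
    case True
    then obtain C where C: "Q C" and min: "\<And>D. Q D \<Longrightarrow> length C \<le> length D"
      using ex_has_least_nat[of Q _ length] by metis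
    \<comment> \<open>Both kinds of shortcut at once: \<open>y = z\<close> is a repeated vertex, and
      otherwise \<open>y z\<close> is a chord. The lengths of the two pieces add up to
      \<open>length C\<close> or \<open>length C + 2\<close>, so one piece is odd, and it is shorter
      than \<open>C\<close>.\<close>
    have split: False if r: "rotate k C = y # P @ z # R" and ne: "y \<noteq> z \<longrightarrow> {y, z} \<in> induced_edges E S \<and> P \<noteq> [] \<and> R \<noteq> []" for k y z P R
    proof (cases "y = z")
      case True
      have "cycle_edges (y # P @ z # R) = cycle_edges C" using cycle_edges_rotate[of k C] r by simp
      then have "cycle_edges (y # P) \<subseteq> induced_edges E S" "cycle_edges (y # R) \<subseteq> induced_edges E S"
        using C True cycle_edges_append[of y P z R] by (auto simp: Q_def cycle_edges_walk)
      moreover have "length C = length P + length R + 2" using arg_cong[OF r, of length] by simp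
      ultimately show False using C min[of "y # P"] min[of "y # R"] by (auto simp: Q_def)
    next
      case False
      have "cycle_edges (y # P @ z # R) = cycle_edges C" using cycle_edges_rotate[of k C] r by simp
      then have "cycle_edges (y # P @ [z]) \<subseteq> induced_edges E S" "cycle_edges (z # R @ [y]) \<subseteq> induced_edges E S"
        using C False ne cycle_edges_append[of y P z R] cycle_edges_append[of y P z "[]"] cycle_edges_append[of z R y "[]"]
        by (auto simp: Q_def insert_commute)
      moreover have "length C = length P + length R + 2" using arg_cong[OF r, of length] by simp
      ultimately show False using C min[of "y # P @ [z]"] min[of "z # R @ [y]"] False ne
        by (cases P; cases R) (auto simp: Q_def)
    qed
    have dist: "distinct C"
    proof (rule ccontr)
      assume "\<not> distinct C"
      then obtain A y B D where "C = A @ [y] @ B @ [y] @ D" using not_distinct_decomp by blast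
      then have "rotate (length A) C = y # B @ y # (D @ A)" by (simp add: rotate_append)
      then show False using split by blast
    qed
    have len: "3 \<le> length C"
    proof -
      have "length C \<noteq> 1"
      proof
        assume "length C = 1"
        then obtain x where "C = [x]" by (auto simp: length_Suc_conv)
        then show False using C E[of "{x}"] by (auto simp: Q_def cycle_edges_walk induced_edges_def)
      qed
      moreover have "length C \<noteq> 2" "length C \<noteq> 0" using C by (auto simp: Q_def)
      ultimately show ?thesis by linarith
    qed
    have SC: "set C \<subseteq> S"
    proof
      fix x assume "x \<in> set C"
      then obtain i where "i < length C" "C ! i = x" by (auto simp: in_set_conv_nth)
      then have "{x, C ! (Suc i mod length C)} \<in> cycle_edges C" by (auto simp: cycle_edges_def)
      then show "x \<in> S" using C by (auto simp: Q_def induced_edges_def)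
    qed
    have "e \<in> cycle_edges C" if e: "e \<in> E" "e \<subseteq> set C" for e
    proof (rule ccontr)
      assume n: "e \<notin> cycle_edges C"
      obtain x y where xy: "e = {x, y}" "x \<noteq> y" using E[OF e(1)] by (auto simp: card_2_iff)
      then have "x \<in> set C" "y \<in> set C" using e by auto
      from cycle_split2[OF this xy(2) dist] obtain k P R
        where k: "rotate k C = x # P @ y # R" "distinct (x # P @ y # R)" .
      have "cycle_edges (x # P @ y # R) = cycle_edges C" using cycle_edges_rotate[of k C] k by simp
      then have "P \<noteq> []" "R \<noteq> []" using n xy cycle_edges_append[of x P y R] by (auto simp: insert_commute)
      moreover have "{x, y} \<in> induced_edges E S" using e xy SC by (auto simp: induced_edges_def)
      ultimately show False using split[OF k(1)] by blast
    qed
    then have "induced_edges E (set C) = cycle_edges C"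
      using C cycle_edges_subset[of _ C] unfolding induced_edges_def Q_def by blast
    then show ?thesis using that(1)[of C] C dist len SC by (auto simp: induced_cycle_def is_cycle_def Q_def)
  qed
qed

section \<open>Loose odd wheels\<close>

text \<open>A rim edge with both ends adjacent to the hub is a segment of length 1, so three of them
  suffice. Every loose odd wheel that the proof constructs is of this kind.\<close>

lemma induced_loose_odd_wheel:
  assumes V: "sgraph V E" and C: "induced_cycle V E C" "odd (length C)"
    and v: "v \<in> V" "v \<notin> set C"
    and I: "3 \<le> card {i. i < length C \<and> {v, C ! i} \<in> E \<and> {v, C ! (Suc i mod length C)} \<in> E}"
  shows "has_induced_loose_odd_wheel V E"
proof -
  define n where "n = length C"
  define N where "N = {u \<in> set C. {v, u} \<in> E}"
  define I where "I = {i. i < n \<and> {v, C ! i} \<in> E \<and> {v, C ! (Suc i mod n)} \<in> E}"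
  have dist: "distinct C" and n: "3 \<le> n" and CV: "set C \<subseteq> V"
    and ind: "induced_edges E (set C) = cycle_edges C"
    using C by (auto simp: induced_cycle_def is_cycle_def n_def)
  have fI: "finite I" and I3: "3 \<le> card I" using I by (auto simp: I_def n_def)
  have mem: "C ! i \<in> set C" "C ! (Suc i mod n) \<in> set C" if "i < n" for i
  proof -
    have "Suc i mod n < n" using n by (intro mod_less_divisor) simp
    then show "C ! i \<in> set C" "C ! (Suc i mod n) \<in> set C" using that unfolding n_def by simp_all
  qed
  have "inj_on ((!) C) I" using dist by (auto simp: inj_on_def I_def n_def nth_eq_iff_index_eq)
  moreover have "(!) C ` I \<subseteq> N" using mem by (auto simp: I_def N_def)
  ultimately have N3: "3 \<le> card N"
    using I3 card_inj_on_le[of "(!) C" I N] by (simp add: N_def)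
  define P where "P i = take 2 (rotate i C)" for i
  have P: "P i = [C ! i, C ! (Suc i mod n)]" if "i < n" for i
  proof (rule nth_equalityI)
    show "length (P i) = length [C ! i, C ! (Suc i mod n)]" using n by (simp add: P_def n_def)
    fix j assume "j < length (P i)"
    then have "j < 2" by (simp add: P_def)
    moreover have "rotate i C ! j = C ! ((i + j) mod n)"
      unfolding n_def using \<open>j < 2\<close> n by (intro nth_rotate) (simp add: n_def)
    ultimately show "P i ! j = [C ! i, C ! (Suc i mod n)] ! j"
      using that by (auto simp: P_def less_2_cases_iff)
  qed
  have fin: "finite (segments C N)"
  proof (rule finite_subset)
    show "segments C N \<subseteq> (\<lambda>(i, k). take k (rotate i C)) ` ({..<n} \<times> {..n})"
      by (auto simp: segments_def n_def)
  qed auto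
  have "inj_on P I" using dist by (auto simp: inj_on_def I_def P n_def nth_eq_iff_index_eq)
  moreover have "P ` I \<subseteq> {P \<in> segments C N. odd (length P - 1)}"
  proof
    fix Q assume "Q \<in> P ` I"
    then obtain i where i: "i \<in> I" "Q = P i" by auto
    then have "i < n" by (simp add: I_def)
    then have "hd (P i) \<in> N" "last (P i) \<in> N" "set (P i) - {hd (P i), last (P i)} = {}"
      using mem i by (auto simp: P N_def I_def)
    then have "\<exists>j k. j < length C \<and> 2 \<le> k \<and> k \<le> length C \<and> P i = take k (rotate j C) \<and>
        hd (P i) \<in> N \<and> last (P i) \<in> N \<and> (\<forall>u \<in> set (P i) - {hd (P i), last (P i)}. u \<notin> N)"
      using \<open>i < n\<close> n by - (rule exI[of _ i], rule exI[of _ "2::nat"], auto simp: n_def P_def)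
    then have "P i \<in> segments C N" unfolding segments_def by blast
    then show "Q \<in> {P \<in> segments C N. odd (length P - 1)}" using i P[OF \<open>i < n\<close>] by simp
  qed
  ultimately have S3: "3 \<le> card {P \<in> segments C N. odd (length P - 1)}"
    using I3 card_inj_on_le[of P I "{P \<in> segments C N. odd (length P - 1)}"] fin by simp
  have "induced_edges E (insert v (set C)) = cycle_edges C \<union> {{v, u} | u. u \<in> N}"
  proof -
    have "e = {v, u} \<and> u \<in> N" if "e \<in> E" "e \<subseteq> insert v (set C)" "v \<in> e" "u \<in> e" "u \<noteq> v" for e u
    proof -
      have "card e = 2" using V that by (auto simp: sgraph_def)
      then have "e = {v, u}" using that by (auto simp: card_2_iff)
      then show ?thesis using that by (auto simp: N_def)
    qed
    moreover have "\<exists>u\<in>e. u \<noteq> v" if "e \<in> E" for e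
    proof -
      have "card e = 2" using V that by (auto simp: sgraph_def)
      then show ?thesis by (auto simp: card_2_iff)
    qed
    ultimately have "e \<in> cycle_edges C \<union> {{v, u} | u. u \<in> N}"
      if "e \<in> induced_edges E (insert v (set C))" for e
    proof (cases "v \<in> e")
      case True
      then show ?thesis using that \<open>\<And>e. e \<in> E \<Longrightarrow> \<exists>u\<in>e. u \<noteq> v\<close>[of e]
          \<open>\<And>u e. e \<in> E \<Longrightarrow> e \<subseteq> insert v (set C) \<Longrightarrow> v \<in> e \<Longrightarrow> u \<in> e \<Longrightarrow> u \<noteq> v \<Longrightarrow> e = {v, u} \<and> u \<in> N\<close>[of e]
        unfolding induced_edges_def by blast
    next
      case False
      then have "e \<in> induced_edges E (set C)" using that by (auto simp: induced_edges_def)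
      then show ?thesis using ind by simp
    qed
    moreover have "cycle_edges C \<subseteq> induced_edges E (insert v (set C))"
      unfolding ind[symmetric] induced_edges_def by auto
    moreover have "{v, u} \<in> induced_edges E (insert v (set C))" if "u \<in> N" for u
      using that by (auto simp: induced_edges_def N_def)
    ultimately show ?thesis by blast
  qed
  then have "loose_wheel C v N (insert v (set C)) (induced_edges E (insert v (set C)))"
    using C v N3 by (auto simp: loose_wheel_def induced_cycle_def N_def)
  then have "loose_odd_wheel (insert v (set C)) (induced_edges E (insert v (set C)))"
    unfolding loose_odd_wheel_def using C(2) S3 by blast
  then show ?thesis unfolding has_induced_loose_odd_wheel_def using CV v by blast
qed

lemma induced_loose_odd_wheelE:
  assumes V: "sgraph V E" and H: "has_induced_loose_odd_wheel V E"
  obtains C v N where "induced_cycle V E C" "odd (length C)" "v \<in> V" "v \<notin> set C"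
    "N = {u \<in> set C. {v, u} \<in> E}" "3 \<le> card N"
    "3 \<le> card {P \<in> segments C N. odd (length P - 1)}"
proof -
  obtain S C v N where S: "S \<subseteq> V" "odd (length C)" "3 \<le> card {P \<in> segments C N. odd (length P - 1)}"
    and w: "loose_wheel C v N S (induced_edges E S)"
    using H unfolding has_induced_loose_odd_wheel_def loose_odd_wheel_def by blast
  have c: "is_cycle C" "v \<notin> set C" "N \<subseteq> set C" "3 \<le> card N" "S = insert v (set C)"
    "induced_edges E S = cycle_edges C \<union> {{v, u} | u. u \<in> N}"
    using w by (auto simp: loose_wheel_def)
  have "induced_edges E (set C) = {e \<in> induced_edges E S. v \<notin> e}"
    using c by (auto simp: induced_edges_def)
  also have "\<dots> = cycle_edges C" using c cycle_edges_subset[of _ C] by auto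
  finally have "induced_cycle V E C" using c S by (auto simp: induced_cycle_def)
  moreover have "N = {u \<in> set C. {v, u} \<in> E}"
  proof -
    have "{v, u} \<in> E \<longleftrightarrow> {v, u} \<in> induced_edges E S" if "u \<in> set C" for u
      using that c by (auto simp: induced_edges_def)
    moreover have "{v, u} \<in> induced_edges E S \<longleftrightarrow> u \<in> N" if "u \<in> set C" for u
      using that c cycle_edges_subset[of "{v, u}" C] by (auto simp: doubleton_eq_iff)
    ultimately show ?thesis using c by auto
  qed
  ultimately show ?thesis using that c S by auto
qed

section \<open>Perfection\<close>

lemma clique_induced_edges: "K \<subseteq> S \<Longrightarrow> clique K (induced_edges E S) \<longleftrightarrow> clique K E"
  unfolding clique_def induced_edges_def by blast

lemma colourable_mono: "colourable S F k \<Longrightarrow> k \<le> l \<Longrightarrow> colourable S F l"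
  unfolding colourable_def by (metis lessThan_subset_iff subset_trans)

lemma colourable_clique:
  assumes "colourable S F k" "K \<subseteq> S" "clique K F"
  shows "card K \<le> k"
proof -
  obtain f where f: "f ` S \<subseteq> {..<k}" "\<And>u v. u \<in> S \<Longrightarrow> v \<in> S \<Longrightarrow> {u, v} \<in> F \<Longrightarrow> f u \<noteq> f v"
    using assms(1) unfolding colourable_def by blast
  have "inj_on f K" using f assms(2,3) unfolding inj_on_def clique_def by blast
  moreover have "f ` K \<subseteq> {..<k}" using f assms(2) by blast
  ultimately show ?thesis using card_inj_on_le[of f K "{..<k}"] by simp
qed

lemma colourable_chromatic:
  fixes S :: "'a::finite set"
  assumes "\<And>u. {u} \<notin> F"
  shows "colourable S F (chromatic_number S F)"
proof -
  obtain f :: "'a \<Rightarrow> nat" where f: "inj f" using finite_imp_inj_to_nat_seg[of "UNIV :: 'a set"] by auto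
  have "\<forall>u\<in>S. \<forall>v\<in>S. {u, v} \<in> F \<longrightarrow> f u \<noteq> f v"
  proof (intro ballI impI notI)
    fix u v assume uv: "{u, v} \<in> F" "f u = f v"
    then have "u = v" using f by (auto simp: inj_on_def)
    then have "{u} \<in> F" using uv by simp
    then show False using assms by blast
  qed
  moreover have "f ` S \<subseteq> {..<Suc (Max (f ` S))}"
    by (auto simp: less_Suc_eq_le)
  ultimately have "colourable S F (Suc (Max (f ` S)))" unfolding colourable_def by blast
  then show ?thesis unfolding chromatic_number_def by (rule LeastI)
qed

lemma clique_number_props:
  fixes S :: "'a::finite set"
  shows "\<exists>K\<subseteq>S. clique K F \<and> card K = clique_number S F"
    and "K \<subseteq> S \<Longrightarrow> clique K F \<Longrightarrow> card K \<le> clique_number S F"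
proof -
  have fin: "finite {card K | K. K \<subseteq> S \<and> clique K F}" by simp
  have "card {} \<in> {card K | K. K \<subseteq> S \<and> clique K F}" by (auto simp: clique_def intro!: exI[of _ "{}"])
  then have "clique_number S F \<in> {card K | K. K \<subseteq> S \<and> clique K F}"
    unfolding clique_number_def using fin Max_in by blast
  then show "\<exists>K\<subseteq>S. clique K F \<and> card K = clique_number S F" by auto
  show "K \<subseteq> S \<Longrightarrow> clique K F \<Longrightarrow> card K \<le> clique_number S F"
    unfolding clique_number_def using fin by (intro Max_ge) auto
qed

lemma perfectI:
  fixes V :: "'a::finite set"
  assumes "\<And>u. {u} \<notin> E"
    and "\<And>S. S \<subseteq> V \<Longrightarrow> colourable S (induced_edges E S) (clique_number S (induced_edges E S))"
  shows "perfect V E"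
  unfolding perfect_def
proof (intro allI impI)
  fix S assume S: "S \<subseteq> V"
  let ?F = "induced_edges E S"
  obtain K where K: "K \<subseteq> S" "clique K ?F" "card K = clique_number S ?F"
    using clique_number_props(1)[of S ?F] by auto
  have "chromatic_number S ?F \<le> clique_number S ?F"
    unfolding chromatic_number_def using assms(2)[OF S] by (rule Least_le)
  moreover have "colourable S ?F (chromatic_number S ?F)"
    by (rule colourable_chromatic) (use assms(1) in \<open>auto simp: induced_edges_def\<close>)
  then have "clique_number S ?F \<le> chromatic_number S ?F" using colourable_clique K by metis
  ultimately show "chromatic_number S ?F = clique_number S ?F" by simp
qed

lemma perfect_colouring:
  fixes V :: "'a::finite set"
  assumes "\<And>u. {u} \<notin> E" "perfect V E" "S \<subseteq> V" "\<And>K. K \<subseteq> S \<Longrightarrow> clique K E \<Longrightarrow> card K \<le> N"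
  shows "\<exists>f. f ` S \<subseteq> {..<N} \<and> (\<forall>u\<in>S. \<forall>v\<in>S. {u, v} \<in> E \<longrightarrow> f u \<noteq> f v)"
proof -
  let ?F = "induced_edges E S"
  have "colourable S ?F (chromatic_number S ?F)"
    by (rule colourable_chromatic) (use assms(1) in \<open>auto simp: induced_edges_def\<close>)
  moreover have "chromatic_number S ?F = clique_number S ?F"
    using assms(2,3) by (simp add: perfect_def)
  moreover have "clique_number S ?F \<le> N"
    using clique_number_props(1)[of S ?F] assms(4) clique_induced_edges by metis
  ultimately have "colourable S ?F N" using colourable_mono by metis
  then show ?thesis by (auto simp: colourable_def induced_edges_def)
qed

text \<open>An induced subgraph that has an odd cycle contains a triangle by \<open>hole\<close>,
  and three colours match its clique number. Otherwise it is bipartite, and the clique number is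
  decided by whether it has an edge or a vertex at all.\<close>

lemma three_colourable_perfect:
  fixes V :: "'a::finite set" and f :: "'a \<Rightarrow> nat"
  assumes V: "sgraph V E"
    and f: "\<And>v. v \<in> V \<Longrightarrow> f v < 3" "\<And>u v. {u, v} \<in> E \<Longrightarrow> f u \<noteq> f v"
    and hole: "\<And>C. induced_cycle V E C \<Longrightarrow> odd (length C) \<Longrightarrow> length C = 3"
  shows "perfect V E"
proof (rule perfectI)
  show "{u} \<notin> E" for u using V by (auto simp: sgraph_def)
  fix S assume S: "S \<subseteq> V"
  let ?F = "induced_edges E S" and ?w = "clique_number S (induced_edges E S)"
  have w: "card K \<le> ?w" if "K \<subseteq> S" "clique K E" for K
    using clique_number_props(2)[of K S ?F] that clique_induced_edges by blast
  have E2: "card e = 2" if "e \<in> E" for e using that V by (auto simp: sgraph_def)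
  from odd_cycle_or_bipartite[OF E2] consider
    C where "induced_cycle S E C" "odd (length C)"
    | g :: "'a \<Rightarrow> int" where "\<And>x y. x \<in> S \<Longrightarrow> y \<in> S \<Longrightarrow> {x, y} \<in> E \<Longrightarrow> odd (g y - g x)"
    by metis
  then show "colourable S ?F ?w"
  proof cases
    case (1 C)
    then have "induced_cycle V E C" using S by (auto simp: induced_cycle_def)
    then have "length C = 3" using hole 1 by blast
    then obtain a b c where abc: "C = [a, b, c]" by (auto simp: length_Suc_conv numeral_eq_Suc)
    then have "cycle_edges C = {{a, b}, {b, c}, {c, a}}" by (simp add: cycle_edges_walk)
    then have "{{a, b}, {b, c}, {c, a}} \<subseteq> E" "distinct [a, b, c]" "{a, b, c} \<subseteq> S"
      using 1 abc by (auto simp: induced_cycle_def is_cycle_def induced_edges_def)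
    then have "3 \<le> ?w" using w[of "{a, b, c}"] by (auto simp: clique_def insert_commute)
    moreover have "colourable S ?F 3"
      unfolding colourable_def using f S by (intro exI[of _ f]) (auto simp: induced_edges_def)
    ultimately show ?thesis using colourable_mono by blast
  next
    case (2 g)
    show ?thesis
    proof (cases "?F = {}")
      case True
      show ?thesis
      proof (cases "S = {}")
        case True
        then show ?thesis by (auto simp: colourable_def)
      next
        case False
        then obtain x where "x \<in> S" by blast
        then have "1 \<le> ?w" using w[of "{x}"] by (auto simp: clique_def)
        moreover have "colourable S ?F 1"
          unfolding colourable_def True by (intro exI[of _ "\<lambda>_. 0"]) auto
        ultimately show ?thesis using colourable_mono by blast
      qed
    next
      case False
      then obtain e where e: "e \<in> E" "e \<subseteq> S" by (auto simp: induced_edges_def)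
      then obtain x y where "e = {x, y}" "x \<noteq> y" using E2[OF e(1)] by (auto simp: card_2_iff)
      then have "2 \<le> ?w" using w[of e] e E2[of e] by (auto simp: clique_def insert_commute)
      moreover have "colourable S ?F 2"
        unfolding colourable_def
      proof (intro exI[of _ "\<lambda>v. if even (g v) then 0 else 1"] conjI ballI impI)
        fix u v assume "u \<in> S" "v \<in> S" "{u, v} \<in> ?F"
        then have "odd (g v - g u)" using 2 by (auto simp: induced_edges_def)
        then show "(if even (g u) then 0 else 1) \<noteq> (if even (g v) then 0 else (1::nat))" by auto
      qed auto
      ultimately show ?thesis using colourable_mono by blast
    qed
  qed
qed

text \<open>A longer odd induced cycle contains no triangle, so perfection would give it a
  2-colouring. Then the colour differences along the cycle are odd and odd in number, yet they sum
  to 0.\<close>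

lemma perfect_odd_cycle:
  fixes V :: "'a::finite set"
  assumes V: "sgraph V E" and p: "perfect V E" and C: "induced_cycle V E C" "odd (length C)"
  shows "length C = 3"
proof (rule ccontr)
  assume n3: "length C \<noteq> 3"
  have E2: "card e = 2" if "e \<in> E" for e using that V by (auto simp: sgraph_def)
  have cyc: "is_cycle C" "set C \<subseteq> V" and ind: "induced_edges E (set C) = cycle_edges C"
    using C by (auto simp: induced_cycle_def)
  have "card K \<le> 2" if K: "K \<subseteq> set C" "clique K E" for K
  proof (rule ccontr)
    assume "\<not> card K \<le> 2"
    then have "3 \<le> card K" by simp
    then obtain T where "T \<subseteq> K" "card T = 3" by (meson obtain_subset_with_card_n)
    then obtain a b c where abc: "T = {a, b, c}" "a \<noteq> b" "b \<noteq> c" "a \<noteq> c" by (auto simp: card_3_iff)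
    have "{a, b} \<in> E" "{b, c} \<in> E" "{a, c} \<in> E" using K abc \<open>T \<subseteq> K\<close> by (auto simp: clique_def)
    then have "{a, b} \<in> cycle_edges C" "{b, c} \<in> cycle_edges C" "{a, c} \<in> cycle_edges C"
      unfolding ind[symmetric] using K abc \<open>T \<subseteq> K\<close> by (auto simp: induced_edges_def)
    from cycle_triangle[OF cyc(1) abc(2-4) this] show False using n3 by simp
  qed
  moreover have "{u} \<notin> E" for u using E2[of "{u}"] by auto
  ultimately have "\<exists>f. f ` set C \<subseteq> {..<2::nat} \<and> (\<forall>u\<in>set C. \<forall>v\<in>set C. {u, v} \<in> E \<longrightarrow> f u \<noteq> f v)"
    using perfect_colouring[OF _ p cyc(2)] by blast
  then obtain f :: "'a \<Rightarrow> nat"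
    where f: "f ` set C \<subseteq> {..<2}" "\<And>u v. u \<in> set C \<Longrightarrow> v \<in> set C \<Longrightarrow> {u, v} \<in> E \<Longrightarrow> f u \<noteq> f v"
    by blast
  have "odd (int (f y) - int (f x))" if "{x, y} \<in> walk_edges (C @ [hd C])" for x y
  proof -
    have "{x, y} \<in> E" "x \<in> set C" "y \<in> set C" using that unfolding cycle_edges_walk[symmetric] ind[symmetric]
      by (auto simp: induced_edges_def)
    then have "f x \<noteq> f y" "f x < 2" "f y < 2" using f by auto
    then show ?thesis by (auto simp: less_2_cases_iff)
  qed
  from walk_sum_parity[of "C @ [hd C]" "\<lambda>x y. int (f y) - int (f x)", OF this]
  have "even (walk_sum (\<lambda>x y. int (f y) - int (f x)) (C @ [hd C])) \<longleftrightarrow> even (length C)" by simp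
  moreover have "walk_sum (\<lambda>x y. int (f y) - int (f x)) (C @ [hd C]) = 0"
    using walk_sum_telescope[of "C @ [hd C]" "\<lambda>x. int (f x)"] by (cases C) auto
  ultimately show False using C by simp
qed

lemma perfect_no_loose_odd_wheel:
  fixes V :: "'a::finite set"
  assumes V: "sgraph V E" and p: "perfect V E" and K4: "\<not> contains_K4 V E"
  shows "\<not> has_induced_loose_odd_wheel V E"
proof
  assume H: "has_induced_loose_odd_wheel V E"
  obtain C v N where
    C: "induced_cycle V E C" "odd (length C)" and v: "v \<in> V" "v \<notin> set C"
    and N: "N = {u \<in> set C. {v, u} \<in> E}" "3 \<le> card N"
    and "3 \<le> card {P \<in> segments C N. odd (length P - 1)}"
    by (rule induced_loose_odd_wheelE[OF V H])
  have l: "length C = 3" using perfect_odd_cycle[OF V p C] .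
  have cyc: "is_cycle C" "set C \<subseteq> V" and ind: "induced_edges E (set C) = cycle_edges C"
    using C by (auto simp: induced_cycle_def)
  have card: "card (set C) = 3" using cyc l by (simp add: is_cycle_def distinct_card)
  have "N \<subseteq> set C" using N by auto
  then have NC: "N = set C" using N(2) card by (intro card_seteq) auto
  have vE: "{v, u} \<in> E" if "u \<in> set C" for u using that N(1) unfolding NC by blast
  obtain a b c where abc: "C = [a, b, c]" using l by (auto simp: length_Suc_conv numeral_eq_Suc)
  then have "cycle_edges C = {{a, b}, {b, c}, {c, a}}" by (simp add: cycle_edges_walk)
  then have "{{a, b}, {b, c}, {c, a}} \<subseteq> E" using ind by (auto simp: induced_edges_def)
  then have "clique (insert v (set C)) E"
    using vE abc by (auto simp: clique_def insert_commute)
  moreover have "card (insert v (set C)) = 4" using card v by simp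
  ultimately show False using K4 v cyc unfolding contains_K4_def by blast
qed

section \<open>Perfect graphs without K4 are t-perfect\<close>

definition stable_set :: "'a set set \<Rightarrow> 'a set \<Rightarrow> bool" where
  "stable_set E A \<longleftrightarrow> (\<forall>u\<in>A. \<forall>v\<in>A. {u, v} \<notin> E)"

lemma card_clique_stable: "clique K E \<Longrightarrow> stable_set E A \<Longrightarrow> card (K \<inter> A) \<le> 1"
proof (rule ccontr)
  assume K: "clique K E" "stable_set E A" "\<not> card (K \<inter> A) \<le> 1"
  then have "2 \<le> card (K \<inter> A)" by simp
  then obtain T where T: "T \<subseteq> K \<inter> A" "card T = 2" by (meson obtain_subset_with_card_n)
  then obtain u v where "T = {u, v}" "u \<noteq> v" by (auto simp: card_2_iff)
  then show False using K(1,2) T(1) unfolding clique_def stable_set_def by blast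
qed

text \<open>Lovasz's replication argument, for vertex weights instead of replicated vertices.\<close>

lemma weighted_colouring:
  fixes V :: "'a::finite set" and q :: "'a \<Rightarrow> nat"
  assumes loop: "\<And>u. {u} \<notin> E" and perf: "perfect V E"
    and "\<And>K. K \<subseteq> V \<Longrightarrow> clique K E \<Longrightarrow> sum q K \<le> N"
  obtains f where "\<And>i. i < N \<Longrightarrow> f i \<subseteq> V \<and> stable_set E (f i)" "\<And>v. v \<in> V \<Longrightarrow> card {i. i < N \<and> v \<in> f i} = q v"
proof -
  have "\<exists>f. (\<forall>i<N. f i \<subseteq> V \<and> stable_set E (f i)) \<and> (\<forall>v\<in>V. card {i. i < N \<and> v \<in> f i} = q v)"
    using assms(3)
  proof (induction "sum q V" arbitrary: q N rule: less_induct)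
    case less
    show ?case
    proof (cases "\<forall>v\<in>V. q v \<le> 1")
      case True
      \<comment> \<open>With weights 0 and 1 only, an ordinary colouring of the support is wanted,
        and perfection provides it.\<close>
      define S where "S = {v \<in> V. q v = 1}"
      have "card K \<le> N" if K: "K \<subseteq> S" "clique K E" for K
      proof -
        have "card K = sum q K" using K by (simp add: S_def subset_iff)
        then show ?thesis using less.prems[of K] K by (auto simp: S_def)
      qed
      then obtain g where g: "g ` S \<subseteq> {..<N}" "\<And>u v. u \<in> S \<Longrightarrow> v \<in> S \<Longrightarrow> {u, v} \<in> E \<Longrightarrow> g u \<noteq> g v"
        using perfect_colouring[OF loop perf, of S N] by (auto simp: S_def)
      define f where "f i = {v \<in> S. g v = i}" for i
      have "card {i. i < N \<and> v \<in> f i} = q v" if v: "v \<in> V" for v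
      proof (cases "v \<in> S")
        case True
        then have "{i. i < N \<and> v \<in> f i} = {g v}" using g(1) by (auto simp: f_def)
        then show ?thesis using True by (simp add: S_def)
      next
        case False
        then have "q v = 0" using \<open>\<forall>v\<in>V. q v \<le> 1\<close> v by (fastforce simp: S_def)
        then show ?thesis using False by (simp add: f_def)
      qed
      moreover have "f i \<subseteq> V \<and> stable_set E (f i)" for i
        using g(2) unfolding f_def S_def stable_set_def by fastforce
      ultimately show ?thesis by blast
    next
      case False
      then obtain x where x: "x \<in> V" "2 \<le> q x" by force
      define q' where "q' = q(x := q x - 1)"
      have q'q: "q' v \<le> q v" for v by (simp add: q'_def)
      have lt: "sum q' V < sum q V"
        by (rule sum_strict_mono_ex1) (use q'q x in \<open>auto simp: q'_def intro!: bexI[of _ x]\<close>)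
      have "sum q' K \<le> N" if "K \<subseteq> V" "clique K E" for K
        using less.prems[OF that] sum_mono[of K q' q] q'q by (meson le_trans)
      from less.hyps[OF lt this] obtain f where
        f: "\<And>i. i < N \<Longrightarrow> f i \<subseteq> V \<and> stable_set E (f i)" "\<And>v. v \<in> V \<Longrightarrow> card {i. i < N \<and> v \<in> f i} = q' v"
        by blast
      have "card {i. i < N \<and> x \<in> f i} \<noteq> 0" using f(2)[OF x(1)] x(2) by (simp add: q'_def)
      then obtain j where j: "j < N" "x \<in> f j" by (auto simp: card_eq_0_iff)
      \<comment> \<open>The weights that are left for \<open>N - 1\<close> sets after
        \<open>f j\<close> has been used once. Compared with \<open>q'\<close>, each vertex of
        \<open>f j\<close> loses one unit, except for \<open>x\<close>: it keeps
        \<open>q' x\<close>, because its weight under \<open>q\<close> is larger by one and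
        \<open>f j\<close> supplies that unit.\<close>
      define q2 where "q2 v = (if v = x then q' x else card {i. i < N \<and> i \<noteq> j \<and> v \<in> f i})" for v
      have q'2: "q' v = q2 v + of_bool (v \<in> f j \<and> v \<noteq> x)" if v: "v \<in> V" for v
      proof (cases "v = x")
        case False
        have "{i. i < N \<and> v \<in> f i} = {i. i < N \<and> i \<noteq> j \<and> v \<in> f i} \<union> (if v \<in> f j then {j} else {})"
          using j by auto
        then have "card {i. i < N \<and> v \<in> f i} = card {i. i < N \<and> i \<noteq> j \<and> v \<in> f i} + of_bool (v \<in> f j)"
          by simp
        then show ?thesis using f(2)[OF v] False by (simp add: q2_def)
      qed (simp add: q2_def)
      have "sum q2 V \<le> sum q' V" by (rule sum_mono) (use q'2 in auto)
      then have lt2: "sum q2 V < sum q V" using lt by simp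
      \<comment> \<open>A clique through \<open>x\<close> weighs less under \<open>q'\<close> than
        under \<open>q\<close>. Any other clique meets each of the \<open>N - 1\<close> stable sets
        besides \<open>f j\<close> at most once.\<close>
      have "sum q2 K \<le> N - 1" if K: "K \<subseteq> V" "clique K E" for K
      proof (cases "x \<in> K")
        case True
        have "sum q2 K \<le> sum q' K" by (rule sum_mono) (use q'2 K in auto)
        also have "\<dots> < sum q K" by (rule sum_strict_mono_ex1) (use q'q x True in \<open>auto simp: q'_def intro!: bexI[of _ x]\<close>)
        also have "\<dots> \<le> N" using less.prems[OF K] .
        finally show ?thesis by simp
      next
        case False
        have "sum q2 K = (\<Sum>v\<in>K. card {i. i < N \<and> i \<noteq> j \<and> v \<in> f i})"
          by (rule sum.cong) (use False in \<open>auto simp: q2_def\<close>)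
        also have "\<dots> = (\<Sum>v\<in>K. \<Sum>i\<in>{..<N} - {j}. of_bool (v \<in> f i))"
        proof (rule sum.cong)
          fix v
          have "{i. i < N \<and> i \<noteq> j \<and> v \<in> f i} = ({..<N} - {j}) \<inter> {i. v \<in> f i}" by auto
          then show "card {i. i < N \<and> i \<noteq> j \<and> v \<in> f i} = (\<Sum>i\<in>{..<N} - {j}. of_bool (v \<in> f i))" by simp
        qed simp
        also have "\<dots> = (\<Sum>i\<in>{..<N} - {j}. \<Sum>v\<in>K. of_bool (v \<in> f i))" by (rule sum.swap)
        also have "\<dots> \<le> (\<Sum>i\<in>{..<N} - {j}. 1)"
        proof (rule sum_mono)
          fix i assume "i \<in> {..<N} - {j}"
          then have "stable_set E (f i)" using f(1) by blast
          then have "card (K \<inter> f i) \<le> 1" using card_clique_stable K(2) by blast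
          then show "(\<Sum>v\<in>K. of_bool (v \<in> f i)) \<le> (1::nat)" by simp
        qed
        also have "\<dots> = N - 1" using j by simp
        finally show ?thesis .
      qed
      from less.hyps[OF lt2 this] obtain g where
        g: "\<And>i. i < N - 1 \<Longrightarrow> g i \<subseteq> V \<and> stable_set E (g i)" "\<And>v. v \<in> V \<Longrightarrow> card {i. i < N - 1 \<and> v \<in> g i} = q2 v"
        by blast
      define h where "h i = (if i < N - 1 then g i else f j)" for i
      have "card {i. i < N \<and> v \<in> h i} = q v" if v: "v \<in> V" for v
      proof -
        have "{i. i < N \<and> v \<in> h i} = {i. i < N - 1 \<and> v \<in> g i} \<union> (if v \<in> f j then {N - 1} else {})"
          using j by (auto simp: h_def)
        then have "card {i. i < N \<and> v \<in> h i} = q2 v + of_bool (v \<in> f j)" using g(2)[OF v] by simp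
        then show ?thesis using q'2[OF v] j x by (auto simp: q'_def q2_def split: if_splits)
      qed
      moreover have "\<forall>i<N. h i \<subseteq> V \<and> stable_set E (h i)" using g(1) f(1) j by (auto simp: h_def)
      ultimately show ?thesis by blast
    qed
  qed
  then show ?thesis using that by blast
qed

section \<open>Stable set vectors and the t-polytope\<close>

definition stable_vectors :: "'a::finite set \<Rightarrow> 'a set set \<Rightarrow> (real ^ 'a) set" where
  "stable_vectors V E = (\<lambda>A. \<chi> v. of_bool (v \<in> A)) ` {A. A \<subseteq> V \<and> stable_set E A}"

lemma cycle_sum_shift: "(\<Sum>i<length C. g (C ! (Suc i mod length C))) = (\<Sum>i<length C. g (C ! i) :: int)"
proof -
  have "(\<Sum>i<length C. g (C ! (Suc i mod length C)) - g (C ! i)) = walk_sum (\<lambda>x y. g y - g x) (C @ [hd C])"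
    by (simp add: cycle_sum_nth)
  also have "\<dots> = 0" using walk_sum_telescope[of "C @ [hd C]" g] by (cases C) auto
  finally show ?thesis by (simp add: sum_subtractf)
qed

lemma card_Int_list:
  assumes "distinct C"
  shows "int (card (A \<inter> set C)) = (\<Sum>i<length C. of_bool (C ! i \<in> A))"
proof -
  have "int (card (A \<inter> set C)) = (\<Sum>v\<in>set C. of_bool (v \<in> A))" by (simp add: Int_commute)
  also have "\<dots> = (\<Sum>i<length C. of_bool (C ! i \<in> A))"
    by (rule sum.reindex_bij_betw[symmetric]) (use assms in \<open>simp add: bij_betw_nth\<close>)
  finally show ?thesis .
qed

text \<open>Each vertex of \<open>A\<close> on the cycle covers two of its edges, and stability
  means that no edge is covered twice; so both sides count the uncovered edges.\<close>

lemma stable_cycle: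
  assumes A: "stable_set E A" and C: "distinct C" "cycle_edges C \<subseteq> E"
  shows "int (length C) - 2 * int (card (A \<inter> set C)) =
    int (card {i. i < length C \<and> C ! i \<notin> A \<and> C ! (Suc i mod length C) \<notin> A})"
proof -
  let ?n = "length C"
  have e: "\<not> (C ! i \<in> A \<and> C ! (Suc i mod ?n) \<in> A)" if "i < ?n" for i
    using A C that by (auto simp: stable_set_def cycle_edges_def)
  have "int (card {i. i < ?n \<and> C ! i \<notin> A \<and> C ! (Suc i mod ?n) \<notin> A}) =
      (\<Sum>i<?n. of_bool (C ! i \<notin> A \<and> C ! (Suc i mod ?n) \<notin> A))" by (simp add: Int_def)
  also have "\<dots> = (\<Sum>i<?n. 1 - of_bool (C ! i \<in> A) - of_bool (C ! (Suc i mod ?n) \<in> A))"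
    by (rule sum.cong) (use e in auto)
  also have "\<dots> = int ?n - 2 * (\<Sum>i<?n. of_bool (C ! i \<in> A))"
    using cycle_sum_shift[of "\<lambda>v. of_bool (v \<in> A)" C] by (simp add: sum_subtractf)
  finally show ?thesis using card_Int_list[OF C(1), of A] by simp
qed

lemma convex_t_polytope: "convex (t_polytope V E)"
proof (rule convexI)
  fix x y :: "real ^ 'a" and u v :: real
  assume x: "x \<in> t_polytope V E" and y: "y \<in> t_polytope V E" and uv: "0 \<le> u" "0 \<le> v" "u + v = 1"
  have le: "u * a + v * b \<le> c" if "a \<le> c" "b \<le> c" for a b c
    using that uv convex_bound_le by blast
  show "u *\<^sub>R x + v *\<^sub>R y \<in> t_polytope V E"
    unfolding t_polytope_def
  proof (intro CollectI conjI allI ballI impI)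
    fix C assume C: "induced_cycle V E C \<and> odd (length C)"
    have c: "(\<Sum>w\<in>set C. x $ w) \<le> (real (length C) - 1) / 2" "(\<Sum>w\<in>set C. y $ w) \<le> (real (length C) - 1) / 2"
      using x y C unfolding t_polytope_def by blast+
    have eq: "(\<Sum>w\<in>set C. (u *\<^sub>R x + v *\<^sub>R y) $ w) = u * (\<Sum>w\<in>set C. x $ w) + v * (\<Sum>w\<in>set C. y $ w)"
      by (simp add: sum.distrib sum_distrib_left)
    show "(\<Sum>w\<in>set C. (u *\<^sub>R x + v *\<^sub>R y) $ w) \<le> (real (length C) - 1) / 2"
      unfolding eq by (rule le[OF c])
  next
    fix a b assume "{a, b} \<in> E"
    then have "u * (x $ a + x $ b) + v * (y $ a + y $ b) \<le> 1" using x y by (intro le) (auto simp: t_polytope_def)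
    then show "(u *\<^sub>R x + v *\<^sub>R y) $ a + (u *\<^sub>R x + v *\<^sub>R y) $ b \<le> 1" by (simp add: algebra_simps)
  qed (use x y uv in \<open>auto simp: t_polytope_def\<close>)
qed

lemma stable_vectors_subset: "stable_vectors V E \<subseteq> t_polytope V E"
proof
  fix x assume "x \<in> stable_vectors V E"
  then obtain A where A: "A \<subseteq> V" "stable_set E A" and x: "x = (\<chi> v. of_bool (v \<in> A))"
    by (auto simp: stable_vectors_def)
  show "x \<in> t_polytope V E"
    unfolding t_polytope_def
  proof (intro CollectI conjI allI ballI impI)
    fix C assume C: "induced_cycle V E C \<and> odd (length C)"
    then have c: "distinct C" "cycle_edges C \<subseteq> E"
      by (auto simp: induced_cycle_def is_cycle_def induced_edges_def)
    have "(\<Sum>v\<in>set C. x $ v) = real (card (A \<inter> set C))" by (simp add: x Int_commute)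
    moreover have "2 * card (A \<inter> set C) \<le> length C" using stable_cycle[OF A(2) c] by linarith
    moreover have "2 * card (A \<inter> set C) \<noteq> length C" using C by (metis dvd_triv_left)
    then have "2 * card (A \<inter> set C) + 1 \<le> length C" using calculation by linarith
    then have "2 * real (card (A \<inter> set C)) + 1 \<le> real (length C)" by linarith
    ultimately show "(\<Sum>v\<in>set C. x $ v) \<le> (real (length C) - 1) / 2" by simp
  next
    fix u v assume "{u, v} \<in> E"
    then show "x $ u + x $ v \<le> 1" using A by (auto simp: x stable_set_def)
  qed (use A in \<open>auto simp: x\<close>)
qed

text \<open>The bound 1 on a coordinate comes from an edge at the vertex, which is why isolated
  vertices are excluded here; at an isolated vertex the polytope would be unbounded.\<close>

lemma t_polytope_le_1:
  assumes "x \<in> t_polytope V E" "sgraph V E" "\<And>v. v \<in> V \<Longrightarrow> \<exists>e\<in>E. v \<in> e" "v \<in> V"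
  shows "x $ v \<le> 1"
proof -
  obtain e where e: "e \<in> E" "v \<in> e" using assms(3,4) by blast
  then have ce: "card e = 2" "e \<subseteq> V" using assms(2) by (auto simp: sgraph_def)
  then obtain a b where "e = {a, b}" by (auto simp: card_2_iff)
  then obtain w where w: "e = {v, w}" using e(2) by (auto simp: insert_commute)
  then have "x $ v + x $ w \<le> 1" using assms(1) e(1) by (simp add: t_polytope_def)
  moreover have "0 \<le> x $ w" using assms(1) w ce(2) by (simp add: t_polytope_def)
  ultimately show ?thesis by linarith
qed

text \<open>A clique has at most three vertices, and a triangle is an odd cycle whose inequality has
  the right-hand side (3 - 1) / 2 = 1.\<close>

lemma t_polytope_clique:
  assumes x: "x \<in> t_polytope V E" and V: "sgraph V E" and iso: "\<And>v. v \<in> V \<Longrightarrow> \<exists>e\<in>E. v \<in> e"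
    and K4: "\<not> contains_K4 V E" and K: "K \<subseteq> V" "clique K E"
  shows "(\<Sum>v\<in>K. x $ v) \<le> 1"
proof -
  have "card K \<le> 3"
  proof (rule ccontr)
    assume "\<not> card K \<le> 3"
    then have "4 \<le> card K" by simp
    then obtain T where T: "T \<subseteq> K" "card T = 4" by (meson obtain_subset_with_card_n)
    then have "clique T E" using K(2) by (meson clique_def subset_iff)
    moreover have "T \<subseteq> V" using T K(1) by simp
    ultimately show False using K4 T(2) unfolding contains_K4_def by blast
  qed
  then consider "card K = 0" | "card K = 1" | "card K = 2" | "card K = 3" by linarith
  then show ?thesis
  proof cases
    case 1 then show ?thesis using V K by (simp add: card_eq_0_iff)
  next
    case 2
    then obtain v where "K = {v}" by (auto simp: card_1_singleton_iff)
    moreover have "x $ v \<le> 1" using calculation K(1) by (intro t_polytope_le_1[OF x V iso]) auto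
    ultimately show ?thesis by simp
  next
    case 3
    then obtain u v where "K = {u, v}" "u \<noteq> v" by (auto simp: card_2_iff)
    then show ?thesis using x K by (simp add: t_polytope_def clique_def)
  next
    case 4
    then obtain a b c where abc: "K = {a, b, c}" "a \<noteq> b" "b \<noteq> c" "a \<noteq> c" by (auto simp: card_3_iff)
    have e: "{a, b} \<in> E" "{b, c} \<in> E" "{c, a} \<in> E"
      using K(2) abc(2-4) unfolding abc(1) clique_def by simp_all
    have ce: "cycle_edges [a, b, c] = {{a, b}, {b, c}, {c, a}}" by (simp add: cycle_edges_walk)
    have "f \<in> {{a, b}, {b, c}, {c, a}}" if "f \<in> E" "f \<subseteq> {a, b, c}" for f
    proof -
      have "card f = 2" using V that by (simp add: sgraph_def)
      then obtain s t where "f = {s, t}" "s \<noteq> t" by (auto simp: card_2_iff)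
      then show ?thesis using that(2) by auto
    qed
    moreover have "{{a, b}, {b, c}, {c, a}} \<subseteq> {f \<in> E. f \<subseteq> {a, b, c}}" using e by simp
    ultimately have "induced_edges E (set [a, b, c]) = cycle_edges [a, b, c]"
      unfolding ce induced_edges_def by (intro equalityI subsetI) auto
    moreover have "is_cycle [a, b, c]" using abc(2-4) by (simp add: is_cycle_def)
    moreover have "set [a, b, c] \<subseteq> V" using K(1) abc(1) by simp
    ultimately have "induced_cycle V E [a, b, c]" by (simp add: induced_cycle_def)
    moreover have "odd (length [a, b, c])" by simp
    ultimately have "(\<Sum>v\<in>set [a, b, c]. x $ v) \<le> (real (length [a, b, c]) - 1) / 2"
      using x unfolding t_polytope_def by blast
    then show ?thesis using abc by simp
  qed
qed

text \<open>Rounding \<open>k * x\<close> down gives integer weights for which no clique weighs more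
  than \<open>k\<close>. So \<open>k\<close> stable sets realise these weights, and the average of
  their vectors is \<open>y k\<close>. Since \<open>y k\<close> tends to \<open>x\<close> and the
  hull is closed, irrational points need no separate treatment.\<close>

lemma t_polytope_hull:
  assumes V: "sgraph V E" and iso: "\<And>v. v \<in> V \<Longrightarrow> \<exists>e\<in>E. v \<in> e"
    and perf: "perfect V E" and K4: "\<not> contains_K4 V E"
  shows "t_polytope V E = convex hull (stable_vectors V E)"
proof
  show "convex hull (stable_vectors V E) \<subseteq> t_polytope V E"
    using stable_vectors_subset convex_t_polytope by (rule hull_minimal)
  show "t_polytope V E \<subseteq> convex hull (stable_vectors V E)"
  proof
    fix x assume x: "x \<in> t_polytope V E"
    have x0: "0 \<le> x $ v" for v using x by (cases "v \<in> V") (auto simp: t_polytope_def)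
    define y :: "nat \<Rightarrow> real ^ 'a" where "y k = (\<chi> v. real (nat \<lfloor>real k * x $ v\<rfloor>) / real k)" for k
    have yH: "y k \<in> convex hull (stable_vectors V E)" if k: "0 < k" for k
    proof -
      let ?q = "\<lambda>v. nat \<lfloor>real k * x $ v\<rfloor>"
      have fl: "real (?q v) \<le> real k * x $ v" for v using x0[of v] by simp
      have "sum ?q K \<le> k" if K: "K \<subseteq> V" "clique K E" for K
      proof -
        have "real (sum ?q K) \<le> (\<Sum>v\<in>K. real k * x $ v)"
          unfolding of_nat_sum by (rule sum_mono) (rule fl)
        also have "\<dots> = real k * (\<Sum>v\<in>K. x $ v)" by (simp add: sum_distrib_left)
        also have "\<dots> \<le> real k" using t_polytope_clique[OF x V iso K4 K] k by (simp add: mult_le_cancel_left1)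
        finally show ?thesis by (simp only: of_nat_le_iff)
      qed
      moreover have "{u} \<notin> E" for u using V by (auto simp: sgraph_def)
      ultimately obtain f where f: "\<And>i. i < k \<Longrightarrow> f i \<subseteq> V \<and> stable_set E (f i)"
        "\<And>v. v \<in> V \<Longrightarrow> card {i. i < k \<and> v \<in> f i} = ?q v"
        using weighted_colouring[OF _ perf, of ?q k] by blast
      have "y k = (\<Sum>i<k. (1 / real k) *\<^sub>R (\<chi> v. of_bool (v \<in> f i)))"
      proof (rule vec_eq_iff[THEN iffD2], rule allI)
        fix v
        have "(\<Sum>i<k. (1 / real k) *\<^sub>R (\<chi> v. of_bool (v \<in> f i))) $ v = (\<Sum>i<k. of_bool (v \<in> f i)) / real k"
          by (subst sum_divide_distrib) simp
        also have "(\<Sum>i<k. of_bool (v \<in> f i)) = real (card {i. i < k \<and> v \<in> f i})" by (simp add: Int_def)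
        also have "card {i. i < k \<and> v \<in> f i} = ?q v"
        proof (cases "v \<in> V")
          case False
          then have "{i. i < k \<and> v \<in> f i} = {}" using f(1) by blast
          moreover have "x $ v = 0" using False x by (simp add: t_polytope_def)
          ultimately show ?thesis by (simp only: card.empty) simp
        qed (rule f(2))
        finally show "y k $ v = (\<Sum>i<k. (1 / real k) *\<^sub>R (\<chi> v. of_bool (v \<in> f i))) $ v"
          by (simp add: y_def)
      qed
      also have "\<dots> \<in> convex hull (stable_vectors V E)"
      proof (rule convex_sum)
        fix i assume "i \<in> {..<k}"
        then have "(\<chi> v. of_bool (v \<in> f i)) \<in> stable_vectors V E" using f by (auto simp: stable_vectors_def)
        then show "(\<chi> v. of_bool (v \<in> f i)) \<in> convex hull (stable_vectors V E)" by (rule hull_inc)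
      qed (use k in auto)
      finally show ?thesis .
    qed
    \<comment> \<open>\<open>Suc\<close> skips the index 0, where \<open>y\<close> divides by
      zero.\<close>
    have lim: "(\<lambda>k. y (Suc k)) \<longlonglongrightarrow> x"
    proof (rule vec_tendstoI)
      fix v
      have b: "x $ v - 1 / real (Suc k) \<le> y (Suc k) $ v \<and> y (Suc k) $ v \<le> x $ v" for k
      proof -
        have n: "real (nat \<lfloor>real (Suc k) * x $ v\<rfloor>) = of_int \<lfloor>real (Suc k) * x $ v\<rfloor>"
          using x0[of v] by simp
        have "real (Suc k) * x $ v - 1 \<le> of_int \<lfloor>real (Suc k) * x $ v\<rfloor>"
          "of_int \<lfloor>real (Suc k) * x $ v\<rfloor> \<le> real (Suc k) * x $ v" by linarith+
        then have "(real (Suc k) * x $ v - 1) / real (Suc k) \<le> y (Suc k) $ v"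
          "y (Suc k) $ v \<le> (real (Suc k) * x $ v) / real (Suc k)"
          unfolding y_def vec_lambda_beta n by (intro divide_right_mono; simp)+
        then show ?thesis by (simp add: diff_divide_distrib del: of_nat_Suc)
      qed
      show "(\<lambda>k. y (Suc k) $ v) \<longlonglongrightarrow> x $ v"
      proof (rule tendsto_sandwich[of "\<lambda>k. x $ v - 1 / real (Suc k)" _ _ "\<lambda>_. x $ v"])
        have "(\<lambda>k. x $ v - 1 / real (Suc k)) \<longlonglongrightarrow> x $ v - 0"
          by (intro tendsto_diff tendsto_const) (rule LIMSEQ_Suc[OF lim_1_over_n])
        then show "(\<lambda>k. x $ v - 1 / real (Suc k)) \<longlonglongrightarrow> x $ v" by simp
      qed (use b in \<open>auto intro: always_eventually\<close>)
    qed
    have "closed (convex hull (stable_vectors V E))"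
      by (intro compact_imp_closed compact_convex_hull finite_imp_compact) (simp add: stable_vectors_def)
    moreover have "\<forall>\<^sub>F k in sequentially. y (Suc k) \<in> convex hull (stable_vectors V E)"
      by (rule always_eventually) (use yH in simp)
    ultimately show "x \<in> convex hull (stable_vectors V E)"
      using lim by (rule Lim_in_closed_set[OF _ _ trivial_limit_sequentially])
  qed
qed

lemma perfect_t_perfect:
  assumes V: "sgraph V E" and iso: "\<And>v. v \<in> V \<Longrightarrow> \<exists>e\<in>E. v \<in> e"
    and perf: "perfect V E" and K4: "\<not> contains_K4 V E"
  shows "t_perfect V E"
  unfolding t_perfect_def integral_polytope_def
proof (intro allI impI)
  fix x i assume "x extreme_point_of t_polytope V E"
  then have "x extreme_point_of convex hull (stable_vectors V E)" using t_polytope_hull[OF assms] by simp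
  then have "x \<in> stable_vectors V E" by (rule extreme_point_of_convex_hull)
  then show "x $ i \<in> \<int>" by (auto simp: stable_vectors_def)
qed

section \<open>t-perfect graphs contain no loose odd wheel\<close>

lemma compact_t_polytope:
  assumes V: "sgraph V E" and iso: "\<And>v. v \<in> V \<Longrightarrow> \<exists>e\<in>E. v \<in> e"
  shows "compact (t_polytope V E)"
proof -
  have "t_polytope V E \<subseteq> cbox 0 1"
  proof
    fix x assume x: "x \<in> t_polytope V E"
    have "0 \<le> x $ v \<and> x $ v \<le> 1" for v
      using x t_polytope_le_1[OF x V iso, of v] by (cases "v \<in> V") (auto simp: t_polytope_def)
    then show "x \<in> cbox 0 1" by (simp add: mem_box_cart)
  qed
  then have "bounded (t_polytope V E)" by (rule bounded_subset[OF bounded_cbox])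
  moreover have "closed (t_polytope V E)"
  proof -
    have "t_polytope V E =
      (\<Inter>v\<in>- V. {x. x $ v = 0}) \<inter> (\<Inter>v\<in>V. {x. 0 \<le> x $ v}) \<inter>
      (\<Inter>(u, v)\<in>{(u, v). {u, v} \<in> E}. {x. x $ u + x $ v \<le> 1}) \<inter>
      (\<Inter>C\<in>{C. induced_cycle V E C \<and> odd (length C)}. {x. (\<Sum>v\<in>set C. x $ v) \<le> (real (length C) - 1) / 2})"
      by (auto simp: t_polytope_def)
    moreover have "closed \<dots>"
      by (intro closed_Int closed_INT ballI)
        (auto intro!: closed_Collect_le closed_Collect_eq continuous_intros)
    ultimately show ?thesis by simp
  qed
  ultimately show ?thesis by (simp add: compact_eq_bounded_closed)
qed

text \<open>The polytope is compact, so by Krein-Milman it is the hull of its extreme points. These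
  are integral with coordinates in the unit interval, hence vectors of stable sets.\<close>

lemma t_perfect_hull:
  assumes V: "sgraph V E" and iso: "\<And>v. v \<in> V \<Longrightarrow> \<exists>e\<in>E. v \<in> e" and t: "t_perfect V E"
  shows "t_polytope V E \<subseteq> convex hull (stable_vectors V E)"
proof -
  have "{x. x extreme_point_of t_polytope V E} \<subseteq> stable_vectors V E"
  proof
    fix x assume "x \<in> {x. x extreme_point_of t_polytope V E}"
    then have x: "x \<in> t_polytope V E" and int: "\<And>i. x $ i \<in> \<int>"
      using t by (auto simp: extreme_point_of_def t_perfect_def integral_polytope_def)
    define A where "A = {v. x $ v = 1}"
    have x01: "x $ v = 0 \<or> x $ v = 1" for v
    proof -
      have "0 \<le> x $ v \<and> x $ v \<le> 1"
        using x t_polytope_le_1[OF x V iso, of v] by (cases "v \<in> V") (auto simp: t_polytope_def)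
      moreover obtain z where "x $ v = of_int z" using int[of v] by (auto simp: Ints_def)
      ultimately have "z = 0 \<or> z = 1" by auto
      then show ?thesis using \<open>x $ v = of_int z\<close> by auto
    qed
    have "x = (\<chi> v. of_bool (v \<in> A))" using x01 by (auto simp: A_def vec_eq_iff of_bool_def)
    moreover have "A \<subseteq> V" using x by (auto simp: A_def t_polytope_def)
    moreover have "stable_set E A" using x by (fastforce simp: A_def t_polytope_def stable_set_def)
    ultimately show "x \<in> stable_vectors V E" by (auto simp: stable_vectors_def)
  qed
  then have "convex hull {x. x extreme_point_of t_polytope V E} \<subseteq> convex hull (stable_vectors V E)"
    by (rule hull_mono)
  then show ?thesis
    using Krein_Milman_Minkowski[OF compact_t_polytope[OF V iso] convex_t_polytope] by simp
qed

lemma mod_add_rcancel_nat: "(a + c) mod n = (b + c) mod n \<Longrightarrow> a mod n = b mod (n :: nat)"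
proof -
  assume "(a + c) mod n = (b + c) mod n"
  then obtain q r where "a + c + n * q = b + c + n * r" by (auto simp: nat_mod_eq_iff)
  then have "a + n * q = b + n * r" by simp
  then show ?thesis unfolding nat_mod_eq_iff by blast
qed

text \<open>A segment whose inner vertices avoid \<open>N\<close> is determined by any position inside it.\<close>

lemma segment_position:
  assumes n: "n = length C" and C: "distinct C"
    and P: "i < n" "2 \<le> k" "k \<le> n" "C ! i \<in> N" "\<And>t. 0 < t \<Longrightarrow> t < k - 1 \<Longrightarrow> C ! ((i + t) mod n) \<notin> N"
    and Q: "j < n" "2 \<le> l" "l \<le> n" "C ! j \<in> N" "\<And>t. 0 < t \<Longrightarrow> t < l - 1 \<Longrightarrow> C ! ((j + t) mod n) \<notin> N"
    and e: "s < k - 1" "t < l - 1" "(i + s) mod n = (j + t) mod n"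
  shows "\<not> s < t"
proof
  assume st: "s < t"
  \<comment> \<open>Going back \<open>s\<close> steps, the start of the first segment is found at
    offset \<open>t - s\<close>, strictly inside the second one, although it lies in
    \<open>N\<close>.\<close>
  have "(i + s) mod n = (j + (t - s) + s) mod n" using e st by simp
  then have "i mod n = (j + (t - s)) mod n" by (rule mod_add_rcancel_nat)
  then have "i = (j + (t - s)) mod n" using P(1) by simp
  then show False using Q(5)[of "t - s"] st e P(4) by simp
qed

text \<open>Each odd segment has an edge that \<open>A\<close> misses, and these edges are distinct.
  So \<open>A\<close> misses at least three rim edges, and \<open>stable_cycle\<close> turns this
  into the bound. It applies to stable sets that contain the hub.\<close>

lemma loose_odd_wheel_stable:
  assumes C: "induced_cycle V E C" and A: "stable_set E A" "\<And>u. u \<in> N \<Longrightarrow> u \<notin> A"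
    and three: "3 \<le> card {P \<in> segments C N. odd (length P - 1)}"
  shows "2 * card (A \<inter> set C) + 3 \<le> length C"
proof -
  define n where "n = length C"
  have dist: "distinct C" and n3: "3 \<le> n" and CE: "cycle_edges C \<subseteq> E"
    using C by (auto simp: induced_cycle_def is_cycle_def induced_edges_def n_def)
  define U where "U = {i. i < n \<and> C ! i \<notin> A \<and> C ! (Suc i mod n) \<notin> A}"
  let ?S = "{P \<in> segments C N. odd (length P - 1)}"
  \<comment> \<open>A segment is handled through its start \<open>i\<close> and its number
    \<open>k\<close> of vertices; its edges begin at the positions \<open>i + t\<close> with
    \<open>t < k - 1\<close>.\<close>
  define seg where "seg P i k \<longleftrightarrow> i < n \<and> 2 \<le> k \<and> k \<le> n \<and> P = take k (rotate i C) \<and> odd (k - 1) \<and>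
    C ! i \<in> N \<and> C ! ((i + (k - 1)) mod n) \<in> N \<and> (\<forall>t. 0 < t \<and> t < k - 1 \<longrightarrow> C ! ((i + t) mod n) \<notin> N)" for P i k
  have seg: "\<exists>i k. seg P i k" if P: "P \<in> ?S" for P
  proof -
    obtain i k where ik: "i < n" "2 \<le> k" "k \<le> n" "P = take k (rotate i C)" "hd P \<in> N" "last P \<in> N"
      "\<forall>u \<in> set P - {hd P, last P}. u \<notin> N" "odd (length P - 1)"
      using P by (auto simp: segments_def n_def)
    have len: "length P = k" using ik by (simp add: n_def)
    have nth: "P ! t = C ! ((i + t) mod n)" if "t < k" for t
      using that ik by (simp add: n_def nth_rotate)
    have ne: "P \<noteq> []" using len ik by auto
    have hd: "hd P = C ! i" using nth[of 0] ik ne by (simp add: hd_conv_nth)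
    have last: "last P = C ! ((i + (k - 1)) mod n)" using nth[of "k - 1"] ik ne len by (simp add: last_conv_nth)
    have dP: "distinct P" using ik dist by simp
    have "C ! ((i + t) mod n) \<notin> N" if "0 < t" "t < k - 1" for t
    proof -
      have "P ! t \<noteq> P ! 0" "P ! t \<noteq> P ! (k - 1)" using dP that len by (auto simp: nth_eq_iff_index_eq)
      then have "P ! t \<in> set P - {hd P, last P}" using that len ne by (simp add: hd_conv_nth last_conv_nth)
      then show ?thesis using ik(7) nth[of t] that by auto
    qed
    then have "seg P i k" using ik hd last len by (auto simp: seg_def)
    then show ?thesis by blast
  qed
  \<comment> \<open>As the ends of a segment are not in \<open>A\<close>, the edges of the segment that meet \<open>A\<close> come in pairs.\<close>
  have unc: "\<exists>t<k - 1. (i + t) mod n \<in> U" if s: "seg P i k" for P i k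
  proof (rule ccontr)
    assume no: "\<not> ?thesis"
    define a :: "nat \<Rightarrow> int" where "a t = of_bool (C ! ((i + t) mod n) \<in> A)" for t
    have one: "a t + a (Suc t) = 1" if t: "t < k - 1" for t
    proof -
      let ?j = "(i + t) mod n"
      have j: "?j < n" using n3 by (intro mod_less_divisor) simp
      have sj: "(i + Suc t) mod n = Suc ?j mod n" by (simp add: mod_Suc_eq)
      have "{C ! ?j, C ! (Suc ?j mod n)} \<in> E" using j CE by (auto simp: cycle_edges_def n_def)
      then have "\<not> (C ! ?j \<in> A \<and> C ! (Suc ?j mod n) \<in> A)" using A(1) by (auto simp: stable_set_def)
      moreover have "?j \<notin> U" using no t by blast
      then have "C ! ?j \<in> A \<or> C ! (Suc ?j mod n) \<in> A" using j by (auto simp: U_def)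
      ultimately show ?thesis unfolding a_def sj by auto
    qed
    have par: "t \<le> k - 1 \<Longrightarrow> a t = of_bool (odd t)" for t
    proof (induction t)
      case 0
      have "C ! i \<notin> A" "i < n" using s A(2) by (auto simp: seg_def)
      then show ?case by (simp add: a_def)
    next
      case (Suc t)
      then show ?case using one[of t] by auto
    qed
    have "a (k - 1) = 0" using s A(2) by (auto simp: seg_def a_def)
    moreover have "odd (k - 1)" using s by (simp add: seg_def)
    ultimately show False using par[of "k - 1"] by simp
  qed
  \<comment> \<open>\<open>h\<close> sends each odd segment to the position of one of its edges
    missed by \<open>A\<close>.\<close>
  have "\<exists>h. \<forall>P\<in>?S. \<exists>i k t. seg P i k \<and> t < k - 1 \<and> h P = (i + t) mod n \<and> h P \<in> U"
    by (intro bchoice ballI) (use seg unc in blast)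
  then obtain h where h: "\<And>P. P \<in> ?S \<Longrightarrow> \<exists>i k t. seg P i k \<and> t < k - 1 \<and> h P = (i + t) mod n \<and> h P \<in> U"
    by blast
  have "inj_on h ?S"
  proof (rule inj_onI)
    fix P Q assume P: "P \<in> ?S" and Q: "Q \<in> ?S" and eq: "h P = h Q"
    obtain i k s where p: "seg P i k" "s < k - 1" "h P = (i + s) mod n" using h[OF P] by blast
    obtain j l t where q: "seg Q j l" "t < l - 1" "h Q = (j + t) mod n" using h[OF Q] by blast
    have e: "(i + s) mod n = (j + t) mod n" using p q eq by simp
    have "\<not> s < t"
      by (rule segment_position[OF n_def dist, of i k N j l s t]) (use p q e in \<open>auto simp: seg_def\<close>)
    moreover have "\<not> t < s"
      by (rule segment_position[OF n_def dist, of j l N i k t s]) (use p q e in \<open>auto simp: seg_def\<close>)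
    ultimately have "s = t" by simp
    then have "i mod n = j mod n" using e mod_add_rcancel_nat by blast
    then have ij: "i = j" using p(1) q(1) by (simp add: seg_def)
    \<comment> \<open>Of two segments with the same start, the shorter would end at a vertex of
      \<open>N\<close> strictly inside the longer.\<close>
    have "\<not> k < l"
      using p(1) q(1) ij unfolding seg_def by (metis One_nat_def Suc_1 Suc_le_lessD diff_less_mono zero_less_diff less_imp_le)
    moreover have "\<not> l < k"
      using p(1) q(1) ij unfolding seg_def by (metis One_nat_def Suc_1 Suc_le_lessD diff_less_mono zero_less_diff less_imp_le)
    ultimately show "P = Q" using p(1) q(1) ij by (simp add: seg_def)
  qed
  moreover have "h ` ?S \<subseteq> U" using h by blast
  moreover have "finite U" by (simp add: U_def)
  ultimately have "3 \<le> card U" using three card_inj_on_le by (meson le_trans)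
  then show ?thesis using stable_cycle[OF A(1) dist CE] by (simp add: U_def n_def)
qed

text \<open>At a vertex of \<open>D\<close>, the two neighbours along \<open>D\<close> are also
  neighbours along \<open>C\<close>, where there are only two. So the successor along
  \<open>C\<close> is in \<open>D\<close> again, and \<open>D\<close> is followed all around
  \<open>C\<close>.\<close>

lemma subcycle_eq:
  assumes C: "is_cycle C" and D: "is_cycle D" and sub: "cycle_edges D \<subseteq> cycle_edges C" "set D \<subseteq> set C"
  shows "set D = set C"
proof -
  let ?n = "length C"
  have n: "3 \<le> ?n" and dC: "distinct C" and dD: "distinct D" and m: "3 \<le> length D"
    using C D by (auto simp: is_cycle_def)
  have step: "C ! (Suc i mod ?n) \<in> set D" if i: "i < ?n" "C ! i \<in> set D" for i
  proof -
    let ?w = "C ! i"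
    obtain k D' where D': "rotate k D = ?w # D'" using rotate_to[OF i(2)] .
    obtain C' where C': "rotate i C = ?w # C'" 
    proof -
      have "rotate i C ! 0 = C ! ((i + 0) mod ?n)" using n by (intro nth_rotate) linarith
      then have "hd (rotate i C) = ?w" using i n by (subst hd_conv_nth) auto
      then show ?thesis using that n by (cases "rotate i C") auto
    qed
    have lens: "2 \<le> length C'" "2 \<le> length D'" using arg_cong[OF D', of length] arg_cong[OF C', of length] n m by auto
    have dist: "distinct (?w # C')" "distinct (?w # D')" using C' D' dC dD by (metis distinct_rotate)+
    have ces: "cycle_edges (?w # D') \<subseteq> cycle_edges (?w # C')"
      using sub(1) cycle_edges_rotate[of k D] cycle_edges_rotate[of i C] C' D' by simp
    obtain x Y where Y: "D' = x # Y" using lens by (cases D') auto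
    have "Y \<noteq> []" using lens Y by auto
    have "{?w, x} \<in> cycle_edges (?w # D')" "{?w, last Y} \<in> cycle_edges (?w # D')"
      using cycle_edges_append[of ?w "[]" x Y] cycle_edges_append[of ?w "x # butlast Y" "last Y" "[]"] \<open>Y \<noteq> []\<close>
      by (auto simp: Y insert_commute)
    then have "x = hd C' \<or> x = last C'" "last Y = hd C' \<or> last Y = last C'"
      using cycle_nbr[OF dist(1) lens(1)] ces by blast+
    moreover have "x \<noteq> last Y" using dist(2) Y \<open>Y \<noteq> []\<close> by auto
    ultimately have "hd C' \<in> {x, last Y}" by auto
    moreover have "{x, last Y} \<subseteq> set (?w # D')" using Y \<open>Y \<noteq> []\<close> by auto
    then have "{x, last Y} \<subseteq> set D" using D' by (metis set_rotate)
    moreover have "hd C' = C ! (Suc i mod ?n)"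
    proof -
      have "rotate i C ! 1 = C ! ((i + 1) mod ?n)" using n by (intro nth_rotate) linarith
      then show ?thesis using C' lens by (simp add: hd_conv_nth) (metis hd_conv_nth list.size(3) not_numeral_le_zero)
    qed
    ultimately show ?thesis by auto
  qed
  obtain w where "w \<in> set D" using m by (cases D) auto
  then obtain i where i: "i < ?n" "C ! i \<in> set D" using sub(2) by (metis in_set_conv_nth subsetD)
  have all: "C ! ((i + t) mod ?n) \<in> set D" for t
  proof (induction t)
    case 0 then show ?case using i by simp
  next
    case (Suc t)
    have "(i + t) mod ?n < ?n" using n by (intro mod_less_divisor) linarith
    then show ?case using step[OF _ Suc] by (simp add: mod_Suc_eq)
  qed
  have "C ! j \<in> set D" if "j < ?n" for j
    using all[of "j + ?n - i"] that i by simp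
  then show ?thesis using sub(2) by (auto simp: in_set_conv_nth)
qed

lemma t_perfect_no_loose_odd_wheel:
  assumes V: "sgraph V E" and iso: "\<And>v. v \<in> V \<Longrightarrow> \<exists>e\<in>E. v \<in> e" and t: "t_perfect V E"
  shows "\<not> has_induced_loose_odd_wheel V E"
proof
  assume H: "has_induced_loose_odd_wheel V E"
  obtain C v N where C: "induced_cycle V E C" "odd (length C)" and v: "v \<in> V" "v \<notin> set C"
    and N: "N = {u \<in> set C. {v, u} \<in> E}" and "3 \<le> card N"
    and three: "3 \<le> card {P \<in> segments C N. odd (length P - 1)}"
    by (rule induced_loose_odd_wheelE[OF V H])
  define n where "n = length C"
  have cyc: "is_cycle C" and CV: "set C \<subseteq> V" and ind: "induced_edges E (set C) = cycle_edges C"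
    using C by (auto simp: induced_cycle_def)
  have dist: "distinct C" and n3: "3 \<le> n" and CE: "cycle_edges C \<subseteq> E"
    using cyc ind by (auto simp: is_cycle_def n_def induced_edges_def)
  obtain k where k: "n = 2 * k + 1" using C(2) by (auto simp: n_def elim: oddE)
  have k1: "1 \<le> k" using k n3 by simp
  define L where "L y = y $ v + (\<Sum>w\<in>set C. y $ w)" for y :: "real ^ 'a"
  have "stable_vectors V E \<subseteq> {y. L y \<le> real k}"
  proof
    fix y assume "y \<in> stable_vectors V E"
    then obtain A where A: "stable_set E A" "y = (\<chi> w. of_bool (w \<in> A))" by (auto simp: stable_vectors_def)
    have L: "L y = of_bool (v \<in> A) + real (card (A \<inter> set C))" by (simp add: L_def A Int_commute)
    \<comment> \<open>If \<open>A\<close> contains the hub, it misses at least three of the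
      \<open>2 * k + 1\<close> rim edges and so has at most \<open>k - 1\<close> rim
      vertices.\<close>
    have "of_bool (v \<in> A) + card (A \<inter> set C) \<le> k"
    proof (cases "v \<in> A")
      case True
      then have "u \<notin> A" if "u \<in> N" for u using that A(1) by (auto simp: N stable_set_def)
      then show ?thesis using loose_odd_wheel_stable[OF C(1) A(1) _ three] k True by (simp add: n_def)
    next
      case False
      then show ?thesis using stable_cycle[OF A(1) dist CE] k by (simp add: n_def)
    qed
    then have "real (of_bool (v \<in> A) + card (A \<inter> set C)) \<le> real k" by (simp only: of_nat_le_iff)
    then show "y \<in> {y. L y \<le> real k}" using L by simp
  qed
  moreover have "convex {y. L y \<le> real k}"
  proof -
    have "linear L" unfolding L_def by (intro linearI) (simp_all add: sum.distrib sum_distrib_left algebra_simps)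
    then have "convex (L -` {..real k})" by (intro convex_linear_vimage) auto
    then show ?thesis by (simp add: vimage_def)
  qed
  ultimately have "convex hull (stable_vectors V E) \<subseteq> {y. L y \<le> real k}" by (rule hull_minimal)
  then have bound: "L y \<le> real k" if "y \<in> t_polytope V E" for y
    using that t_perfect_hull[OF V iso t] by blast
  \<comment> \<open>The value \<open>k / n\<close> makes the inequality of the rim tight. The hub
    receives what a triangle formed with a rim edge would leave to it,
    \<open>1 - 2 * k / n = 1 / n\<close>. Then \<open>L x\<close> exceeds \<open>k\<close> by
    \<open>1 / n\<close>.\<close>
  define x :: "real ^ 'a" where
    "x = (\<chi> w. if w \<in> set C then real k / real n else if w = v then 1 / real n else 0)"
  have n0: "0 < real n" using n3 by simp
  have small: "0 \<le> x $ w \<and> x $ w \<le> real k / real n" for w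
    using k1 n0 by (auto simp: x_def divide_right_mono)
  have "x \<in> t_polytope V E"
    unfolding t_polytope_def
  proof (intro CollectI conjI allI ballI impI)
    fix a b
    have "x $ a + x $ b \<le> real k / real n + real k / real n" using small by (intro add_mono) auto
    also have "\<dots> = (2 * real k) / real n" by simp
    also have "\<dots> \<le> 1" using n0 k by (subst divide_le_eq_1_pos) auto
    finally show "x $ a + x $ b \<le> 1" .
  next
    fix D assume D: "induced_cycle V E D \<and> odd (length D)"
    then have cD: "is_cycle D" and indD: "induced_edges E (set D) = cycle_edges D"
      by (auto simp: induced_cycle_def)
    have m3: "3 \<le> length D" and dD: "distinct D" using cD by (auto simp: is_cycle_def)
    have cardD: "card (set D) = length D" using dD by (rule distinct_card)
    show "(\<Sum>w\<in>set D. x $ w) \<le> (real (length D) - 1) / 2"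
    proof (cases "set D \<subseteq> set C")
      case True
      have "cycle_edges D \<subseteq> cycle_edges C"
        using True unfolding indD[symmetric] ind[symmetric] by (auto simp: induced_edges_def)
      then have "set D = set C" using subcycle_eq[OF cyc cD] True by blast
      then have "(\<Sum>w\<in>set D. x $ w) = real (card (set C)) * (real k / real n)" "length D = n"
        using cardD distinct_card[OF dist] by (auto simp: x_def n_def)
      then show ?thesis using distinct_card[OF dist] n0 k by (simp add: n_def[symmetric])
    next
      case False
      then obtain w where w: "w \<in> set D" "w \<notin> set C" by blast
      \<comment> \<open>Off the rim a coordinate is at most \<open>1 / n\<close>, elsewhere at most
        \<open>k / n\<close>. With \<open>m\<close> further vertices the claim is
        \<open>2 + 2 * m * k \<le> m * (2 * k + 1)\<close>, that is
        \<open>2 \<le> m\<close>.\<close>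
      have "(\<Sum>u\<in>set D. x $ u) = x $ w + (\<Sum>u\<in>set D - {w}. x $ u)" using w by (intro sum.remove) auto
      also have "\<dots> \<le> 1 / real n + real (card (set D - {w})) * (real k / real n)"
        using w small by (intro add_mono sum_bounded_above) (auto simp: x_def)
      also have "card (set D - {w}) = length D - 1" using w cardD by simp
      also have "1 / real n + real (length D - 1) * (real k / real n) = (1 + real (length D - 1) * real k) / real n"
        by (simp add: add_divide_distrib)
      also have "\<dots> \<le> (real (length D) - 1) / 2"
      proof -
        define m where "m = real (length D - 1)"
        have m: "2 \<le> m" "real (length D) - 1 = m" using m3 by (auto simp: m_def)
        have "2 * (1 + m * real k) \<le> m * real n" using m k by (simp add: algebra_simps)
        then show ?thesis using n0 unfolding m(2) m_def[symmetric] by (simp add: field_simps)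
      qed
      finally show ?thesis .
    qed
  qed (use v CV k1 in \<open>auto simp: x_def\<close>)
  then have "L x \<le> real k" by (rule bound)
  moreover have "L x = 1 / real n + real k"
  proof -
    have "(\<Sum>w\<in>set C. x $ w) = real n * (real k / real n)"
      using distinct_card[OF dist] by (simp add: x_def n_def)
    then show ?thesis using v n0 by (simp add: L_def x_def)
  qed
  ultimately show False using n0 by simp
qed

section \<open>Sphere triangulations, combinatorially\<close>

text \<open>\<open>ins C\<close> stands for the set of faces inside \<open>C\<close>. Faces have a
  type of their own because two of them may share their triangle, as happens when the graph is a
  single triangle.\<close>

locale sphere_triangulation =
  fixes V :: "'a::finite set" and E :: "'a set set"
    and Fs :: "'f set" and tri :: "'f \<Rightarrow> 'a set" and ins :: "'a list \<Rightarrow> 'f set"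
  assumes graph: "sgraph V E"
    and fin: "finite Fs"
    and tri: "F \<in> Fs \<Longrightarrow> card (tri F) = 3" "F \<in> Fs \<Longrightarrow> clique (tri F) E"
    and two_faces: "e \<in> E \<Longrightarrow> card {F \<in> Fs. e \<subseteq> tri F} = 2"
    and ins_faces: "is_cycle C \<Longrightarrow> cycle_edges C \<subseteq> E \<Longrightarrow> ins C \<subseteq> Fs"
    and ins_edge: "is_cycle C \<Longrightarrow> cycle_edges C \<subseteq> E \<Longrightarrow> e \<in> cycle_edges C \<Longrightarrow>
      card {F \<in> ins C. e \<subseteq> tri F} = 1"
    and ins_nonedge: "is_cycle C \<Longrightarrow> cycle_edges C \<subseteq> E \<Longrightarrow> e \<in> E \<Longrightarrow> e \<notin> cycle_edges C \<Longrightarrow>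
      F \<in> ins C \<Longrightarrow> e \<subseteq> tri F \<Longrightarrow> G \<in> Fs \<Longrightarrow> e \<subseteq> tri G \<Longrightarrow> G \<in> ins C"
    and ins_vertex: "is_cycle C \<Longrightarrow> cycle_edges C \<subseteq> E \<Longrightarrow> v \<notin> set C \<Longrightarrow>
      F \<in> ins C \<Longrightarrow> v \<in> tri F \<Longrightarrow> G \<in> Fs \<Longrightarrow> v \<in> tri G \<Longrightarrow> G \<in> ins C"
    and ins_mono: "is_cycle C \<Longrightarrow> cycle_edges C \<subseteq> E \<Longrightarrow> is_cycle Z \<Longrightarrow> cycle_edges Z \<subseteq> E \<Longrightarrow>
      (\<And>e. e \<in> cycle_edges Z \<Longrightarrow> e \<notin> cycle_edges C \<Longrightarrow> \<exists>F\<in>ins C. e \<subseteq> tri F) \<Longrightarrow> ins Z \<subseteq> ins C"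
begin

definition cyc :: "'a list \<Rightarrow> bool" where
  "cyc C \<longleftrightarrow> is_cycle C \<and> cycle_edges C \<subseteq> E"

definition inside_vertices :: "'a list \<Rightarrow> 'a set" where
  "inside_vertices C = {v \<in> V - set C. \<exists>F\<in>ins C. v \<in> tri F}"

section \<open>Faces and vertices inside a cycle\<close>

lemma card_edge: "e \<in> E \<Longrightarrow> card e = 2"
  using graph by (simp add: sgraph_def)

lemma edge_vertices: "{x, y} \<in> E \<Longrightarrow> x \<in> V \<and> y \<in> V \<and> x \<noteq> y"
  using graph by (force simp: sgraph_def)

lemma tri_edge: "F \<in> Fs \<Longrightarrow> x \<in> tri F \<Longrightarrow> y \<in> tri F \<Longrightarrow> x \<noteq> y \<Longrightarrow> {x, y} \<in> E"
  using tri(2) by (auto simp: clique_def)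

lemma tri_third:
  assumes "F \<in> Fs" "x \<in> tri F" "y \<in> tri F" "x \<noteq> y"
  obtains z where "tri F = {x, y, z}" "z \<noteq> x" "z \<noteq> y"
proof -
  obtain a b c where "tri F = {a, b, c}" "a \<noteq> b" "b \<noteq> c" "a \<noteq> c"
    using tri(1)[OF assms(1)] by (auto simp: card_3_iff)
  then consider "tri F = {x, y, a}" "a \<noteq> x" "a \<noteq> y" | "tri F = {x, y, b}" "b \<noteq> x" "b \<noteq> y" | "tri F = {x, y, c}" "c \<noteq> x" "c \<noteq> y"
    using assms by fastforce
  then show ?thesis using that by cases auto
qed

lemma face_exists: "e \<in> E \<Longrightarrow> \<exists>F\<in>Fs. e \<subseteq> tri F"
  using two_faces[of e] by (metis (no_types, lifting) Collect_empty_eq card.empty zero_neq_numeral)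

lemma boundary_faces:
  assumes "cyc C" "e \<in> cycle_edges C"
  obtains F G where "F \<in> ins C" "e \<subseteq> tri F" "G \<in> Fs" "G \<notin> ins C" "e \<subseteq> tri G"
proof -
  have c: "card {F \<in> ins C. e \<subseteq> tri F} = 1" "card {F \<in> Fs. e \<subseteq> tri F} = 2"
    using assms ins_edge two_faces by (auto simp: cyc_def)
  then have "{F \<in> ins C. e \<subseteq> tri F} \<noteq> {F \<in> Fs. e \<subseteq> tri F}" by auto
  moreover have "ins C \<subseteq> Fs" using ins_faces assms by (simp add: cyc_def)
  ultimately obtain G where "G \<in> Fs" "G \<notin> ins C" "e \<subseteq> tri G" by blast
  moreover obtain F where "F \<in> ins C" "e \<subseteq> tri F" using c(1) by (auto simp: card_1_singleton_iff)
  ultimately show ?thesis using that by blast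
qed

lemma induced_cycle_cyc: "induced_cycle V E C \<Longrightarrow> cyc C"
  by (auto simp: induced_cycle_def cyc_def induced_edges_def)

lemma induced_cycle_edge:
  "induced_cycle V E C \<Longrightarrow> x \<in> set C \<Longrightarrow> y \<in> set C \<Longrightarrow> {x, y} \<in> E \<longleftrightarrow> {x, y} \<in> cycle_edges C"
  by (auto simp: induced_cycle_def induced_edges_def)

text \<open>\<open>C\<close> separates the two faces at \<open>e0\<close>, whereas \<open>Z\<close>
  does not, as \<open>e0\<close> is not one of its edges; so the inclusion is strict. This drives
  every induction on the number of inner faces.\<close>

lemma ins_less:
  assumes "cyc C" "cyc Z" "\<And>e. e \<in> cycle_edges Z \<Longrightarrow> e \<notin> cycle_edges C \<Longrightarrow> \<exists>F\<in>ins C. e \<subseteq> tri F"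
    and e0: "e0 \<in> cycle_edges C" "e0 \<notin> cycle_edges Z"
  shows "ins Z \<subseteq> ins C" "card (ins Z) < card (ins C)"
proof -
  show sub: "ins Z \<subseteq> ins C" using ins_mono assms by (auto simp: cyc_def)
  obtain F G where FG: "F \<in> ins C" "e0 \<subseteq> tri F" "G \<in> Fs" "G \<notin> ins C" "e0 \<subseteq> tri G"
    using boundary_faces[OF assms(1) e0(1)] .
  have "ins Z \<noteq> ins C"
  proof
    assume eq: "ins Z = ins C"
    have "G \<in> ins Z"
      by (rule ins_nonedge[of Z e0 F G]) (use assms FG eq in \<open>auto simp: cyc_def\<close>)
    then show False using FG eq by simp
  qed
  moreover have "finite (ins C)" using ins_faces fin assms by (meson cyc_def finite_subset)
  ultimately show "card (ins Z) < card (ins C)" using sub by (meson psubsetI psubset_card_mono)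
qed

lemma inside_face:
  assumes "cyc C" "x \<in> inside_vertices C" "G \<in> Fs" "x \<in> tri G"
  shows "G \<in> ins C"
  using assms ins_vertex unfolding cyc_def inside_vertices_def by blast

lemma inside_edge:
  assumes "cyc C" "x \<in> inside_vertices C" "e \<in> E" "x \<in> e"
  shows "\<exists>F\<in>ins C. e \<subseteq> tri F"
  using face_exists[OF assms(3)] inside_face assms by blast

lemma inside_adjacent:
  assumes "cyc C" "x \<in> inside_vertices C" "{x, y} \<in> E" "y \<notin> set C"
  shows "y \<in> inside_vertices C"
proof -
  obtain F where "F \<in> ins C" "{x, y} \<subseteq> tri F" using inside_edge[OF assms(1-3)] by auto
  then show ?thesis using assms edge_vertices by (auto simp: inside_vertices_def)
qed

text \<open>A vertex of \<open>C\<close> belongs to a face that is not inside \<open>C\<close>,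
  whereas all faces at a vertex inside \<open>Z\<close> are inside \<open>Z\<close> and hence inside
  \<open>C\<close>.\<close>

lemma inside_vertices_mono:
  assumes "cyc C" "cyc Z" "ins Z \<subseteq> ins C"
  shows "inside_vertices Z \<subseteq> inside_vertices C"
proof
  fix x assume x: "x \<in> inside_vertices Z"
  have "x \<notin> set C"
  proof
    assume "x \<in> set C"
    then obtain i where "i < length C" "x = C ! i" by (auto simp: in_set_conv_nth)
    then have e: "{x, C ! (Suc i mod length C)} \<in> cycle_edges C" (is "?e \<in> _") by (auto simp: cycle_edges_def)
    obtain F G where FG: "F \<in> ins C" "?e \<subseteq> tri F" "G \<in> Fs" "G \<notin> ins C" "?e \<subseteq> tri G"
      using boundary_faces[OF assms(1) e] .
    have "G \<in> ins Z" using inside_face[OF assms(2) x FG(3)] FG by auto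
    then show False using FG assms by blast
  qed
  then show "x \<in> inside_vertices C" using x assms by (auto simp: inside_vertices_def)
qed

text \<open>Stokes' theorem modulo \<open>d\<close>. The triangle \<open>x y z\<close> of an inner
  face at an edge \<open>x y\<close> of \<open>C\<close> is removed. If \<open>z\<close> is off
  \<open>C\<close>, the edge is replaced by the path \<open>x z y\<close>; otherwise the arcs from
  \<open>y\<close> to \<open>z\<close> and from \<open>z\<close> to \<open>x\<close> are closed up
  by the other sides of the triangle, and an arc that is a single edge needs only antisymmetry. No
  new cycle contains \<open>x y\<close>, so each has fewer inner faces.\<close>

lemma cycle_sum_dvd:
  assumes anti: "\<And>x y. {x, y} \<in> E \<Longrightarrow> d dvd s x y + s y x"
    and face: "\<And>F x y z. F \<in> Fs \<Longrightarrow> tri F = {x, y, z} \<Longrightarrow> x \<noteq> y \<Longrightarrow> y \<noteq> z \<Longrightarrow> x \<noteq> z \<Longrightarrow>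
      d dvd s x y + s y z + s z x"
    and C: "cyc C"
  shows "d dvd walk_sum s (C @ [hd C])"
  using C
proof (induction "card (ins C)" arbitrary: C rule: less_induct)
  case less
  have dist: "distinct C" and n: "3 \<le> length C" and CE: "cycle_edges C \<subseteq> E"
    using less.prems by (auto simp: cyc_def is_cycle_def)
  obtain x y D where C: "C = x # y # D" and D: "D \<noteq> []"
  proof (cases C rule: walk_edges.cases)
    case (1 x y zs)
    then show ?thesis using that[of x y zs] n by (cases zs) auto
  qed (use n in auto)
  have ce: "cycle_edges C = insert {x, y} (walk_edges (y # D @ [x]))"
    using cycle_edges_append[of x "[]" y D] by (simp add: C)
  have xy: "{x, y} \<in> cycle_edges C" by (simp add: ce)
  obtain F where F: "F \<in> ins C" "{x, y} \<subseteq> tri F" using boundary_faces[OF less.prems xy] by metis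
  have FFs: "F \<in> Fs" using F ins_faces less.prems by (auto simp: cyc_def)
  have "x \<noteq> y" using dist C by auto
  then obtain z where z: "tri F = {x, y, z}" "z \<noteq> x" "z \<noteq> y" using tri_third[OF FFs, of x y] F by auto
  have zE: "{x, z} \<in> E" "{z, y} \<in> E" using tri_edge[OF FFs] z by auto
  have fs: "d dvd s x y + s y z + s z x" using face[OF FFs z(1)] z \<open>x \<noteq> y\<close> by auto
  have axz: "d dvd s x z + s z x" "d dvd s z y + s y z" using anti zE by auto
  \<comment> \<open>Passing from \<open>C\<close> to the new cycles changes the sum by the boundary
    of the triangle, up to the antisymmetry defects of its other two sides.\<close>
  have comb: "d dvd a" if "d dvd b" "a = b + (s x y + s y z + s z x) - (s x z + s z x) - (s z y + s y z)" for a b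
    unfolding that(2) by (intro dvd_add dvd_diff that fs axz)
  show ?case
  proof (cases "z \<in> set C")
    case False
    let ?Z = "x # z # y # D"
    have ceZ: "cycle_edges ?Z = {{x, z}, {z, y}} \<union> walk_edges (y # D @ [x])"
      using cycle_edges_append[of x "[z]" y D] by (simp add: insert_commute)
    have "cyc ?Z" using ceZ ce CE zE dist False C by (auto simp: cyc_def is_cycle_def)
    moreover have "{x, y} \<notin> cycle_edges ?Z"
      using cycle_edge_endpoints[of x "[z]" y D] dist False C D by auto
    moreover have "\<exists>F\<in>ins C. e \<subseteq> tri F" if "e \<in> cycle_edges ?Z" "e \<notin> cycle_edges C" for e
      using that F z unfolding ce ceZ by (intro bexI[of _ F]) auto
    ultimately have "d dvd walk_sum s (?Z @ [hd ?Z])"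
      using less.hyps[of ?Z] ins_less(2)[of C ?Z] less.prems xy by blast
    then show ?thesis by (rule comb) (simp add: C)
  next
    case True
    then have "z \<in> set D" using C z by auto
    then obtain P Q where PQ: "D = P @ z # Q" by (meson split_list)
    let ?A = "y # P @ [z]" and ?B = "z # Q @ [x]"
    have we: "walk_edges (y # D @ [x]) = walk_edges (y # P @ [z]) \<union> walk_edges (z # Q @ [x])"
      using walk_edges_append[of "y # P" z "Q @ [x]"] PQ by simp
    have A: "d dvd walk_sum s ?A + s z y"
    proof (cases "P = []")
      case True then show ?thesis using axz by (simp add: add.commute)
    next
      case False
      have ceA: "cycle_edges ?A = insert {z, y} (walk_edges ?A)"
        using cycle_edges_append[of y P z "[]"] by simp
      have "cyc ?A" using False dist C PQ CE ce we ceA zE by (cases P) (auto simp: cyc_def is_cycle_def)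
      moreover have "{x, y} \<notin> cycle_edges ?A" using cycle_edges_subset[of "{x, y}" ?A] dist C PQ by auto
      moreover have "\<exists>F\<in>ins C. e \<subseteq> tri F" if "e \<in> cycle_edges ?A" "e \<notin> cycle_edges C" for e
        using that F z unfolding ce ceA we by (intro bexI[of _ F]) auto
      ultimately have "d dvd walk_sum s (?A @ [hd ?A])"
        using less.hyps[of ?A] ins_less(2)[of C ?A] less.prems xy by blast
      then show ?thesis using walk_sum_snoc2[of s "y # P" z y] by simp
    qed
    have B: "d dvd walk_sum s ?B + s x z"
    proof (cases "Q = []")
      case True then show ?thesis using axz by (simp add: add.commute)
    next
      case False
      have ceB: "cycle_edges ?B = insert {x, z} (walk_edges ?B)"
        using cycle_edges_append[of z Q x "[]"] by simp
      have "cyc ?B" using False dist C PQ CE ce we ceB zE by (cases Q) (auto simp: cyc_def is_cycle_def)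
      moreover have "{x, y} \<notin> cycle_edges ?B" using cycle_edges_subset[of "{x, y}" ?B] dist C PQ by auto
      moreover have "\<exists>F\<in>ins C. e \<subseteq> tri F" if "e \<in> cycle_edges ?B" "e \<notin> cycle_edges C" for e
        using that F z unfolding ce ceB we by (intro bexI[of _ F]) auto
      ultimately have "d dvd walk_sum s (?B @ [hd ?B])"
        using less.hyps[of ?B] ins_less(2)[of C ?B] less.prems xy by blast
      then show ?thesis using walk_sum_snoc2[of s "z # Q" x z] by simp
    qed
    have "walk_sum s (C @ [hd C]) = s x y + walk_sum s ?A + walk_sum s ?B"
      using walk_sum_append[of s "x # y # P" z "Q @ [x]"] by (simp add: C PQ)
    then show ?thesis
      by (intro comb[OF dvd_add[OF A B]]) simp
  qed
qed

lemma potential: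
  assumes "\<And>x y. {x, y} \<in> E \<Longrightarrow> d dvd s x y + s y x"
    and "\<And>F x y z. F \<in> Fs \<Longrightarrow> tri F = {x, y, z} \<Longrightarrow> x \<noteq> y \<Longrightarrow> y \<noteq> z \<Longrightarrow> x \<noteq> z \<Longrightarrow>
      d dvd s x y + s y z + s z x"
  obtains p :: "'a \<Rightarrow> int" where "\<And>x y. {x, y} \<in> E \<Longrightarrow> d dvd p y - p x - s x y"
proof -
  have "d dvd walk_sum s (C @ [hd C])" if "C \<noteq> []" "cycle_edges C \<subseteq> E" for C
    using card_edge assms(1) _ that
  proof (rule closed_walk_sum_dvd)
    fix C :: "'a list" assume "is_cycle C" "cycle_edges C \<subseteq> E"
    then show "d dvd walk_sum s (C @ [hd C])" using cycle_sum_dvd[of d s C] assms by (simp add: cyc_def)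
  qed
  from potential_exists[of E d s, OF assms(1) this] show ?thesis using that by blast
qed

text \<open>The neighbours \<open>p\<close> and \<open>q\<close> of \<open>x\<close> on a hole are
  joined by a path in the part of the link of \<open>x\<close> that lies inside; a shortest one is
  chordless. It will serve to bypass \<open>x\<close>, or an arc seen from \<open>x\<close>.\<close>

lemma link_path:
  assumes Z: "induced_cycle V E (x # p # P @ [q])"
  obtains R where "hd R = p" "last R = q" "R \<noteq> []" "distinct R" "walk_edges R \<subseteq> E"
    "set R \<subseteq> insert p (insert q (inside_vertices (x # p # P @ [q])))"
    "\<And>y. y \<in> set R \<Longrightarrow> {x, y} \<in> E"
    "\<And>y z. y \<in> set R \<Longrightarrow> z \<in> set R \<Longrightarrow> y \<noteq> z \<Longrightarrow> {y, z} \<in> E \<Longrightarrow> {y, z} \<in> walk_edges R"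
proof -
  let ?Z = "x # p # P @ [q]"
  have cZ: "cyc ?Z" using induced_cycle_cyc[OF Z] .
  have dist: "distinct ?Z" using cZ by (simp add: cyc_def is_cycle_def)
  have ce: "{x, p} \<in> cycle_edges ?Z" "{x, q} \<in> cycle_edges ?Z"
    using cycle_edges_append[of x "[]" p "P @ [q]"] cycle_edges_append[of x "p # P" q "[]"]
    by (auto simp: insert_commute)
  then have xpq: "{x, p} \<in> E" "{x, q} \<in> E" using cZ by (auto simp: cyc_def)
  define X where "X = {w. {x, w} \<in> E \<and> w \<in> insert p (insert q (inside_vertices ?Z))}"
  define Fx where "Fx = {F \<in> ins ?Z. x \<in> tri F}"
  have insFs: "ins ?Z \<subseteq> Fs" using ins_faces cZ by (auto simp: cyc_def)
  have finFx: "finite Fx" unfolding Fx_def using insFs fin by (auto intro: finite_subset)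
  have FxX: "w \<in> X" if "F \<in> Fx" "w \<in> tri F" "w \<noteq> x" for F w
  proof -
    have FF: "F \<in> Fs" "F \<in> ins ?Z" "x \<in> tri F" using that insFs by (auto simp: Fx_def)
    then have e: "{x, w} \<in> E" using tri_edge[of F x w] that by auto
    have "w \<in> insert p (insert q (inside_vertices ?Z))"
    proof (cases "w \<in> set ?Z")
      case True
      then have "{x, w} \<in> cycle_edges ?Z" using induced_cycle_edge[OF Z, of x w] e by simp
      then show ?thesis using cycle_nbr[of x "p # P @ [q]" w] dist by auto
    next
      case False
      then show ?thesis using FF that edge_vertices[OF e] by (auto simp: inside_vertices_def)
    qed
    then show ?thesis using e by (simp add: X_def)
  qed
  have xX: "x \<notin> X" using card_edge[of "{x, x}"] by (auto simp: X_def)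
  \<comment> \<open>The component of \<open>p\<close> in that part of the link. A face of
    \<open>Fx\<close> has both or none of its vertices other than \<open>x\<close> in
    \<open>K\<close>.\<close>
  define K where "K = {w. \<exists>xs. xs \<noteq> [] \<and> hd xs = p \<and> last xs = w \<and> walk_edges xs \<subseteq> E \<and> set xs \<subseteq> X}"
  have KX: "K \<subseteq> X" unfolding K_def using last_in_set by blast
  have pX: "p \<in> X" using xpq by (simp add: X_def)
  then have pK: "p \<in> K" unfolding K_def by (auto intro!: exI[of _ "[p]"])
  have Kext: "b \<in> K" if "a \<in> K" "b \<in> X" "{a, b} \<in> E" for a b
  proof -
    obtain xs where "xs \<noteq> []" "hd xs = p" "last xs = a" "walk_edges xs \<subseteq> E" "set xs \<subseteq> X"
      using \<open>a \<in> K\<close> by (auto simp: K_def)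
    then show ?thesis unfolding K_def using that walk_edges_append_walks[of xs "[b]"]
      by (intro CollectI exI[of _ "xs @ [b]"]) auto
  qed
  \<comment> \<open>Handshake: in the part of the link of \<open>x\<close> inside the cycle, only \<open>p\<close> and \<open>q\<close> have odd degree.\<close>
  have "q \<in> K"
  proof (rule ccontr)
    assume qK: "q \<notin> K"
    have finK: "finite K" by simp
    have "(\<Sum>w\<in>K. card {F \<in> Fx. w \<in> tri F}) = (\<Sum>w\<in>K. \<Sum>F\<in>Fx. of_bool (w \<in> tri F))"
      using finFx by (simp add: Int_def)
    also have "\<dots> = (\<Sum>F\<in>Fx. \<Sum>w\<in>K. of_bool (w \<in> tri F))" by (rule sum.swap)
    also have "\<dots> = (\<Sum>F\<in>Fx. card {w \<in> K. w \<in> tri F})" by (simp add: Int_def)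
    finally have swap: "(\<Sum>w\<in>K. card {F \<in> Fx. w \<in> tri F}) = (\<Sum>F\<in>Fx. card {w \<in> K. w \<in> tri F})" .
    have "even (card {w \<in> K. w \<in> tri F})" if F: "F \<in> Fx" for F
    proof -
      have FF: "F \<in> Fs" "x \<in> tri F" using F insFs by (auto simp: Fx_def)
      obtain a b c where abc: "tri F = {a, b, c}" "a \<noteq> b" "b \<noteq> c" "a \<noteq> c"
        using tri(1)[OF FF(1)] by (auto simp: card_3_iff)
      obtain y z where yz: "tri F = {x, y, z}" "y \<noteq> x" "z \<noteq> x" "y \<noteq> z"
      proof -
        obtain y where "y \<in> tri F" "y \<noteq> x" using abc by (metis insertI1 insertI2)
        then show ?thesis using tri_third[OF FF, of y] that by blast
      qed
      have "{y, z} \<in> E" using tri_edge[OF FF(1), of y z] yz by auto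
      moreover have "y \<in> X" "z \<in> X" using FxX[OF F] yz by auto
      ultimately have "y \<in> K \<longleftrightarrow> z \<in> K" using Kext[of y z] Kext[of z y] by (auto simp: insert_commute)
      then have "{w \<in> K. w \<in> tri F} = {} \<or> {w \<in> K. w \<in> tri F} = {y, z}"
        using yz xX KX by auto
      then have "card {w \<in> K. w \<in> tri F} = 0 \<or> card {w \<in> K. w \<in> tri F} = 2"
        using yz(4) by (elim disjE) (metis card.empty, simp)
      then show ?thesis by presburger
    qed
    then have "even (\<Sum>w\<in>K. card {F \<in> Fx. w \<in> tri F})" unfolding swap by (rule dvd_sum)
    moreover have "(\<Sum>w\<in>K. card {F \<in> Fx. w \<in> tri F}) = card {F \<in> Fx. p \<in> tri F} + (\<Sum>w\<in>K - {p}. card {F \<in> Fx. w \<in> tri F})"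
      using pK finK by (rule sum.remove[rotated])
    moreover have "card {F \<in> Fx. p \<in> tri F} = 1"
    proof -
      have "{F \<in> Fx. p \<in> tri F} = {F \<in> ins ?Z. {x, p} \<subseteq> tri F}" by (auto simp: Fx_def)
      then show ?thesis using ins_edge[of ?Z "{x, p}"] cZ ce by (simp add: cyc_def)
    qed
    moreover have "even (\<Sum>w\<in>K - {p}. card {F \<in> Fx. w \<in> tri F})"
    proof (rule dvd_sum)
      fix w assume w: "w \<in> K - {p}"
      then have "w \<in> X" "w \<noteq> q" using KX qK by auto
      then have wI: "w \<in> inside_vertices ?Z" "{x, w} \<in> E" using w by (auto simp: X_def)
      have "{F \<in> Fx. w \<in> tri F} = {F \<in> Fs. {x, w} \<subseteq> tri F}"
        using inside_face[OF cZ wI(1)] insFs by (auto simp: Fx_def)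
      then show "even (card {F \<in> Fx. w \<in> tri F})" using two_faces[OF wI(2)] by simp
    qed
    ultimately show False by simp
  qed
  then obtain xs where xs: "xs \<noteq> []" "hd xs = p" "last xs = q" "walk_edges xs \<subseteq> E" "set xs \<subseteq> X"
    by (auto simp: K_def)
  from shortest_walk[OF this] obtain ys where
    "ys \<noteq> []" "hd ys = p" "last ys = q" "walk_edges ys \<subseteq> E" "set ys \<subseteq> X" "distinct ys"
    "\<And>x y. x \<in> set ys \<Longrightarrow> y \<in> set ys \<Longrightarrow> x \<noteq> y \<Longrightarrow> {x, y} \<in> E \<Longrightarrow> {x, y} \<in> walk_edges ys"
    by blast
  then show ?thesis using that[of ys] by (auto simp: X_def)
qed

text \<open>An odd cycle among the neighbours of \<open>v\<close> is the rim of a wheel with hub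
  \<open>v\<close> all of whose segments are edges. All adjacent pairs of neighbours count here, not
  only those on a common face with \<open>v\<close>; so separating triangles are covered
  later.\<close>

lemma link_bipartite:
  assumes low: "\<not> has_induced_loose_odd_wheel V E" and v: "v \<in> V"
  obtains g :: "'a \<Rightarrow> int" where
    "\<And>x y. {v, x} \<in> E \<Longrightarrow> {v, y} \<in> E \<Longrightarrow> {x, y} \<in> E \<Longrightarrow> odd (g y - g x)"
proof -
  from odd_cycle_or_bipartite[of E "{x. {v, x} \<in> E}", OF card_edge] consider
    C where "induced_cycle {x. {v, x} \<in> E} E C" "odd (length C)"
    | g :: "'a \<Rightarrow> int" where "\<And>x y. x \<in> {x. {v, x} \<in> E} \<Longrightarrow> y \<in> {x. {v, x} \<in> E} \<Longrightarrow> {x, y} \<in> E \<Longrightarrow> odd (g y - g x)"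
    by metis
  then show ?thesis
  proof cases
    case (1 C)
    have nb: "{v, y} \<in> E" if "y \<in> set C" for y using 1 that by (auto simp: induced_cycle_def)
    have n: "3 \<le> length C" using 1 by (auto simp: induced_cycle_def is_cycle_def)
    have "{i. i < length C \<and> {v, C ! i} \<in> E \<and> {v, C ! (Suc i mod length C)} \<in> E} = {..<length C}"
    proof -
      have "Suc i mod length C < length C" for i using n by (intro mod_less_divisor) linarith
      then show ?thesis using nb by auto
    qed
    then have "3 \<le> card {i. i < length C \<and> {v, C ! i} \<in> E \<and> {v, C ! (Suc i mod length C)} \<in> E}"
      using n by simp
    moreover have "induced_cycle V E C" using 1 nb edge_vertices by (auto simp: induced_cycle_def)
    moreover have "v \<notin> set C" using nb[of v] edge_vertices[of v v] by auto
    ultimately show ?thesis using induced_loose_odd_wheel[OF graph _ 1(2) v] low by blast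
  next
    case (2 g)
    then show ?thesis using that[of g] by auto
  qed
qed

end

section \<open>Cyclic orientations and 3-colourings\<close>

definition cyclic_orientation :: "'a set set \<Rightarrow> ('a \<Rightarrow> 'a \<Rightarrow> int) \<Rightarrow> bool" where
  "cyclic_orientation E s \<longleftrightarrow>
    (\<forall>x y. {x, y} \<in> E \<longrightarrow> (s x y = 1 \<or> s x y = -1) \<and> s y x = - s x y) \<and>
    (\<forall>x y z. {x, y} \<in> E \<and> {y, z} \<in> E \<and> {z, x} \<in> E \<longrightarrow> s x y = s y z)"

context sphere_triangulation
begin

text \<open>\<open>g x\<close> is a 2-colouring of the neighbourhood of \<open>x\<close>. The sign
  of \<open>s x y\<close> follows \<open>g x y\<close>, hence differs for adjacent neighbours of
  \<open>x\<close>; the correction \<open>t x\<close> may swap the colours at \<open>x\<close> and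
  is chosen to make \<open>s\<close> antisymmetric. The required change of \<open>t\<close> can be
  integrated modulo 2: around a triangle it adds up to 3 plus three odd numbers, one for each
  corner.\<close>

lemma cyclic_orientation_exists:
  assumes low: "\<not> has_induced_loose_odd_wheel V E"
  obtains s where "cyclic_orientation E s"
proof -
  have "\<exists>g :: 'a \<Rightarrow> int. \<forall>x y. {v, x} \<in> E \<longrightarrow> {v, y} \<in> E \<longrightarrow> {x, y} \<in> E \<longrightarrow> odd (g y - g x)" if "v \<in> V" for v
    using link_bipartite[OF low that] by metis
  then obtain g :: "'a \<Rightarrow> 'a \<Rightarrow> int" where
    g: "\<And>v x y. v \<in> V \<Longrightarrow> {v, x} \<in> E \<Longrightarrow> {v, y} \<in> E \<Longrightarrow> {x, y} \<in> E \<Longrightarrow> odd (g v y - g v x)"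
    by metis
  have g3: "odd (g x y + g x z)" if "{x, y} \<in> E" "{x, z} \<in> E" "{y, z} \<in> E" for x y z
    using g[of x y z] that edge_vertices[of x y] by auto
  obtain t :: "'a \<Rightarrow> int" where t: "\<And>x y. {x, y} \<in> E \<Longrightarrow> 2 dvd t y - t x - (1 + g x y + g y x)"
  proof (rule potential[of 2 "\<lambda>x y. 1 + g x y + g y x"])
    fix F x y z assume F: "F \<in> Fs" "tri F = {x, y, z}" "x \<noteq> y" "y \<noteq> z" "x \<noteq> z"
    have "{x, y} \<in> E" "{x, z} \<in> E" "{y, z} \<in> E" using tri_edge[OF F(1)] F by auto
    then have "odd (g x y + g x z)" "odd (g y x + g y z)" "odd (g z x + g z y)"
      using g3[of x y z] g3[of y x z] g3[of z x y] by (auto simp: insert_commute)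
    then show "2 dvd (1 + g x y + g y x) + (1 + g y z + g z y) + (1 + g z x + g x z)" by presburger
  qed auto
  define s :: "'a \<Rightarrow> 'a \<Rightarrow> int" where "s x y = (if even (t x + g x y) then 1 else -1)" for x y
  have anti: "s y x = - s x y" if "{x, y} \<in> E" for x y
    using t[OF that] unfolding s_def by presburger
  have flip: "s x z = - s x y" if "{x, y} \<in> E" "{y, z} \<in> E" "{z, x} \<in> E" for x y z
    using g3[of x y z] that unfolding s_def by (simp add: insert_commute)
  have "s x y = s y z" if "{x, y} \<in> E" "{y, z} \<in> E" "{z, x} \<in> E" for x y z
    using flip[of y z x] anti[of x y] that by (simp add: insert_commute)
  then have "cyclic_orientation E s"
    unfolding cyclic_orientation_def using anti by (auto simp: s_def)
  then show ?thesis using that by blast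
qed

text \<open>The values of \<open>s\<close> around a face are equal and add up to 3 or -3. So
  \<open>s\<close> has a potential modulo 3, which changes by 1 or -1 along every edge.\<close>

lemma three_colouring:
  assumes s: "cyclic_orientation E s"
  obtains f :: "'a \<Rightarrow> nat" where "\<And>v. f v < 3" "\<And>x y. {x, y} \<in> E \<Longrightarrow> f x \<noteq> f y"
proof -
  obtain p :: "'a \<Rightarrow> int" where p: "\<And>x y. {x, y} \<in> E \<Longrightarrow> 3 dvd p y - p x - s x y"
  proof (rule potential[of 3 s])
    show "3 dvd s x y + s y x" if "{x, y} \<in> E" for x y
      using s that by (simp add: cyclic_orientation_def)
    fix F x y z assume F: "F \<in> Fs" "tri F = {x, y, z}" "x \<noteq> y" "y \<noteq> z" "x \<noteq> z"
    have "{x, y} \<in> E" "{y, z} \<in> E" "{z, x} \<in> E" using tri_edge[OF F(1)] F by auto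
    then have "s x y = s y z" "s y z = s z x" using s unfolding cyclic_orientation_def by blast+
    then show "3 dvd s x y + s y z + s z x" by simp
  qed blast
  define f where "f v = nat (p v mod 3)" for v
  have "f x \<noteq> f y" if e: "{x, y} \<in> E" for x y
  proof -
    have "s x y = 1 \<or> s x y = -1" using s e by (simp add: cyclic_orientation_def)
    then have "p x mod 3 \<noteq> p y mod 3" using p[OF e] by presburger
    then show ?thesis by (simp add: f_def eq_nat_nat_iff)
  qed
  moreover have "f v < 3" for v by (simp add: f_def nat_less_iff)
  ultimately show ?thesis using that by blast
qed

end

section \<open>Cutting a cycle at the neighbours of a hub\<close>

lemma closed_walk_segment:
  assumes C: "distinct C" "C \<noteq> []" "C @ [hd C] = A @ p # P @ q # B" "p \<noteq> q"
  obtains k Q where "rotate k C = p # P @ q # Q"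
proof (cases "B = []")
  case True
  \<comment> \<open>Here the segment ends at the base point, which the closed walk lists twice; in
    the rotated cycle it is the first vertex of \<open>A\<close>.\<close>
  then have eq: "C = A @ p # P" "q = hd C" using C(3) by (auto simp: append_eq_append_conv2 dest: arg_cong[of _ _ butlast] arg_cong[of _ _ last])
  then obtain A' where A': "A = q # A'" using C(4) by (cases A) auto
  have "rotate (length A) C = (p # P) @ A" unfolding eq(1) by (rule rotate_append)
  then have "rotate (length A) C = p # P @ q # A'" by (simp add: A')
  then show ?thesis using that by blast
next
  case False
  then have "B = butlast B @ [last B]" by simp
  then have "C = A @ p # P @ q # butlast B" using C(3) by (metis append_Cons append_assoc butlast_snoc)
  then have "rotate (length A) C = p # P @ q # (butlast B @ A)" by (simp add: rotate_append)
  then show ?thesis using that by blast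
qed

text \<open>The walk is cut at its visits to \<open>N\<close>. \<open>W\<close> is the excess of
  each segment with inner vertices over the telescoping term in \<open>h\<close>, and such segments
  are counted by their first step out of \<open>N\<close>. They have an even number of edges, so the
  single edges within \<open>N\<close> carry the parity of the walk.\<close>

lemma walk_segments:
  fixes h :: "'a \<Rightarrow> int"
  assumes "xs \<noteq> []" "hd xs \<in> N" "last xs \<in> N"
    and "\<And>A p P q B. xs = A @ p # P @ q # B \<Longrightarrow> p \<in> N \<Longrightarrow> q \<in> N \<Longrightarrow> set P \<inter> N = {} \<Longrightarrow>
      2 * walk_sum s (p # P @ [q]) = h p - h q + W * of_bool (P \<noteq> []) \<and> (P \<noteq> [] \<longrightarrow> odd (length P))"
  shows "2 * walk_sum s xs =
      h (hd xs) - h (last xs) + W * walk_sum (\<lambda>x y. of_bool (x \<in> N \<and> y \<notin> N)) xs \<and>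
    (even (walk_sum (\<lambda>x y. of_bool (x \<in> N \<and> y \<in> N)) xs) \<longleftrightarrow> odd (length xs))"
  using assms
proof (induction "length xs" arbitrary: xs rule: less_induct)
  case less
  let ?l = "\<lambda>x y. of_bool (x \<in> N \<and> y \<notin> N) :: int" and ?t = "\<lambda>x y. of_bool (x \<in> N \<and> y \<in> N) :: int"
  obtain p xs' where xs: "xs = p # xs'" using less.prems(1) by (cases xs) auto
  show ?case
  proof (cases "xs' = []")
    case True
    then show ?thesis using xs by simp
  next
    case False
    then have "\<exists>x\<in>set xs'. x \<in> N" using less.prems(3) xs by (intro bexI[of _ "last xs'"]) auto
    then obtain P q B where P: "xs' = P @ q # B" "q \<in> N" "\<forall>y\<in>set P. y \<notin> N"
      by (rule split_list_first_propE)
    have p: "p \<in> N" using less.prems(2) xs by simp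
    have seg: "2 * walk_sum s (p # P @ [q]) = h p - h q + W * of_bool (P \<noteq> []) \<and> (P \<noteq> [] \<longrightarrow> odd (length P))"
    proof (rule less.prems(4)[of "[]"])
      show "set P \<inter> N = {}" using P by blast
    qed (use P p xs in simp_all)
    have IH: "2 * walk_sum s (q # B) = h q - h (last (q # B)) + W * walk_sum ?l (q # B) \<and>
        (even (walk_sum ?t (q # B)) \<longleftrightarrow> odd (length (q # B)))"
    proof -
      have "2 * walk_sum s (a # R @ [b]) = h a - h b + W * of_bool (R \<noteq> []) \<and> (R \<noteq> [] \<longrightarrow> odd (length R))"
        if "q # B = A @ a # R @ b # D" "a \<in> N" "b \<in> N" "set R \<inter> N = {}" for A a R b D
        using less.prems(4)[of "p # P @ A" a R b D] that P xs by auto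
      then show ?thesis using less.hyps[of "q # B"] P xs less.prems(3) by auto
    qed
    have out: "walk_sum ?l (R @ [q]) = 0 \<and> walk_sum ?t (R @ [q]) = 0" if "\<forall>y\<in>set R. y \<notin> N" for R
      using that
    proof (induction R)
      case (Cons a R) then show ?case by (cases R) auto
    qed auto
    have "walk_sum ?l (p # P @ [q]) = of_bool (P \<noteq> [])" "walk_sum ?t (p # P @ [q]) = of_bool (P = [])"
      using out[of P] P p by (cases P; auto)+
    then have l: "walk_sum ?l xs = of_bool (P \<noteq> []) + walk_sum ?l (q # B)"
      and t: "walk_sum ?t xs = of_bool (P = []) + walk_sum ?t (q # B)"
      using walk_sum_append[of ?l "p # P" q B] walk_sum_append[of ?t "p # P" q B] xs P by auto
    have s: "walk_sum s xs = walk_sum s (p # P @ [q]) + walk_sum s (q # B)"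
      using walk_sum_append[of s "p # P" q B] xs P by auto
    have "last xs = last (q # B)" using xs P by simp
    then have "2 * walk_sum s xs = h (hd xs) - h (last xs) + W * walk_sum ?l xs"
      using seg IH unfolding l s by (simp add: xs algebra_simps)
    moreover have "length xs = 1 + length P + length (q # B)" using xs P by simp
    then have "even (walk_sum ?t xs) \<longleftrightarrow> odd (length xs)"
      using seg IH unfolding t by (cases "P = []") auto
    ultimately show ?thesis by blast
  qed
qed

lemma cyclic_orientation_value: "cyclic_orientation E s \<Longrightarrow> {x, y} \<in> E \<Longrightarrow> s x y = 1 \<or> s x y = -1"
  and cyclic_orientation_anti: "cyclic_orientation E s \<Longrightarrow> {x, y} \<in> E \<Longrightarrow> s y x = - s x y"
  by (simp_all add: cyclic_orientation_def)

text \<open>Along the triangle \<open>s u p\<close>, \<open>s p q\<close> and \<open>s q u\<close>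
  agree. Written as a difference, with the factor 2, the identity telescopes along the link of
  \<open>u\<close>.\<close>

lemma cyclic_orientation_link:
  assumes s: "cyclic_orientation E s" and e: "{u, p} \<in> E" "{u, q} \<in> E" "{p, q} \<in> E"
  shows "2 * s p q = s u p - s u q"
proof -
  have t: "s x y = s y z" if "{x, y} \<in> E" "{y, z} \<in> E" "{z, x} \<in> E" for x y z
    using s that unfolding cyclic_orientation_def by blast
  have e': "{q, u} \<in> E" using e by (simp add: insert_commute)
  have "s u p = s p q" "s p q = s q u" using t[of u p q] t[of p q u] e e' by auto
  moreover have "s q u = - s u q" using cyclic_orientation_anti[OF s e(2)] .
  ultimately show ?thesis by simp
qed

section \<open>Smaller holes from links\<close>

context sphere_triangulation
begin

lemma ins_rotate: "cyc C \<Longrightarrow> ins (rotate k C) = ins C"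
  using ins_mono[of C "rotate k C"] ins_mono[of "rotate k C" C]
  by (simp add: cyc_def is_cycle_def cycle_edges_rotate)

lemma link_sum:
  assumes s: "cyclic_orientation E s"
    and "R \<noteq> []" "walk_edges R \<subseteq> E" "\<And>y. y \<in> set R \<Longrightarrow> {x, y} \<in> E"
  shows "2 * walk_sum s R = s x (hd R) - s x (last R)"
  using assms(2-)
proof (induction R rule: walk_edges.induct)
  case (1 a b zs)
  have "2 * s a b = s x a - s x b"
    by (rule cyclic_orientation_link[OF assms(1)]) (use 1 in auto)
  then show ?case using 1 by simp
qed auto

text \<open>Chords of the new cycle are excluded within the path by \<open>ind\<close>, between the
  inner path and \<open>Q\<close> by \<open>apart\<close>, and elsewhere since the old cycle is
  induced. New edges have an end inside the old cycle and the edges of \<open>P\<close> are lost, so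
  the number of inner faces drops.\<close>

lemma replace_arc:
  assumes C: "induced_cycle V E (p # P @ q # Q)" and ne: "P \<noteq> []" "Q \<noteq> []"
    and R: "hd R = p" "last R = q" "distinct R" "walk_edges R \<subseteq> E"
    and inner: "\<And>y. y \<in> set R \<Longrightarrow> y \<noteq> p \<Longrightarrow> y \<noteq> q \<Longrightarrow> y \<in> inside_vertices (p # P @ q # Q)"
    and ind: "\<And>y z. y \<in> set R \<Longrightarrow> z \<in> set R \<Longrightarrow> y \<noteq> z \<Longrightarrow> {y, z} \<in> E \<Longrightarrow> {y, z} \<in> walk_edges R"
    and apart: "\<And>y z. y \<in> set R \<Longrightarrow> y \<noteq> p \<Longrightarrow> y \<noteq> q \<Longrightarrow> z \<in> set Q \<Longrightarrow> {y, z} \<notin> E"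
  obtains R' where "R = p # R' @ [q]" "induced_cycle V E (p # R' @ q # Q)"
    "4 \<le> length (p # R' @ q # Q)" "card (ins (p # R' @ q # Q)) < card (ins (p # P @ q # Q))"
proof -
  let ?C = "p # P @ q # Q"
  have cC: "cyc ?C" using induced_cycle_cyc[OF C] .
  have dist: "distinct ?C" and CV: "set ?C \<subseteq> V" and CE: "cycle_edges ?C \<subseteq> E"
    using C cC by (auto simp: cyc_def is_cycle_def induced_cycle_def)
  have pq: "p \<noteq> q" using dist by auto
  obtain R0 where R0: "R = p # R0" using R(1,2) pq hd_Nil_eq_last
    by (cases R) auto
  then have "R0 \<noteq> []" using R pq by auto
  then obtain R' where R': "R = p # R' @ [q]" using R(2) R0 by (metis append_butlast_last_id last_ConsR)
  have dR: "distinct (p # R' @ [q])" using R(3) R' by simp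
  let ?D = "p # R' @ q # Q"
  have RI: "set R' \<subseteq> inside_vertices ?C" using inner R' dR by auto
  then have RC: "set R' \<inter> set ?C = {}" by (auto simp: inside_vertices_def)
  \<comment> \<open>So the path has an inner vertex, which makes the new cycle at least as long as
    4.\<close>
  have npq: "{p, q} \<notin> E"
    using induced_cycle_edge[OF C, of p q] cycle_edge_endpoints[OF dist] ne by auto
  have "R' \<noteq> []" using R(4) R' npq by auto
  have len: "4 \<le> length ?D" using \<open>R' \<noteq> []\<close> ne by (cases R'; cases Q) auto
  have ceC: "cycle_edges ?C = walk_edges (p # P @ [q]) \<union> walk_edges (q # Q @ [p])"
    and ceD: "cycle_edges ?D = walk_edges (p # R' @ [q]) \<union> walk_edges (q # Q @ [p])"
    by (rule cycle_edges_append)+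
  have DE: "cycle_edges ?D \<subseteq> E" using ceC ceD CE R(4) R' by auto
  have isD: "is_cycle ?D" using len dist dR RC by (auto simp: is_cycle_def)
  have cD: "cyc ?D" using isD DE by (simp add: cyc_def)
  have DV: "set ?D \<subseteq> V" using CV RI by (auto simp: inside_vertices_def)
  have "e \<in> cycle_edges ?D" if e: "e \<in> E" "e \<subseteq> set ?D" for e
  proof -
    obtain a b where ab: "e = {a, b}" "a \<noteq> b" using card_edge[OF e(1)] by (auto simp: card_2_iff)
    show ?thesis
    proof (cases "e \<inter> set R' = {}")
      case True
      then have "a \<in> set ?C" "b \<in> set ?C" using e ab by auto
      then have "e \<in> cycle_edges ?C" using induced_cycle_edge[OF C, of a b] e ab by simp
      moreover have "e \<notin> walk_edges (p # P @ [q])"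
        using walk_edges_inner[of e p P q] ne e True dist by auto
      ultimately show ?thesis using ceC ceD by auto
    next
      case False
      have *: "e \<in> walk_edges R" if "e = {c, d}" "c \<in> set R'" "c \<noteq> d" for c d
      proof -
        have "d \<notin> set Q" using apart[of c d] that e(1) R' dR by auto
        then have "d \<in> set R" using that e(2) R' by auto
        then show ?thesis using ind[of c d] that e(1) R' by auto
      qed
      have "a \<in> set R' \<or> b \<in> set R'" using False ab by auto
      moreover have "e = {b, a}" using ab(1) by blast
      ultimately have "e \<in> walk_edges R" using *[OF ab(1) _ ab(2)] *[of b a] ab(2) by blast
      then show ?thesis using ceD R' by auto
    qed
  qed
  then have "induced_edges E (set ?D) = cycle_edges ?D"
    using DE cycle_edges_subset[of _ ?D] by (auto simp: induced_edges_def)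
  then have iD: "induced_cycle V E ?D" using isD DV by (simp add: induced_cycle_def)
  obtain x P' where P': "P = x # P'" using ne by (cases P) auto
  have "{p, x} \<in> cycle_edges ?C" using ceC P' by simp
  moreover have "{p, x} \<notin> cycle_edges ?D"
    using cycle_edges_subset[of "{p, x}" ?D] RC dist P' by auto
  moreover have "\<exists>F\<in>ins ?C. e \<subseteq> tri F" if e: "e \<in> cycle_edges ?D" "e \<notin> cycle_edges ?C" for e
  proof -
    have "e \<in> walk_edges (p # R' @ [q])" using e ceC ceD by auto
    from walk_edges_inner[OF this \<open>R' \<noteq> []\<close>] obtain y where y: "y \<in> e" "y \<in> set R'" by blast
    have "y \<in> inside_vertices ?C" using y RI by blast
    moreover have "e \<in> E" using e DE by blast
    ultimately show ?thesis using inside_edge[OF cC] y(1) by blast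
  qed
  ultimately have "card (ins ?D) < card (ins ?C)" using ins_less(2)[OF cC cD] by blast
  then show ?thesis using that R' iD len by blast
qed

text \<open>Two smaller holes are used. The cycle of \<open>u\<close> and the arc \<open>P\<close>
  has sum 0, which gives the sum over the arc and, by parity, its length. Replacing the arc in
  \<open>C\<close> by a path in the link of \<open>u\<close> gives another hole with sum 0, so the
  other arc has half the sum \<open>s u q - s u p\<close>. Together this is three halves.\<close>

lemma hub_segment:
  assumes s: "cyclic_orientation E s"
    and C: "induced_cycle V E (p # P @ q # Q)" and ne: "P \<noteq> []" "Q \<noteq> []"
    and IH: "\<And>D. induced_cycle V E D \<Longrightarrow> 4 \<le> length D \<Longrightarrow>
      card (ins D) < card (ins (p # P @ q # Q)) \<Longrightarrow> walk_sum s (D @ [hd D]) = 0"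
    and u: "u \<in> inside_vertices (p # P @ q # Q)" "{u, p} \<in> E" "{u, q} \<in> E"
      "\<And>y. y \<in> set P \<Longrightarrow> {u, y} \<notin> E"
  shows "walk_sum s (p # P @ [q]) = s u q - s u p" "odd (length P)"
    "2 * walk_sum s ((p # P @ q # Q) @ [p]) = 3 * (s u q - s u p)"
proof -
  let ?C = "p # P @ q # Q" and ?Z = "u # p # P @ [q]"
  have cC: "cyc ?C" using induced_cycle_cyc[OF C] .
  have dist: "distinct ?C" and CV: "set ?C \<subseteq> V" and CE: "cycle_edges ?C \<subseteq> E"
    using C cC by (auto simp: cyc_def is_cycle_def induced_cycle_def)
  have uC: "u \<notin> set ?C" "u \<in> V" using u(1) by (auto simp: inside_vertices_def)
  have ceC: "cycle_edges ?C = walk_edges (p # P @ [q]) \<union> walk_edges (q # Q @ [p])"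
    by (rule cycle_edges_append)
  have ceZ: "cycle_edges ?Z = {{u, p}, {u, q}} \<union> walk_edges (p # P @ [q])"
    using cycle_edges_append[of u "p # P" q "[]"] by (auto simp: insert_commute)
  have ZE: "cycle_edges ?Z \<subseteq> E" using ceZ ceC CE u by auto
  have isZ: "is_cycle ?Z" using dist uC by (auto simp: is_cycle_def)
  have cZ: "cyc ?Z" using isZ ZE by (simp add: cyc_def)
  have "e \<in> cycle_edges ?Z" if e: "e \<in> E" "e \<subseteq> set ?Z" for e
  proof -
    obtain a b where ab: "e = {a, b}" "a \<noteq> b" using card_edge[OF e(1)] by (auto simp: card_2_iff)
    show ?thesis
    proof (cases "u \<in> e")
      case True
      then obtain y where y: "e = {u, y}" "y \<noteq> u" using ab by auto
      then have "y = p \<or> y = q" using e u(4)[of y] by auto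
      then show ?thesis using y ceZ by auto
    next
      case False
      then have "a \<in> set ?C" "b \<in> set ?C" using e ab by auto
      then have "e \<in> cycle_edges ?C" using induced_cycle_edge[OF C, of a b] e ab by simp
      moreover have "e \<notin> walk_edges (q # Q @ [p])"
        using walk_edges_inner[of e q Q p] ne e False dist by auto
      ultimately show ?thesis using ceC ceZ by auto
    qed
  qed
  then have "induced_edges E (set ?Z) = cycle_edges ?Z"
    using ZE cycle_edges_subset[of _ ?Z] by (auto simp: induced_edges_def)
  then have iZ: "induced_cycle V E ?Z" using isZ CV uC by (simp add: induced_cycle_def)
  obtain x Q' where Q': "Q = x # Q'" using ne by (cases Q) auto
  have "{q, x} \<in> cycle_edges ?C" using ceC Q' by simp
  moreover have "{q, x} \<notin> cycle_edges ?Z"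
    using cycle_edges_subset[of "{q, x}" ?Z] uC dist Q' by auto
  moreover have "\<exists>F\<in>ins ?C. e \<subseteq> tri F" if e: "e \<in> cycle_edges ?Z" "e \<notin> cycle_edges ?C" for e
  proof (rule inside_edge[OF cC u(1)])
    show "e \<in> E" using e ZE by blast
    show "u \<in> e" using e ceC ceZ by auto
  qed
  ultimately have Zlt: "ins ?Z \<subseteq> ins ?C" "card (ins ?Z) < card (ins ?C)"
    using ins_less[OF cC cZ] by blast+
  have Z4: "4 \<le> length ?Z" using ne by (cases P) auto
  have sqp: "s q u = - s u q" using s u by (simp add: cyclic_orientation_def)
  have sZ: "walk_sum s (?Z @ [u]) = s u p + walk_sum s (p # P @ [q]) + s q u"
    using walk_sum_append[of s "u # p # P" q "[u]"] by simp
  have Z0: "walk_sum s (?Z @ [hd ?Z]) = 0" using IH[OF iZ Z4 Zlt(2)] .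
  then show seg: "walk_sum s (p # P @ [q]) = s u q - s u p" using sZ sqp by simp
  have odd_s: "odd (s x y)" if "{x, y} \<in> E" for x y
  proof -
    have "s x y = 1 \<or> s x y = -1" using s that by (simp add: cyclic_orientation_def)
    then show ?thesis by auto
  qed
  have "even (walk_sum s (?Z @ [hd ?Z])) \<longleftrightarrow> odd (length (?Z @ [hd ?Z]))"
    by (rule walk_sum_parity) (use ZE odd_s in \<open>auto simp: cycle_edges_walk\<close>)
  then have "odd (length (?Z @ [hd ?Z]))" unfolding Z0 by simp
  then show "odd (length P)" by simp
  obtain R where R: "hd R = p" "last R = q" "R \<noteq> []" "distinct R" "walk_edges R \<subseteq> E"
    and RZ: "set R \<subseteq> insert p (insert q (inside_vertices ?Z))"
    and Ru: "\<And>y. y \<in> set R \<Longrightarrow> {u, y} \<in> E"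
    and Rind: "\<And>y z. y \<in> set R \<Longrightarrow> z \<in> set R \<Longrightarrow> y \<noteq> z \<Longrightarrow> {y, z} \<in> E \<Longrightarrow> {y, z} \<in> walk_edges R"
    using link_path[OF iZ] by blast
  have IZC: "inside_vertices ?Z \<subseteq> inside_vertices ?C" using inside_vertices_mono[OF cC cZ Zlt(1)] .
  obtain R' where R': "R = p # R' @ [q]" and D: "induced_cycle V E (p # R' @ q # Q)"
    "4 \<le> length (p # R' @ q # Q)" "card (ins (p # R' @ q # Q)) < card (ins ?C)"
  proof (rule replace_arc[OF C ne R(1,2,4,5)])
    show "y \<in> inside_vertices ?C" if "y \<in> set R" "y \<noteq> p" "y \<noteq> q" for y using that RZ IZC by auto
    show "{y, z} \<in> walk_edges R" if "y \<in> set R" "z \<in> set R" "y \<noteq> z" "{y, z} \<in> E" for y z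
      using Rind that by blast
    \<comment> \<open>\<open>y\<close> is strictly inside \<open>?Z\<close>, and \<open>z\<close> is
      neither on \<open>?Z\<close> nor inside it.\<close>
    show "{y, z} \<notin> E" if "y \<in> set R" "y \<noteq> p" "y \<noteq> q" "z \<in> set Q" for y z
    proof
      assume e: "{y, z} \<in> E"
      have "y \<in> inside_vertices ?Z" using that RZ by auto
      moreover have "z \<notin> set ?Z" using that uC dist by auto
      ultimately have "z \<in> inside_vertices ?Z" using inside_adjacent[OF cZ _ e] by blast
      then have "z \<in> inside_vertices ?C" using IZC by blast
      then show False using that by (auto simp: inside_vertices_def)
    qed
  qed (use that in blast)
  have "walk_sum s ((p # R' @ q # Q) @ [p]) = 0" using IH[OF D] by simp
  then have "walk_sum s R + walk_sum s (q # Q @ [p]) = 0" using cycle_sum_append[of s p R' q Q] R' by simp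
  moreover have "2 * walk_sum s R = s u p - s u q" using link_sum[OF s R(3,5), of u] Ru R by simp
  moreover have "walk_sum s (?C @ [p]) = walk_sum s (p # P @ [q]) + walk_sum s (q # Q @ [p])"
    by (rule cycle_sum_append)
  ultimately show "2 * walk_sum s (?C @ [p]) = 3 * (s u q - s u p)" using seg by simp
qed

text \<open>If \<open>a\<close> and \<open>b\<close> are not adjacent, \<open>hub_segment\<close>
  applies to every segment with inner vertices. Each adds \<open>W\<close> to a sum that otherwise
  telescopes to 0, so there is exactly one. As \<open>W\<close> is 3 or -3, the cycle is odd, and so
  is the number of rim edges with both ends in \<open>N\<close>. Three of them would give a loose
  odd wheel; hence there is one, and \<open>N\<close> consists of its two ends, which are
  \<open>a\<close> and \<open>b\<close>.\<close>

lemma hub_neighbours_adjacent: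
  assumes low: "\<not> has_induced_loose_odd_wheel V E" and s: "cyclic_orientation E s"
    and C: "induced_cycle V E C" and W: "walk_sum s (C @ [hd C]) \<noteq> 0"
    and IH: "\<And>D. induced_cycle V E D \<Longrightarrow> 4 \<le> length D \<Longrightarrow>
      card (ins D) < card (ins C) \<Longrightarrow> walk_sum s (D @ [hd D]) = 0"
    and u: "u \<in> inside_vertices C" "{u, a} \<in> E" "{u, b} \<in> E" "a \<in> set C" "b \<in> set C" "a \<noteq> b"
  shows "{a, b} \<in> E"
proof (rule ccontr)
  have rot: "ins (rotate k C) = ins C" for k using ins_rotate induced_cycle_cyc[OF C] .
  assume nab: "{a, b} \<notin> E"
  define N where "N = {y \<in> set C. {u, y} \<in> E}"
  have aN: "a \<in> N" "b \<in> N" using u by (auto simp: N_def)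
  obtain k D0 where k: "rotate k C = a # D0" using rotate_to[OF u(4)] .
  define D where "D = a # D0"
  have rD: "rotate k C = D" using k by (simp add: D_def)
  have iD: "induced_cycle V E D" using C induced_cycle_rotate[of V E k C] rD by simp
  have insD: "ins D = ins C" using rot[of k] rD by simp
  have setD: "set D = set C" using rD by (metis set_rotate)
  have WD: "walk_sum s (D @ [hd D]) = walk_sum s (C @ [hd C])" using cycle_sum_rotate[of s k C] rD by simp
  define W where "W = walk_sum s (C @ [hd C])"
  have cD: "cyc D" using induced_cycle_cyc[OF iD] .
  have dist: "distinct D" and nD: "3 \<le> length D" and DE: "cycle_edges D \<subseteq> E"
    using cD by (auto simp: cyc_def is_cycle_def)
  have uN: "u \<notin> set D" using u(1) setD by (auto simp: inside_vertices_def)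
  have anti: "s y x = - s x y" if "{x, y} \<in> E" for x y using s that by (simp add: cyclic_orientation_def)
  have pm: "s x y = 1 \<or> s x y = -1" if "{x, y} \<in> E" for x y using s that by (simp add: cyclic_orientation_def)
  let ?l = "\<lambda>x y. of_bool (x \<in> N \<and> y \<notin> N) :: int" and ?t = "\<lambda>x y. of_bool (x \<in> N \<and> y \<in> N) :: int"
  have long: "walk_sum s (p # P @ [q]) = s u q - s u p \<and> odd (length P) \<and> 2 * W = 3 * (s u q - s u p)"
    if d: "D @ [hd D] = A @ p # P @ q # B" and pq: "p \<in> N" "q \<in> N" "set P \<inter> N = {}" "P \<noteq> []" for A p P q B
  proof -
    \<comment> \<open>Equal ends would mean that the segment runs around the whole cycle and that
      the hub has one neighbour on it.\<close>
    have "p \<noteq> q"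
    proof
      assume "p = q"
      have "length A + length P + length B + 1 = length D" using arg_cong[OF d, of length] by simp
      have "A = [] \<and> B = []"
      proof (rule ccontr)
        assume "\<not> (A = [] \<and> B = [])"
        then have "\<not> distinct (butlast (D @ [hd D])) \<or> \<not> distinct (tl (D @ [hd D]))"
          unfolding d using \<open>p = q\<close> by (cases A; cases B) (auto simp: butlast_append)
        moreover have "distinct (tl (D @ [hd D]))" using dist by (simp add: D_def)
        ultimately show False using dist by simp
      qed
      then have "D = p # P" using d \<open>p = q\<close> by (auto simp: D_def)
      then have "N \<subseteq> {p}" using pq setD by (auto simp: N_def)
      then show False using aN u(6) by auto
    qed
    then obtain j Q where j: "rotate j D = p # P @ q # Q"
      using closed_walk_segment[OF dist _ d] nD by (metis list.size(3) not_numeral_le_zero)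
    have iQ: "induced_cycle V E (p # P @ q # Q)" using iD induced_cycle_rotate[of V E j D] j by simp
    have setQ: "set (p # P @ q # Q) = set C" using j setD by (metis set_rotate)
    have insQ: "ins (p # P @ q # Q) = ins C" using rot[of "j + k"] j rD by (metis rotate_rotate)
    \<comment> \<open>Otherwise \<open>p\<close> and \<open>q\<close> would be adjacent and the only
      neighbours of \<open>u\<close> on the cycle, against the choice of \<open>a\<close> and
      \<open>b\<close>.\<close>
    have "Q \<noteq> []"
    proof
      assume "Q = []"
      then have "N \<subseteq> {p, q}" using setQ pq by (auto simp: N_def)
      then have "{a, b} = {p, q}" using aN u(6) by auto
      moreover have "{p, q} \<in> cycle_edges (p # P @ q # Q)"
        using cycle_edges_append[of p P q Q] \<open>Q = []\<close> by (auto simp: insert_commute)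
      ultimately show False using nab iQ by (auto simp: induced_cycle_def induced_edges_def)
    qed
    have uI: "u \<in> inside_vertices (p # P @ q # Q)" using u(1) setQ insQ by (simp add: inside_vertices_def)
    have upq: "{u, p} \<in> E" "{u, q} \<in> E" "\<And>y. y \<in> set P \<Longrightarrow> {u, y} \<notin> E"
      using pq setQ by (auto simp: N_def)
    have IHQ: "\<And>D. induced_cycle V E D \<Longrightarrow> 4 \<le> length D \<Longrightarrow>
      card (ins D) < card (ins (p # P @ q # Q)) \<Longrightarrow> walk_sum s (D @ [hd D]) = 0" using IH insQ by simp
    have "walk_sum s ((p # P @ q # Q) @ [p]) = W"
      using cycle_sum_rotate[of s j D] j WD by (simp add: W_def)
    then show ?thesis using hub_segment[OF s iQ pq(4) \<open>Q \<noteq> []\<close> IHQ uI upq] by simp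
  qed
  \<comment> \<open>For a segment with inner vertices, twice its sum is
    \<open>2 * (s u q - s u p)\<close>; the form needed by \<open>walk_segments\<close> follows by
    inserting \<open>2 * W = 3 * (s u q - s u p)\<close>.\<close>
  have seg: "2 * walk_sum s (p # P @ [q]) = s u p - s u q + (2 * W) * of_bool (P \<noteq> []) \<and> (P \<noteq> [] \<longrightarrow> odd (length P))"
    if d: "D @ [hd D] = A @ p # P @ q # B" and pq: "p \<in> N" "q \<in> N" "set P \<inter> N = {}" for A p P q B
  proof (cases "P = []")
    case True
    have "{p, q} \<in> walk_edges (D @ [hd D])" unfolding d True using walk_edges_append[of A p "q # B"] by simp
    then have e: "{p, q} \<in> E" using DE by (auto simp: cycle_edges_walk)
    have "{u, p} \<in> E" "{u, q} \<in> E" using pq by (auto simp: N_def)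
    then have "2 * s p q = s u p - s u q" using cyclic_orientation_link[OF s _ _ e] by blast
    then show ?thesis using True by simp
  next
    case False
    then show ?thesis using long[OF d pq] by simp
  qed
  have closed: "D @ [hd D] \<noteq> []" "hd (D @ [hd D]) = a" "last (D @ [hd D]) = a" by (simp_all add: D_def)
  have closed_segments: "2 * walk_sum s (D @ [hd D]) = w * walk_sum ?l (D @ [hd D]) \<and>
      (even (walk_sum ?t (D @ [hd D])) \<longleftrightarrow> odd (length (D @ [hd D])))"
    if "\<And>A p P q B. D @ [hd D] = A @ p # P @ q # B \<Longrightarrow> p \<in> N \<Longrightarrow> q \<in> N \<Longrightarrow> set P \<inter> N = {} \<Longrightarrow>
      2 * walk_sum s (p # P @ [q]) = s u p - s u q + w * of_bool (P \<noteq> []) \<and> (P \<noteq> [] \<longrightarrow> odd (length P))" for w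
  proof -
    have "2 * walk_sum s (D @ [hd D]) = s u (hd (D @ [hd D])) - s u (last (D @ [hd D])) +
        w * walk_sum ?l (D @ [hd D]) \<and>
      (even (walk_sum ?t (D @ [hd D])) \<longleftrightarrow> odd (length (D @ [hd D])))"
    proof (rule walk_segments)
      fix A p P q B
      assume "D @ [hd D] = A @ p # P @ q # B" "p \<in> N" "q \<in> N" "set P \<inter> N = {}"
      then show "2 * walk_sum s (p # P @ [q]) = s u p - s u q + w * of_bool (P \<noteq> []) \<and>
          (P \<noteq> [] \<longrightarrow> odd (length P))" by (rule that)
    qed (use closed aN in simp_all)
    then show ?thesis unfolding closed by simp
  qed
  have "2 * walk_sum s (D @ [hd D]) = (2 * W) * walk_sum ?l (D @ [hd D]) \<and>
      (even (walk_sum ?t (D @ [hd D])) \<longleftrightarrow> odd (length (D @ [hd D])))"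
    by (rule closed_segments) (rule seg)
  then have main: "2 * walk_sum s (D @ [hd D]) = (2 * W) * walk_sum ?l (D @ [hd D])"
    and par: "even (walk_sum ?t (D @ [hd D])) \<longleftrightarrow> odd (length (D @ [hd D]))"
    by blast+
  have L1: "walk_sum ?l (D @ [hd D]) = 1"
    using main WD W by (simp add: W_def)
  have "odd (length D)"
  proof -
    \<comment> \<open>If all segments were edges, the sum around the cycle would telescope to
      0.\<close>
    have "\<exists>A p P q B. D @ [hd D] = A @ p # P @ q # B \<and> p \<in> N \<and> q \<in> N \<and> set P \<inter> N = {} \<and> P \<noteq> []"
    proof (rule ccontr)
      assume n: "\<not> ?thesis"
      have "2 * walk_sum s (D @ [hd D]) = 0 * walk_sum ?l (D @ [hd D]) \<and>
        (even (walk_sum ?t (D @ [hd D])) \<longleftrightarrow> odd (length (D @ [hd D])))"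
      proof (rule closed_segments)
        fix A p P q B
        assume d: "D @ [hd D] = A @ p # P @ q # B" "p \<in> N" "q \<in> N" "set P \<inter> N = {}"
        then have "P = []" using n by blast
        then show "2 * walk_sum s (p # P @ [q]) = s u p - s u q + 0 * of_bool (P \<noteq> []) \<and>
            (P \<noteq> [] \<longrightarrow> odd (length P))" using seg[OF d] by simp
      qed
      then have "2 * walk_sum s (D @ [hd D]) = 0" by simp
      then show False using W WD by simp
    qed
    then obtain p q where pq: "p \<in> N" "q \<in> N" "2 * W = 3 * (s u q - s u p)" using long by blast
    then have "s u p = 1 \<or> s u p = -1" "s u q = 1 \<or> s u q = -1" using pm by (auto simp: N_def)
    then have "odd W" using pq(3) W unfolding W_def by (elim disjE) simp_all
    moreover have "even (walk_sum s (D @ [hd D])) \<longleftrightarrow> odd (length (D @ [hd D]))"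
    proof (rule walk_sum_parity)
      fix x y assume "{x, y} \<in> walk_edges (D @ [hd D])"
      then have "{x, y} \<in> E" using DE by (auto simp: cycle_edges_walk)
      then show "odd (s x y)" using pm[of x y] by auto
    qed simp
    ultimately show ?thesis using WD by (simp add: W_def)
  qed
  then have oddT: "odd (walk_sum ?t (D @ [hd D]))" using par by simp
  let ?n = "length D"
  define T where "T = {i. i < ?n \<and> D ! i \<in> N \<and> D ! (Suc i mod ?n) \<in> N}"
  have of_bool_sum: "(\<Sum>i<?n. of_bool (Q i) :: int) = int (card {i. i < ?n \<and> Q i})" for Q
    by (simp add: Int_def)
  have cT: "walk_sum ?t (D @ [hd D]) = int (card T)"
    unfolding cycle_sum_nth T_def by (rule of_bool_sum)
  have in_D: "D ! (Suc i mod ?n) \<in> set D" if "i < ?n" for i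
  proof -
    have "Suc i mod ?n < ?n" using nD by (intro mod_less_divisor) linarith
    then show ?thesis by simp
  qed
  have "card T < 3"
  proof (rule ccontr)
    assume "\<not> card T < 3"
    moreover have "T = {i. i < ?n \<and> {u, D ! i} \<in> E \<and> {u, D ! (Suc i mod ?n)} \<in> E}"
      using in_D setD by (auto simp: T_def N_def)
    ultimately have "has_induced_loose_odd_wheel V E"
      using induced_loose_odd_wheel[OF graph iD \<open>odd (length D)\<close> _ uN] u(1)
      by (simp add: inside_vertices_def)
    then show False using low by blast
  qed
  moreover have "odd (card T)" using oddT cT by simp
  ultimately have T1: "card T = 1" by presburger
  then obtain i where i: "i \<in> T" by (auto simp: card_1_singleton_iff)
  \<comment> \<open>The vertices of \<open>N\<close> are counted by whether their successor on the
    cycle leaves \<open>N\<close>; each case occurs once.\<close>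
  have "int (card {i. i < ?n \<and> D ! i \<in> N}) = walk_sum ?l (D @ [hd D]) + walk_sum ?t (D @ [hd D])"
    unfolding cycle_sum_nth of_bool_sum[symmetric] sum.distrib[symmetric]
    by (rule sum.cong) auto
  then have "card {i. i < ?n \<and> D ! i \<in> N} = 2" using L1 cT T1 by simp
  moreover have "card N \<le> card {i. i < ?n \<and> D ! i \<in> N}"
  proof (rule surj_card_le)
    show "N \<subseteq> (!) D ` {i. i < ?n \<and> D ! i \<in> N}"
    proof
      fix y assume "y \<in> N"
      then have "y \<in> set D" using setD by (auto simp: N_def)
      then show "y \<in> (!) D ` {i. i < ?n \<and> D ! i \<in> N}" using \<open>y \<in> N\<close> by (auto simp: in_set_conv_nth)
    qed
  qed simp
  ultimately have "N = {a, b}" using aN u(6) by (intro card_seteq[symmetric]) (auto simp: N_def)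
  moreover have e: "{D ! i, D ! (Suc i mod ?n)} \<in> cycle_edges D" using i by (auto simp: cycle_edges_def T_def)
  then have "{D ! i, D ! (Suc i mod ?n)} \<in> E" using DE by blast
  moreover have "D ! i \<noteq> D ! (Suc i mod ?n)" using edge_vertices calculation by blast
  ultimately have "{a, b} \<in> E" using i by (auto simp: T_def insert_commute)
  then show False using nab by blast
qed

text \<open>In a minimal counterexample with sum \<open>W\<close>, each vertex \<open>x\<close> of
  the cycle, with neighbours \<open>p\<close> and \<open>q\<close> there, can be bypassed through
  its own link. This gives \<open>2 * W = 3 * (s p x + s x q)\<close>, so for \<open>W\<close> other
  than 0 both signs agree and \<open>W = 3 * s p x\<close>. Summation over the \<open>n\<close>
  edges yields \<open>3 * W = n * W\<close>, against \<open>4 \<le> n\<close>.\<close>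

lemma hole_sum_zero:
  assumes low: "\<not> has_induced_loose_odd_wheel V E" and s: "cyclic_orientation E s"
    and C: "induced_cycle V E C" "4 \<le> length C"
  shows "walk_sum s (C @ [hd C]) = 0"
  using C
proof (induction "card (ins C)" arbitrary: C rule: less_induct)
  case less
  let ?W = "walk_sum s (C @ [hd C])" and ?n = "length C"
  show ?case
  proof (rule ccontr)
    assume W: "?W \<noteq> 0"
    have step: "3 * s (C ! i) (C ! (Suc i mod ?n)) = ?W" if i: "i < ?n" for i
    proof -
      obtain p x q Q where rot: "rotate i C = p # x # q # Q" and Q: "Q \<noteq> []"
      proof -
        have "4 \<le> length (rotate i C)" using less.prems by simp
        then show ?thesis
          using that by (cases "rotate i C"; cases "tl (rotate i C)"; cases "tl (tl (rotate i C))"; cases "tl (tl (tl (rotate i C)))") auto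
      qed
      let ?C = "p # [x] @ q # Q" and ?Z = "x # q # Q @ [p]"
      have rC: "rotate i C = ?C" using rot by simp
      have rZ: "rotate (Suc i) C = ?Z" using rot by (simp add: rotate_Suc)
      have C: "induced_cycle V E ?C" using less.prems(1) induced_cycle_rotate[of V E i C] rC by simp
      have Z: "induced_cycle V E ?Z" using less.prems(1) induced_cycle_rotate[of V E "Suc i" C] rZ by simp
      have cC: "cyc ?C" and cZ: "cyc ?Z" using induced_cycle_cyc C Z by blast+
      have dist: "distinct ?C" using cC by (simp add: cyc_def is_cycle_def)
      have insC: "ins ?C = ins C" and insZ: "ins ?Z = ins C"
        using ins_rotate[OF induced_cycle_cyc[OF less.prems(1)]] rC rZ by metis+
      have WC: "walk_sum s (?C @ [hd ?C]) = ?W" using cycle_sum_rotate[of s i C] rC by metis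
      have I: "inside_vertices ?Z = inside_vertices ?C" using insC insZ unfolding inside_vertices_def by auto
      have IH: "walk_sum s (D @ [hd D]) = 0"
        if "induced_cycle V E D" "4 \<le> length D" "card (ins D) < card (ins ?C)" for D
        using less.hyps[of D] that insC by simp
      have ceC: "cycle_edges ?C = {{p, x}, {x, q}} \<union> walk_edges (q # Q @ [p])"
        using cycle_edges_append[of p "[x]" q Q] by auto
      have xE: "{p, x} \<in> E" "{x, p} \<in> E" "{x, q} \<in> E" using cC ceC by (auto simp: cyc_def insert_commute)
      obtain R where R: "hd R = q" "last R = p" "R \<noteq> []" "distinct R" "walk_edges R \<subseteq> E"
        and RZ: "set R \<subseteq> insert q (insert p (inside_vertices ?Z))"
        and Rx: "\<And>y. y \<in> set R \<Longrightarrow> {x, y} \<in> E"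
        and Rind: "\<And>y z. y \<in> set R \<Longrightarrow> z \<in> set R \<Longrightarrow> y \<noteq> z \<Longrightarrow> {y, z} \<in> E \<Longrightarrow> {y, z} \<in> walk_edges R"
        using link_path[OF Z] by blast
      let ?R = "rev R"
      have R2: "hd ?R = p" "last ?R = q" "distinct ?R" "walk_edges ?R \<subseteq> E"
        using R by (auto simp: hd_rev last_rev walk_edges_rev)
      have ne: "[x] \<noteq> []" by simp
      obtain R' where R': "?R = p # R' @ [q]" and D: "induced_cycle V E (p # R' @ q # Q)"
        "4 \<le> length (p # R' @ q # Q)" "card (ins (p # R' @ q # Q)) < card (ins ?C)"
      proof (rule replace_arc[OF C ne Q R2])
        show inner: "y \<in> inside_vertices ?C" if "y \<in> set ?R" "y \<noteq> p" "y \<noteq> q" for y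
          using that RZ I by auto
        show "{y, z} \<in> walk_edges ?R" if "y \<in> set ?R" "z \<in> set ?R" "y \<noteq> z" "{y, z} \<in> E" for y z
          using Rind[of y z] that by (simp add: walk_edges_rev)
        \<comment> \<open>An edge \<open>y z\<close> would make \<open>y\<close> a hub with the
          neighbours \<open>x\<close> and \<open>z\<close> on the cycle; these would then be
          adjacent and form a chord.\<close>
        show "{y, z} \<notin> E" if y: "y \<in> set ?R" "y \<noteq> p" "y \<noteq> q" "z \<in> set Q" for y z
        proof
          assume yz: "{y, z} \<in> E"
          have "{y, x} \<in> E" using Rx[of y] y by (simp add: insert_commute)
          moreover have "x \<noteq> z" using dist y by auto
          ultimately have "{x, z} \<in> E"
            using hub_neighbours_adjacent[OF low s C _ IH inner[OF y(1-3)], of x z] yz y WC W by auto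
          then have "{x, z} \<in> cycle_edges ?Z" using induced_cycle_edge[OF Z, of x z] y by simp
          then have "z = q \<or> z = p" using cycle_nbr[of x "q # Q @ [p]" z] dist by auto
          then show False using y dist by auto
        qed
      qed (use that in blast)
      have "walk_sum s ((p # R' @ q # Q) @ [p]) = 0" using IH[OF D] by simp
      then have "walk_sum s ?R + walk_sum s (q # Q @ [p]) = 0" using cycle_sum_append[of s p R' q Q] R' by simp
      moreover have "2 * walk_sum s ?R = s x p - s x q"
        using link_sum[OF s _ R2(4), of x] R2 Rx R(3) by simp
      moreover have "?W = s p x + s x q + walk_sum s (q # Q @ [p])"
        using cycle_sum_append[of s p "[x]" q Q] WC by simp
      moreover have "s x p = - s p x" using cyclic_orientation_anti[OF s xE(1)] .
      ultimately have W2: "2 * ?W = 3 * (s p x + s x q)" by simp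
      have "s p x = 1 \<or> s p x = -1" "s x q = 1 \<or> s x q = -1"
        using cyclic_orientation_value[OF s] xE by auto
      then have "3 * s p x = ?W" using W2 W by (elim disjE) simp_all
      moreover have "C ! i = p" "C ! (Suc i mod ?n) = x"
      proof -
        have "rotate i C ! 0 = C ! ((i + 0) mod ?n)" "rotate i C ! 1 = C ! ((i + 1) mod ?n)"
          using less.prems(2) by (intro nth_rotate; linarith)+
        then show "C ! i = p" "C ! (Suc i mod ?n) = x" using rot i by simp_all
      qed
      ultimately show ?thesis by simp
    qed
    have "3 * ?W = (\<Sum>i<?n. 3 * s (C ! i) (C ! (Suc i mod ?n)))"
      unfolding cycle_sum_nth by (rule sum_distrib_left)
    also have "\<dots> = (\<Sum>i<?n. ?W)" by (rule sum.cong) (use step in auto)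
    finally have "3 * ?W = int ?n * ?W" by simp
    then have "int ?n = 3" using W by simp
    then show False using less.prems by simp
  qed
qed

lemma perfect_if_no_loose_odd_wheel:
  assumes low: "\<not> has_induced_loose_odd_wheel V E"
  shows "perfect V E" "\<not> contains_K4 V E"
proof -
  obtain s where s: "cyclic_orientation E s" using cyclic_orientation_exists[OF low] .
  obtain f :: "'a \<Rightarrow> nat" where f: "\<And>v. f v < 3" "\<And>x y. {x, y} \<in> E \<Longrightarrow> f x \<noteq> f y"
    using three_colouring[OF s] by blast
  show "perfect V E"
  proof (rule three_colourable_perfect[OF graph])
    show "f v < 3" for v by (rule f)
    show "f u \<noteq> f v" if "{u, v} \<in> E" for u v using f that by blast
    fix C assume C: "induced_cycle V E C" "odd (length C)"
    show "length C = 3"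
    proof (rule ccontr)
      assume "length C \<noteq> 3"
      moreover have "3 \<le> length C" using C by (simp add: induced_cycle_def is_cycle_def)
      ultimately have "walk_sum s (C @ [hd C]) = 0" using hole_sum_zero[OF low s C(1)] by simp
      \<comment> \<open>A sum of an odd number of signs is odd, so it cannot vanish.\<close>
      moreover have "even (walk_sum s (C @ [hd C])) \<longleftrightarrow> odd (length (C @ [hd C]))"
      proof (rule walk_sum_parity)
        fix x y assume "{x, y} \<in> walk_edges (C @ [hd C])"
        then have "{x, y} \<in> E" using induced_cycle_cyc[OF C(1)] by (auto simp: cycle_edges_walk cyc_def)
        then show "odd (s x y)" using cyclic_orientation_value[OF s, of x y] by auto
      qed simp
      ultimately show False using C by simp
    qed
  qed
  show "\<not> contains_K4 V E"
  proof
    assume "contains_K4 V E"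
    then obtain K where K: "card K = 4" "clique K E" by (auto simp: contains_K4_def)
    then have "inj_on f K" using f(2) unfolding inj_on_def clique_def by blast
    moreover have "f ` K \<subseteq> {..<3}" using f by auto
    ultimately show False using card_inj_on_le[of f K "{..<3}"] K by simp
  qed
qed

end

section \<open>Faces of a plane triangulation\<close>

text \<open>The inverse of the arc would embed an open subset of the plane into the line, against
  invariance of dimension.\<close>

lemma arc_empty_interior:
  fixes g :: "real \<Rightarrow> complex"
  assumes "arc g"
  shows "interior (path_image g) = {}"
proof (rule ccontr)
  assume ne: "interior (path_image g) \<noteq> {}"
  have g: "continuous_on {0..1} g" "inj_on g {0..1}" using assms by (auto simp: arc_def path_def)
  let ?f = "inv_into {0..1} g"
  have "continuous_on (g ` {0..1}) ?f"
    by (rule continuous_on_inv[OF g(1)]) (use g(2) in auto)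
  then have "continuous_on (interior (path_image g)) ?f"
    unfolding path_image_def by (rule continuous_on_subset) (rule interior_subset)
  moreover have "inj_on ?f (interior (path_image g))"
    using inj_on_inv_into[of "interior (path_image g)" g "{0..1}"] interior_subset[of "path_image g"]
    by (simp add: path_image_def)
  ultimately have "DIM(complex) \<le> DIM(real)" using invariance_of_dimension ne open_interior by blast
  then show False by simp
qed

lemma interior_finite_Union_empty:
  assumes "finite A" "\<And>S. S \<in> A \<Longrightarrow> closed S" "\<And>S. S \<in> A \<Longrightarrow> interior S = {}"
  shows "interior (\<Union>A) = {}"
  using assms
proof (induction A)
  case (insert S A)
  then have "interior (S \<union> \<Union>A) = interior S" by (intro interior_closed_Un_empty_interior) auto
  then show ?case using insert by simp
qed auto

lemma connected_subset_side:
  assumes "connected S" "S \<subseteq> A \<union> B" "open A" "open B" "A \<inter> B = {}"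
  shows "S \<subseteq> A \<or> S \<subseteq> B"
  using connectedD[OF assms(1,3,4)] assms(2,5) by blast

lemma unbounded_subset_outside:
  assumes "connected S" "\<not> bounded S" "S \<inter> T = {}"
  shows "S \<subseteq> outside T"
proof
  fix x assume x: "x \<in> S"
  have "S \<subseteq> connected_component_set (- T) x" by (rule connected_component_maximal) (use x assms in auto)
  then have "\<not> bounded (connected_component_set (- T) x)" using assms(2) bounded_subset by blast
  then show "x \<in> outside T" using x assms(3) by (auto simp: outside_def)
qed

locale plane_triangulated =
  fixes V :: "'a::finite set" and E :: "'a set set"
    and pos :: "'a \<Rightarrow> complex" and crv :: "'a set \<Rightarrow> real \<Rightarrow> complex"
  assumes plane: "plane_triangulation V E pos crv"
begin

abbreviation "draw \<equiv> drawing V E pos crv"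
abbreviation "Fcs \<equiv> faces V E pos crv"

definition curve :: "'a set set \<Rightarrow> complex set" where
  "curve K = (\<Union>e\<in>K. path_image (crv e))"

text \<open>Its points lie on no other edge. A single one of them therefore tests whether the edge
  belongs to a curve or to the boundary of a face.\<close>

definition open_edge :: "'a set \<Rightarrow> complex set" where
  "open_edge e = path_image (crv e) - pos ` e"

lemma graph: "sgraph V E"
  and inj_pos: "inj_on pos V"
  and edge_arc: "e \<in> E \<Longrightarrow> arc (crv e)"
  and edge_ends: "e \<in> E \<Longrightarrow> {pathstart (crv e), pathfinish (crv e)} = pos ` e"
  and edge_vertex: "e \<in> E \<Longrightarrow> v \<in> V \<Longrightarrow> pos v \<in> path_image (crv e) \<Longrightarrow> v \<in> e"
  and edges_meet: "e \<in> E \<Longrightarrow> f \<in> E \<Longrightarrow> e \<noteq> f \<Longrightarrow>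
    path_image (crv e) \<inter> path_image (crv f) \<subseteq> pos ` (e \<inter> f)"
  using plane by (auto simp: plane_triangulation_def plane_graph_def)

lemma card_edge: "e \<in> E \<Longrightarrow> card e = 2"
  using graph by (simp add: sgraph_def)

lemma edge_sub: "e \<in> E \<Longrightarrow> e \<subseteq> V"
  using graph by (simp add: sgraph_def)

lemma ends_in_image: "e \<in> E \<Longrightarrow> pos ` e \<subseteq> path_image (crv e)"
  using edge_ends by (metis insert_subset empty_subsetI pathfinish_in_path_image pathstart_in_path_image)

lemma compact_curve: "K \<subseteq> E \<Longrightarrow> compact (curve K)"
  unfolding curve_def by (intro compact_UN) (auto intro: compact_arc_image edge_arc finite)

lemma curve_draw: "K \<subseteq> E \<Longrightarrow> curve K \<subseteq> draw"
  by (auto simp: curve_def drawing_def)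

lemma closed_draw: "closed draw"
proof -
  have "closed (pos ` V)" by (simp add: finite_imp_closed)
  moreover have "closed (curve E)" using compact_curve[of E] compact_imp_closed by blast
  ultimately show ?thesis unfolding drawing_def curve_def by (rule closed_Un)
qed

lemma interior_draw: "interior draw = {}"
proof -
  have "interior (\<Union>(insert (pos ` V) ((\<lambda>e. path_image (crv e)) ` E))) = {}"
  proof (rule interior_finite_Union_empty)
    fix S assume "S \<in> insert (pos ` V) ((\<lambda>e. path_image (crv e)) ` E)"
    then consider "S = pos ` V" | e where "e \<in> E" "S = path_image (crv e)" by blast
    then show "closed S" by cases (auto simp: finite_imp_closed intro: closed_arc_image edge_arc)
  next
    fix S assume "S \<in> insert (pos ` V) ((\<lambda>e. path_image (crv e)) ` E)"
    then consider "S = pos ` V" | e where "e \<in> E" "S = path_image (crv e)" by blast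
    then show "interior S = {}"
      by cases (auto simp: empty_interior_finite arc_empty_interior edge_arc)
  qed simp
  then show ?thesis by (simp add: drawing_def)
qed

lemma open_edge_nonempty:
  assumes "e \<in> E" shows "open_edge e \<noteq> {}"
proof -
  have "simple_path (crv e)" using edge_arc[OF assms] arc_imp_simple_path by blast
  then have "path_image (crv e) - {pathstart (crv e), pathfinish (crv e)} \<noteq> {}"
    by (rule nonempty_simple_path_endless)
  then show ?thesis by (simp add: open_edge_def edge_ends[OF assms])
qed

lemma open_edge_curve:
  assumes "e \<in> E" "K \<subseteq> E" "p \<in> open_edge e"
  shows "p \<in> curve K \<longleftrightarrow> e \<in> K"
proof
  assume "p \<in> curve K"
  then obtain f where f: "f \<in> K" "p \<in> path_image (crv f)" by (auto simp: curve_def)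
  show "e \<in> K"
  proof (cases "e = f")
    case False
    then have "p \<in> pos ` (e \<inter> f)" using edges_meet[of e f] assms f by (auto simp: open_edge_def)
    then show ?thesis using assms(3) by (auto simp: open_edge_def)
  qed (use f in simp)
next
  assume "e \<in> K"
  then show "p \<in> curve K" using assms(3) by (auto simp: curve_def open_edge_def)
qed

lemma vertex_curve:
  assumes "v \<in> V" "K \<subseteq> E" "pos v \<in> curve K"
  shows "\<exists>e\<in>K. v \<in> e"
  using assms edge_vertex by (auto simp: curve_def)

lemma face_props:
  assumes "F \<in> Fcs"
  shows "open F" "connected F" "F \<noteq> {}" "F \<inter> draw = {}"
  using assms closed_draw unfolding faces_def
  by (auto intro: open_components in_components_connected dest: in_components_nonempty in_components_subset)

lemma faces_disjoint: "F \<in> Fcs \<Longrightarrow> G \<in> Fcs \<Longrightarrow> F \<noteq> G \<Longrightarrow> F \<inter> G = {}"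
  unfolding faces_def using components_nonoverlap by blast

section \<open>Cycles as Jordan curves\<close>

lemma edge_path:
  assumes "{x, y} \<in> E"
  obtains g where "arc g" "pathstart g = pos x" "pathfinish g = pos y" "path_image g = path_image (crv {x, y})"
proof -
  have "x \<noteq> y" "x \<in> V" "y \<in> V" using card_edge[OF assms] edge_sub[OF assms] by auto
  then have "pos x \<noteq> pos y" using inj_pos by (auto simp: inj_on_def)
  then consider "pathstart (crv {x, y}) = pos x" "pathfinish (crv {x, y}) = pos y"
    | "pathstart (crv {x, y}) = pos y" "pathfinish (crv {x, y}) = pos x"
    using edge_ends[OF assms] by (auto simp: doubleton_eq_iff)
  then show ?thesis
  proof cases
    case 1 then show ?thesis using that edge_arc[OF assms] by blast
  next
    case 2
    show ?thesis
      by (rule that[of "reversepath (crv {x, y})"]) (use 2 edge_arc[OF assms] in \<open>auto simp: arc_reversepath\<close>)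
  qed
qed

lemma walk_path:
  assumes "distinct xs" "2 \<le> length xs" "walk_edges xs \<subseteq> E"
  shows "\<exists>g. arc g \<and> pathstart g = pos (hd xs) \<and> pathfinish g = pos (last xs) \<and> path_image g = curve (walk_edges xs)"
  using assms
proof (induction xs rule: walk_edges.induct)
  case (1 x y zs)
  have xy: "{x, y} \<in> E" using 1 by simp
  obtain g1 where g1: "arc g1" "pathstart g1 = pos x" "pathfinish g1 = pos y"
    "path_image g1 = path_image (crv {x, y})"
    using edge_path[OF xy] .
  show ?case
  proof (cases "zs = []")
    case True
    then show ?thesis using g1 by (intro exI[of _ g1]) (auto simp: curve_def)
  next
    case False
    then have "2 \<le> length (y # zs)" by (cases zs) auto
    then obtain g2 where g2: "arc g2" "pathstart g2 = pos y" "pathfinish g2 = pos (last (y # zs))"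
      "path_image g2 = curve (walk_edges (y # zs))" using "1.IH" "1.prems" by auto
    have "path_image g1 \<inter> path_image g2 \<subseteq> {pathstart g2}"
    proof
      fix p assume p: "p \<in> path_image g1 \<inter> path_image g2"
      then obtain f where f: "f \<in> walk_edges (y # zs)" "p \<in> path_image (crv f)"
        using g2 by (auto simp: curve_def)
      have xf: "x \<notin> f" using walk_edges_subset[OF f(1)] "1.prems"(1) by auto
      then have "{x, y} \<noteq> f" by auto
      moreover have "f \<in> E" using f "1.prems" by auto
      ultimately have "p \<in> pos ` ({x, y} \<inter> f)" using edges_meet[OF xy] p f g1 by blast
      then show "p \<in> {pathstart g2}" using xf g2 by auto
    qed
    then have "arc (g1 +++ g2)" using g1 g2 by (intro arc_join) auto
    moreover have "path_image (g1 +++ g2) = curve (walk_edges (x # y # zs))"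
      using g1 g2 by (simp add: path_image_join curve_def)
    ultimately show ?thesis using g1 g2 by (intro exI[of _ "g1 +++ g2"]) auto
  qed
qed auto

definition cyc :: "'a list \<Rightarrow> bool" where
  "cyc C \<longleftrightarrow> is_cycle C \<and> cycle_edges C \<subseteq> E"

lemma cycle_path:
  assumes "cyc C"
  obtains g where "simple_path g" "pathfinish g = pathstart g" "path_image g = curve (cycle_edges C)"
proof -
  have dist: "distinct C" and n: "3 \<le> length C" and CE: "cycle_edges C \<subseteq> E"
    using assms by (auto simp: cyc_def is_cycle_def)
  obtain x D where "C = x # D" using n by (cases C) auto
  then have D: "C = x # D" "D \<noteq> []" "butlast D \<noteq> []" using n by (auto simp: butlast_conv_take)
  then obtain P l where P: "C = x # P @ [l]" "P \<noteq> []" by (metis append_butlast_last_id)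
  have ce: "cycle_edges C = insert {l, x} (walk_edges C)"
    using cycle_edges_append[of x P l "[]"] P by simp
  have lx: "{l, x} \<in> E" using ce CE by simp
  obtain g2 where g2: "arc g2" "pathstart g2 = pos l" "pathfinish g2 = pos x"
    "path_image g2 = path_image (crv {l, x})"
    using edge_path[OF lx] .
  obtain g1 where g1: "arc g1" "pathstart g1 = pos x" "pathfinish g1 = pos l"
    "path_image g1 = curve (walk_edges C)"
    using walk_path[OF dist] n ce CE P by auto
  have "path_image g1 \<inter> path_image g2 \<subseteq> {pathstart g1, pathstart g2}"
  proof
    fix p assume p: "p \<in> path_image g1 \<inter> path_image g2"
    then obtain f where f: "f \<in> walk_edges C" "p \<in> path_image (crv f)"
      using g1 by (auto simp: curve_def)
    have "f \<inter> set P \<noteq> {}" using walk_edges_inner[of f x P l] f P by simp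
    then have "f \<noteq> {l, x}" using dist P by auto
    moreover have "f \<in> E" using f CE ce by auto
    ultimately have "p \<in> pos ` (f \<inter> {l, x})" using edges_meet[of f "{l, x}"] lx p f g2 by blast
    then show "p \<in> {pathstart g1, pathstart g2}" using g1 g2 by auto
  qed
  then have "simple_path (g1 +++ g2)" using g1 g2 by (intro simple_path_join_loop) auto
  moreover have "path_image (g1 +++ g2) = curve (cycle_edges C)"
    using g1 g2 by (simp add: path_image_join curve_def ce Un_commute)
  moreover have "pathfinish (g1 +++ g2) = pathstart (g1 +++ g2)" using g1 g2 by simp
  ultimately show ?thesis using that by blast
qed

lemma cycle_sides:
  assumes "cyc C"
  defines "U \<equiv> curve (cycle_edges C)"
  shows "open (inside U)" "connected (inside U)" "open (outside U)" "connected (outside U)" "\<not> bounded (outside U)"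
    "inside U \<inter> outside U = {}" "inside U \<union> outside U = - U" "frontier (inside U) = U" "frontier (outside U) = U"
proof -
  obtain g where "simple_path g" "pathfinish g = pathstart g" "path_image g = U"
    using cycle_path[OF assms(1)] unfolding U_def .
  then show "open (inside U)" "connected (inside U)" "open (outside U)" "connected (outside U)" "\<not> bounded (outside U)"
    "inside U \<inter> outside U = {}" "inside U \<union> outside U = - U" "frontier (inside U) = U" "frontier (outside U) = U"
    using Jordan_inside_outside[of g] by auto
qed

section \<open>Faces and their boundary triangles\<close>

lemma face_side:
  assumes "cyc C" "F \<in> Fcs"
  shows "F \<subseteq> inside (curve (cycle_edges C)) \<or> F \<subseteq> outside (curve (cycle_edges C))"
proof (rule connected_subset_side)
  have "curve (cycle_edges C) \<subseteq> draw" using assms(1) curve_draw by (simp add: cyc_def)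
  then show "F \<subseteq> inside (curve (cycle_edges C)) \<union> outside (curve (cycle_edges C))"
    using face_props(4)[OF assms(2)] cycle_sides(7)[OF assms(1)] by blast
qed (use face_props[OF assms(2)] cycle_sides[OF assms(1)] in auto)

text \<open>The choice does not affect incidence: by \<open>closure_face_edge\<close> the edges
  within \<open>tri F\<close> are those whose open edge lies in the closure of
  \<open>F\<close>.\<close>

definition tri :: "complex set \<Rightarrow> 'a set" where
  "tri F = (SOME T. \<exists>a b c. T = {a, b, c} \<and> a \<noteq> b \<and> b \<noteq> c \<and> a \<noteq> c \<and> {a, b} \<in> E \<and> {b, c} \<in> E \<and> {a, c} \<in> E \<and>
     frontier F = path_image (crv {a, b}) \<union> path_image (crv {b, c}) \<union> path_image (crv {a, c}))"

lemma tri_obtain: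
  assumes "F \<in> Fcs"
  obtains a b c where "tri F = {a, b, c}" "a \<noteq> b" "b \<noteq> c" "a \<noteq> c" "cyc [a, b, c]"
    "cycle_edges [a, b, c] = {e \<in> E. e \<subseteq> tri F}" "frontier F = curve (cycle_edges [a, b, c])"
proof -
  have "\<exists>T a b c. T = {a, b, c} \<and> a \<noteq> b \<and> b \<noteq> c \<and> a \<noteq> c \<and> {a, b} \<in> E \<and> {b, c} \<in> E \<and> {a, c} \<in> E \<and>
     frontier F = path_image (crv {a, b}) \<union> path_image (crv {b, c}) \<union> path_image (crv {a, c})"
    using plane assms unfolding plane_triangulation_def by blast
  then have "\<exists>a b c. tri F = {a, b, c} \<and> a \<noteq> b \<and> b \<noteq> c \<and> a \<noteq> c \<and> {a, b} \<in> E \<and> {b, c} \<in> E \<and> {a, c} \<in> E \<and>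
     frontier F = path_image (crv {a, b}) \<union> path_image (crv {b, c}) \<union> path_image (crv {a, c})"
    unfolding tri_def by (rule someI_ex)
  then obtain a b c where abc: "tri F = {a, b, c}" "a \<noteq> b" "b \<noteq> c" "a \<noteq> c" "{a, b} \<in> E" "{b, c} \<in> E" "{a, c} \<in> E"
    and fr: "frontier F = path_image (crv {a, b}) \<union> path_image (crv {b, c}) \<union> path_image (crv {a, c})"
    by blast
  have ce: "cycle_edges [a, b, c] = {{a, b}, {b, c}, {a, c}}" by (simp add: cycle_edges_walk insert_commute)
  have "e \<in> {{a, b}, {b, c}, {a, c}}" if e: "e \<in> E" "e \<subseteq> {a, b, c}" for e
  proof -
    obtain s t where "e = {s, t}" "s \<noteq> t" using card_edge[OF e(1)] by (auto simp: card_2_iff)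
    then show ?thesis using e(2) by auto
  qed
  then have "cycle_edges [a, b, c] = {e \<in> E. e \<subseteq> tri F}"
    unfolding ce abc(1) using abc(5-7) by (intro equalityI subsetI) auto
  moreover have "cyc [a, b, c]" using abc ce by (simp add: cyc_def is_cycle_def)
  moreover have "frontier F = curve (cycle_edges [a, b, c])" unfolding ce fr by (auto simp: curve_def)
  ultimately show ?thesis using that abc by blast
qed

text \<open>A connected set that meets \<open>F\<close> but not its frontier lies in
  \<open>F\<close>. The side of the boundary curve that contains \<open>F\<close> is such a
  set.\<close>

lemma face_is_side:
  assumes F: "F \<in> Fcs" and C: "cyc C" "frontier F = curve (cycle_edges C)"
  shows "F = inside (frontier F) \<or> F = outside (frontier F)"
proof -
  have max: "S \<subseteq> F" if "connected S" "S \<inter> F \<noteq> {}" "S \<inter> frontier F = {}" for S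
    using connected_Int_frontier[of S F] that by blast
  note s = cycle_sides[OF C(1), folded C(2)]
  have "F \<subseteq> inside (frontier F) \<or> F \<subseteq> outside (frontier F)" using face_side[OF C(1) F] C(2) by simp
  moreover have "inside (frontier F) \<subseteq> F" if "F \<subseteq> inside (frontier F)"
    by (rule max) (use that face_props[OF F] s in auto)
  moreover have "outside (frontier F) \<subseteq> F" if "F \<subseteq> outside (frontier F)"
    by (rule max) (use that face_props[OF F] s in auto)
  ultimately show ?thesis by blast
qed

text \<open>Being a side of its boundary curve, a face is determined by a set of edges up to two
  possibilities.\<close>

lemma finite_faces: "finite Fcs"
proof (rule finite_subset)
  let ?K = "\<Union>K\<in>UNIV. {inside (curve K), outside (curve K)}"
  show "Fcs \<subseteq> ?K"
  proof
    fix F assume F: "F \<in> Fcs"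
    obtain a b c where "cyc [a, b, c]" "frontier F = curve (cycle_edges [a, b, c])"
      using tri_obtain[OF F] .
    then show "F \<in> ?K" using face_is_side[OF F, of "[a, b, c]"] by auto
  qed
qed simp

text \<open>The drawing has empty interior, so the faces are dense in \<open>S\<close>; there are
  finitely many, so the closure of their union is the union of the closures.\<close>

lemma face_near:
  assumes "open S" "p \<in> closure S"
  obtains F where "F \<in> Fcs" "F \<inter> S \<noteq> {}" "p \<in> closure F"
proof -
  have "S \<subseteq> closure (S - draw)"
  proof
    fix x assume x: "x \<in> S"
    show "x \<in> closure (S - draw)"
      unfolding closure_iff_nhds_not_empty
    proof (intro allI impI)
      fix A T assume T: "T \<subseteq> A" "x \<in> T" "open T"
      have "\<not> T \<inter> S \<subseteq> draw"
      proof
        assume "T \<inter> S \<subseteq> draw"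
        then have "T \<inter> S \<subseteq> interior draw" using T assms(1) by (intro interior_maximal) auto
        then show False using x T interior_draw by auto
      qed
      then show "(S - draw) \<inter> A \<noteq> {}" using T by blast
    qed
  qed
  then have "p \<in> closure (S - draw)" using assms(2) closure_minimal[of S "closure (S - draw)"] by auto
  moreover have "S - draw = (\<Union>F\<in>Fcs. F \<inter> S)"
    using Union_components[of "- draw"] by (auto simp: faces_def)
  moreover have "closure (\<Union>F\<in>Fcs. F \<inter> S) \<subseteq> (\<Union>F\<in>Fcs. closure (F \<inter> S))"
  proof (rule closure_minimal)
    show "(\<Union>F\<in>Fcs. F \<inter> S) \<subseteq> (\<Union>F\<in>Fcs. closure (F \<inter> S))" using closure_subset by fast
    show "closed (\<Union>F\<in>Fcs. closure (F \<inter> S))" using finite_faces by (intro closed_UN) auto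
  qed
  ultimately obtain F where F: "F \<in> Fcs" "p \<in> closure (F \<inter> S)" by auto
  then have "F \<inter> S \<noteq> {}" by auto
  moreover have "p \<in> closure F" using F closure_mono[of "F \<inter> S" F] by auto
  ultimately show ?thesis using that F by blast
qed

lemma closure_face_edge:
  assumes "F \<in> Fcs" "e \<in> E" "p \<in> open_edge e"
  shows "p \<in> closure F \<longleftrightarrow> e \<subseteq> tri F"
proof -
  obtain a b c where abc: "cyc [a, b, c]" "cycle_edges [a, b, c] = {e \<in> E. e \<subseteq> tri F}"
    "frontier F = curve (cycle_edges [a, b, c])" using tri_obtain[OF assms(1)] .
  have "p \<in> draw" using assms by (auto simp: open_edge_def drawing_def)
  then have "p \<notin> F" using face_props(4)[OF assms(1)] by blast
  then have "p \<in> closure F \<longleftrightarrow> p \<in> frontier F" using face_props(1)[OF assms(1)] by (simp add: frontier_def interior_open)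
  also have "\<dots> \<longleftrightarrow> e \<in> {e \<in> E. e \<subseteq> tri F}"
    unfolding abc(3) abc(2) by (rule open_edge_curve) (use assms in auto)
  finally show ?thesis using assms(2) by simp
qed

text \<open>If \<open>F1\<close> and \<open>F2\<close> have the same triangle, they are its two
  sides and leave no room for \<open>F3\<close>. Otherwise \<open>F2\<close> and \<open>F3\<close>
  can be joined near \<open>e\<close> without meeting the triangle of \<open>F2\<close>, although
  that triangle is the frontier of \<open>F2\<close>.\<close>

lemma faces_at_edge_le_2:
  assumes e: "e \<in> E" and F: "F1 \<in> Fcs" "F2 \<in> Fcs" "F3 \<in> Fcs"
    and t: "e \<subseteq> tri F1" "e \<subseteq> tri F2" "e \<subseteq> tri F3" and ne: "F1 \<noteq> F2" "F1 \<noteq> F3" "F2 \<noteq> F3"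
  shows False
proof -
  obtain p where p: "p \<in> open_edge e" using open_edge_nonempty[OF e] by blast
  define K where "K F = {f \<in> E. f \<subseteq> tri F}" for F
  have KE: "K F \<subseteq> E" for F by (auto simp: K_def)
  have fr: "frontier F = curve (K F)" and side: "F = inside (frontier F) \<or> F = outside (frontier F)"
    and sides: "connected (inside (frontier F))" "connected (outside (frontier F))"
      "inside (frontier F) \<inter> outside (frontier F) = {}" "inside (frontier F) \<union> outside (frontier F) = - frontier F"
    if F: "F \<in> Fcs" for F
  proof -
    obtain a b c where abc: "cyc [a, b, c]" "cycle_edges [a, b, c] = {e \<in> E. e \<subseteq> tri F}"
      "frontier F = curve (cycle_edges [a, b, c])" using tri_obtain[OF F] .
    show "frontier F = curve (K F)" using abc by (simp add: K_def)
    show "F = inside (frontier F) \<or> F = outside (frontier F)" using face_is_side[OF F] abc by blast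
    note s = cycle_sides[OF abc(1), folded abc(3)]
    show "connected (inside (frontier F))" "connected (outside (frontier F))"
      "inside (frontier F) \<inter> outside (frontier F) = {}" "inside (frontier F) \<union> outside (frontier F) = - frontier F"
      using s by auto
  qed
  have off: "G \<inter> frontier F = {}" if "F \<in> Fcs" "G \<in> Fcs" for F G
    using face_props(4)[OF that(2)] curve_draw[OF KE, of F] fr[OF that(1)] by blast
  show False
  proof (cases "tri F1 = tri F2")
    case True
    then have eq: "frontier F1 = frontier F2" using fr F by (simp add: K_def)
    have "F2 = inside (frontier F1) \<or> F2 = outside (frontier F1)" using side[OF F(2)] unfolding eq .
    then have "F1 \<union> F2 = inside (frontier F1) \<union> outside (frontier F1)"
      using side[OF F(1)] ne(1) by (metis Un_commute)
    then have "F1 \<union> F2 = - frontier F1" using sides(4)[OF F(1)] by simp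
    moreover have "F3 \<inter> frontier F1 = {}" "F3 \<inter> F1 = {}" "F3 \<inter> F2 = {}"
      using off F faces_disjoint ne by blast+
    ultimately show False using face_props(3)[OF F(3)] by blast
  next
    case False
    obtain a b where ab: "e = {a, b}" "a \<noteq> b" using card_edge[OF e] by (auto simp: card_2_iff)
    have third: "\<exists>c. tri F = {a, b, c} \<and> c \<noteq> a \<and> c \<noteq> b \<and> {a, c} \<in> E \<and> {b, c} \<in> E \<and> K F = {e, {a, c}, {b, c}}"
      if F: "F \<in> Fcs" "e \<subseteq> tri F" for F
    proof -
      obtain u v w where uvw: "tri F = {u, v, w}" "u \<noteq> v" "v \<noteq> w" "u \<noteq> w" "cyc [u, v, w]"
        using tri_obtain[OF F(1)] by metis
      have "cycle_edges [u, v, w] = {{u, v}, {v, w}, {w, u}}" by (simp add: cycle_edges_walk)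
      then have uvwE: "{u, v} \<in> E" "{v, w} \<in> E" "{w, u} \<in> E" using uvw(5) by (auto simp: cyc_def)
      have clq: "{s, t} \<in> E" if "s \<in> tri F" "t \<in> tri F" "s \<noteq> t" for s t
        using that uvwE unfolding uvw(1) by (auto simp: insert_commute)
      have abF: "a \<in> tri F" "b \<in> tri F" using F(2) ab(1) by auto
      have "\<exists>c. tri F = {a, b, c} \<and> c \<noteq> a \<and> c \<noteq> b"
      proof -
        have "card (tri F - {a, b}) = 1" using uvw(1-4) abF ab(2) by (subst card_Diff_subset) auto
        then obtain c where "tri F - {a, b} = {c}" by (auto simp: card_1_singleton_iff)
        then show ?thesis using abF by blast
      qed
      then obtain c where c: "tri F = {a, b, c}" "c \<noteq> a" "c \<noteq> b" by blast
      have cE: "{a, c} \<in> E" "{b, c} \<in> E" using clq[of a c] clq[of b c] c by auto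
      have "f \<in> {e, {a, c}, {b, c}}" if f: "f \<in> E" "f \<subseteq> {a, b, c}" for f
      proof -
        obtain s t where st: "f = {s, t}" "s \<noteq> t" using card_edge[OF f(1)] by (auto simp: card_2_iff)
        show ?thesis using f(2) st(2) unfolding st(1) ab(1) by auto
      qed
      then have "K F \<subseteq> {e, {a, c}, {b, c}}" unfolding K_def c(1) by blast
      moreover have "{e, {a, c}, {b, c}} \<subseteq> K F" unfolding K_def c(1) using e cE ab(1) by auto
      ultimately show ?thesis using c cE by blast
    qed
    obtain c where c: "tri F1 = {a, b, c}" "c \<noteq> a" "c \<noteq> b" "{a, c} \<in> E" "{b, c} \<in> E" "K F1 = {e, {a, c}, {b, c}}"
      using third[OF F(1) t(1)] by blast
    obtain d where d: "tri F2 = {a, b, d}" "d \<noteq> a" "d \<noteq> b" "{a, d} \<in> E" "{b, d} \<in> E" "K F2 = {e, {a, d}, {b, d}}"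
      using third[OF F(2) t(2)] by blast
    have cd: "c \<noteq> d" using False c d by auto
    \<comment> \<open>The edges of the two triangles other than \<open>e\<close>. They avoid
      \<open>p\<close>, so a small disc around \<open>p\<close> misses them while it meets all three
      faces.\<close>
    define K12 where "K12 = {{a, c}, {b, c}, {a, d}, {b, d}}"
    have K12E: "K12 \<subseteq> E" using c d by (auto simp: K12_def)
    have "e \<notin> K12" using ab c d by (auto simp: K12_def doubleton_eq_iff)
    then have "p \<notin> curve K12" using open_edge_curve[OF e K12E p] by simp
    moreover have "closed (curve K12)" using compact_curve[OF K12E] compact_imp_closed by blast
    ultimately obtain r where r: "0 < r" "ball p r \<subseteq> - curve K12"
      using open_contains_ball[of "- curve K12"] by (auto simp: open_Compl)
    have meet: "\<exists>x. x \<in> F \<and> x \<in> ball p r" if "F \<in> Fcs" "e \<subseteq> tri F" for F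
    proof -
      have "p \<in> closure F" using closure_face_edge[OF that(1) e p] that by simp
      then show ?thesis using r(1) by (auto simp: closure_approachable dist_commute)
    qed
    obtain x where x: "x \<in> F3" "x \<in> ball p r" using meet[OF F(3) t(3)] by blast
    obtain z where z: "z \<in> F2" "z \<in> ball p r" using meet[OF F(2) t(2)] by blast
    \<comment> \<open>\<open>x\<close> and \<open>z\<close> lie on the same side of the triangle of \<open>F1\<close>, and of the 4-cycle \<open>K12\<close> since they are
      near \<open>p\<close>. By Janiszewski's theorem their union, which contains the triangle of \<open>F2\<close>,
      does not separate \<open>x\<close> and \<open>z\<close>.\<close>
    have "connected_component (- (curve (K F1) \<union> curve K12)) x z"
    proof (rule Janiszewski)
      show "compact (curve (K F1))" using compact_curve[OF KE] .
      show "closed (curve K12)" by fact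
      show "connected_component (- curve K12) x z"
        using r x z by (auto simp: connected_component_def intro!: exI[of _ "ball p r"])
      have "x \<notin> F1" "z \<notin> F1" "x \<notin> frontier F1" "z \<notin> frontier F1"
        using x z off[OF F(1)] F faces_disjoint ne by blast+
      then have "(x \<in> inside (frontier F1) \<and> z \<in> inside (frontier F1)) \<or>
          (x \<in> outside (frontier F1) \<and> z \<in> outside (frontier F1))"
        using side[OF F(1)] sides(4)[OF F(1)] by blast
      then show "connected_component (- curve (K F1)) x z"
        unfolding connected_component_def fr[OF F(1), symmetric]
        using sides(1,2)[OF F(1)] sides(4)[OF F(1)] by blast
      \<comment> \<open>Janiszewski's theorem requires a connected intersection; it is the path
        \<open>a c b\<close>, since \<open>e\<close> meets the other two edges only in its
        ends.\<close>
      have "curve (K F1) \<inter> curve K12 = path_image (crv {a, c}) \<union> path_image (crv {b, c})" (is "?L = ?R")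
      proof
        show "?R \<subseteq> ?L" by (auto simp: c(6) K12_def curve_def)
        show "?L \<subseteq> ?R"
        proof
          fix y assume y: "y \<in> ?L"
          show "y \<in> ?R"
          proof (rule ccontr)
            assume n: "y \<notin> ?R"
            then have ye: "y \<in> path_image (crv e)" using y by (auto simp: c(6) curve_def)
            have "e \<noteq> {a, d}" "e \<noteq> {b, d}" using ab d by (auto simp: doubleton_eq_iff)
            moreover have "y \<in> path_image (crv {a, d}) \<or> y \<in> path_image (crv {b, d})"
              using y n by (auto simp: K12_def curve_def)
            ultimately have "y \<in> pos ` (e \<inter> {a, d}) \<or> y \<in> pos ` (e \<inter> {b, d})"
              using edges_meet[OF e d(4)] edges_meet[OF e d(5)] ye by blast
            then have "y = pos a \<or> y = pos b" using ab d by auto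
            then show False using n ends_in_image[OF c(4)] ends_in_image[OF c(5)] by auto
          qed
        qed
      qed
      moreover have "connected ?R"
      proof (rule connected_Un)
        show "connected (path_image (crv {a, c}))" "connected (path_image (crv {b, c}))"
          using edge_arc[OF c(4)] edge_arc[OF c(5)] connected_arc_image by auto
        show "path_image (crv {a, c}) \<inter> path_image (crv {b, c}) \<noteq> {}"
          using ends_in_image[OF c(4)] ends_in_image[OF c(5)] by blast
      qed
      ultimately show "connected (curve (K F1) \<inter> curve K12)" by simp
    qed
    then obtain T where T: "connected T" "T \<subseteq> - (curve (K F1) \<union> curve K12)" "x \<in> T" "z \<in> T"
      by (auto simp: connected_component_def)
    have "frontier F2 \<subseteq> curve (K F1) \<union> curve K12"
      unfolding fr[OF F(2)] by (auto simp: c(6) d(6) K12_def curve_def)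
    then have "T \<inter> frontier F2 = {}" using T by blast
    moreover have "x \<notin> F2" using x faces_disjoint[OF F(2,3)] ne by blast
    ultimately show False using connected_Int_frontier[of T F2] T z by blast
  qed
qed

section \<open>Incidence of edges and vertices with inner faces\<close>

definition ins :: "'a list \<Rightarrow> complex set set" where
  "ins C = {F \<in> Fcs. F \<subseteq> inside (curve (cycle_edges C))}"

text \<open>A point of the open edge lies in the closure of a face \<open>F\<close> and, by the
  Jordan curve theorem, also in the closure of the side of the frontier of \<open>F\<close> away
  from \<open>F\<close>. There a second face is found.\<close>

lemma two_faces:
  assumes e: "e \<in> E"
  shows "card {F \<in> Fcs. e \<subseteq> tri F} = 2"
proof -
  obtain p where p: "p \<in> open_edge e" using open_edge_nonempty[OF e] by blast
  obtain F where F: "F \<in> Fcs" "p \<in> closure F" by (rule face_near[of UNIV p]) auto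
  obtain a b c where abc: "cyc [a, b, c]" "cycle_edges [a, b, c] = {e \<in> E. e \<subseteq> tri F}"
    "frontier F = curve (cycle_edges [a, b, c])" using tri_obtain[OF F(1)] .
  note s = cycle_sides[OF abc(1), folded abc(3)]
  have Fe: "e \<subseteq> tri F" using closure_face_edge[OF F(1) e p] F by simp
  have "p \<in> frontier F" unfolding abc(3) abc(2)
    by (rule open_edge_curve[OF e _ p, THEN iffD2]) (use Fe e in auto)
  then have "p \<in> closure (inside (frontier F))" "p \<in> closure (outside (frontier F))"
    using s(8,9) by (auto simp: frontier_def)
  moreover obtain S where S: "S = inside (frontier F) \<or> S = outside (frontier F)" "S \<inter> F = {}"
  proof (cases "F = inside (frontier F)")
    case True
    then show ?thesis using that[of "outside (frontier F)"] s(6) by (metis inf_commute)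
  next
    case False
    then have "F = outside (frontier F)" using face_is_side[OF F(1) abc(1,3)] by simp
    then show ?thesis using that[of "inside (frontier F)"] s(6) by metis
  qed
  ultimately have "open S" "p \<in> closure S" using s(1,3) by metis+
  then obtain G where G: "G \<in> Fcs" "G \<inter> S \<noteq> {}" "p \<in> closure G" by (rule face_near)
  have Ge: "e \<subseteq> tri G" using closure_face_edge[OF G(1) e p] G by simp
  have GF: "G \<noteq> F" using G S by blast
  have "H = F \<or> H = G" if "H \<in> Fcs" "e \<subseteq> tri H" for H
    using faces_at_edge_le_2[OF e F(1) G(1) that(1) Fe Ge that(2)] GF by metis
  then have "{F \<in> Fcs. e \<subseteq> tri F} = {F, G}" using F(1) G(1) Fe Ge by (intro equalityI subsetI) auto
  then show ?thesis using GF by simp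
qed

lemma ins_iff:
  assumes "cyc C" "F \<in> Fcs"
  shows "F \<in> ins C \<longleftrightarrow> F \<inter> inside (curve (cycle_edges C)) \<noteq> {}"
proof
  assume "F \<in> ins C"
  then show "F \<inter> inside (curve (cycle_edges C)) \<noteq> {}"
    using face_props(3)[OF assms(2)] unfolding ins_def by blast
next
  assume "F \<inter> inside (curve (cycle_edges C)) \<noteq> {}"
  then show "F \<in> ins C"
    using face_side[OF assms] cycle_sides(6)[OF assms(1)] assms(2) unfolding ins_def by blast
qed

text \<open>A point off the curve has a neighbourhood on one side of it, and this neighbourhood
  meets every face that has the point in its closure.\<close>

lemma closure_ins:
  assumes C: "cyc C" and p: "p \<notin> curve (cycle_edges C)" and F: "F \<in> ins C" "p \<in> closure F"
    and G: "G \<in> Fcs" "p \<in> closure G"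
  shows "G \<in> ins C"
proof -
  let ?U = "curve (cycle_edges C)"
  note s = cycle_sides[OF C]
  have FI: "F \<subseteq> inside ?U" using F by (simp add: ins_def)
  have "p \<notin> outside ?U"
  proof
    assume "p \<in> outside ?U"
    then have "outside ?U \<inter> F \<noteq> {}" using s(3) F(2) by (metis closure_iff_nhds_not_empty inf_commute order_refl)
    then show False using FI s(6) by blast
  qed
  then have "p \<in> inside ?U" using s(7) p by blast
  then have "inside ?U \<inter> G \<noteq> {}" using s(1) G(2) by (metis closure_iff_nhds_not_empty inf_commute order_refl)
  then show ?thesis unfolding ins_iff[OF C G(1)] by (simp add: Int_commute)
qed

text \<open>Both sides of the curve come close to a point of the open edge, so each side contains a
  face at the edge; there are only two such faces.\<close>

lemma ins_edge:
  assumes C: "cyc C" and e: "e \<in> cycle_edges C"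
  shows "card {F \<in> ins C. e \<subseteq> tri F} = 1"
proof -
  let ?U = "curve (cycle_edges C)"
  have CE: "cycle_edges C \<subseteq> E" using C by (simp add: cyc_def)
  have eE: "e \<in> E" using e CE by blast
  note s = cycle_sides[OF C]
  obtain p where p: "p \<in> open_edge e" using open_edge_nonempty[OF eE] by blast
  have "p \<in> ?U" using open_edge_curve[OF eE CE p] e by simp
  then have cl: "p \<in> closure (inside ?U)" "p \<in> closure (outside ?U)"
    using s(8,9) by (auto simp: frontier_def)
  obtain F where F: "F \<in> Fcs" "F \<inter> inside ?U \<noteq> {}" "p \<in> closure F" using face_near[OF s(1) cl(1)] .
  obtain G where G: "G \<in> Fcs" "G \<inter> outside ?U \<noteq> {}" "p \<in> closure G" using face_near[OF s(3) cl(2)] .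
  have Fe: "e \<subseteq> tri F" "e \<subseteq> tri G" using closure_face_edge[OF _ eE p] F G by auto
  have FI: "F \<in> ins C" unfolding ins_iff[OF C F(1)] using F(2) .
  have GI: "G \<notin> ins C" using G(2) s(6) unfolding ins_def by blast
  have "F \<noteq> G" using FI GI by blast
  then have "{F, G} = {F \<in> Fcs. e \<subseteq> tri F}"
    by (intro card_seteq) (use F(1) G(1) Fe two_faces[OF eE] finite_faces in auto)
  then have "{F \<in> ins C. e \<subseteq> tri F} = {F}" using FI GI Fe by (auto simp: ins_def)
  then show ?thesis by simp
qed

lemma edge_image_closure:
  assumes "F \<in> Fcs" "e \<in> E" "e \<subseteq> tri F"
  shows "path_image (crv e) \<subseteq> closure F"
proof -
  obtain a b c where abc: "cyc [a, b, c]" "cycle_edges [a, b, c] = {e \<in> E. e \<subseteq> tri F}"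
    "frontier F = curve (cycle_edges [a, b, c])" using tri_obtain[OF assms(1)] .
  then have "path_image (crv e) \<subseteq> frontier F" using assms by (auto simp: curve_def)
  then show ?thesis by (auto simp: frontier_def)
qed

lemma vertex_closure:
  assumes "F \<in> Fcs" "v \<in> tri F"
  shows "v \<in> V" "pos v \<in> closure F"
proof -
  obtain a b c where abc: "tri F = {a, b, c}" "cyc [a, b, c]" "cycle_edges [a, b, c] = {e \<in> E. e \<subseteq> tri F}"
    using tri_obtain[OF assms(1)] by metis
  have ce: "cycle_edges [a, b, c] = {{a, b}, {b, c}, {c, a}}" by (simp add: cycle_edges_walk)
  have "\<exists>e\<in>cycle_edges [a, b, c]. v \<in> e" using assms(2) unfolding abc(1) ce by auto
  then obtain e where e: "e \<in> E" "e \<subseteq> tri F" "v \<in> e" using abc(3) by auto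
  then show "v \<in> V" using edge_sub by blast
  show "pos v \<in> closure F"
    using e ends_in_image[OF e(1)] edge_image_closure[OF assms(1) e(1,2)] by blast
qed

lemma no_isolated_vertex:
  assumes v: "v \<in> V"
  shows "\<exists>e\<in>E. v \<in> e"
proof -
  obtain F where F: "F \<in> Fcs" "pos v \<in> closure F" by (rule face_near[of UNIV "pos v"]) auto
  obtain a b c where abc: "cyc [a, b, c]" "frontier F = curve (cycle_edges [a, b, c])"
    using tri_obtain[OF F(1)] by metis
  have "pos v \<in> draw" using v by (simp add: drawing_def)
  then have "pos v \<in> frontier F" using F face_props[OF F(1)] by (auto simp: frontier_def interior_open)
  then have "\<exists>e\<in>cycle_edges [a, b, c]. v \<in> e" unfolding abc(2)
    by (intro vertex_curve) (use v abc in \<open>auto simp: cyc_def\<close>)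
  then show ?thesis using abc(1) unfolding cyc_def by blast
qed

text \<open>The curve of \<open>Z\<close> stays within the closure of the inside of
  \<open>C\<close>. So the outside of \<open>C\<close>, being connected and unbounded, lies outside
  \<open>Z\<close>, and a face inside \<open>Z\<close> must be inside \<open>C\<close>.\<close>

lemma ins_subset:
  assumes C: "cyc C" and Z: "cyc Z"
    and sub: "\<And>e. e \<in> cycle_edges Z \<Longrightarrow> e \<notin> cycle_edges C \<Longrightarrow> \<exists>F\<in>ins C. e \<subseteq> tri F"
  shows "ins Z \<subseteq> ins C"
proof
  let ?U = "curve (cycle_edges C)" and ?W = "curve (cycle_edges Z)"
  note s = cycle_sides[OF C]
  have "outside ?U \<inter> ?W = {}"
  proof -
    have "path_image (crv e) \<inter> outside ?U = {}" if e: "e \<in> cycle_edges Z" for e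
    proof (cases "e \<in> cycle_edges C")
      case True
      then have "path_image (crv e) \<subseteq> ?U" by (auto simp: curve_def)
      then show ?thesis using s(7) by blast
    next
      case False
      then obtain F where F: "F \<in> ins C" "e \<subseteq> tri F" using sub[OF e] by blast
      have "e \<in> E" using e Z by (auto simp: cyc_def)
      then have "path_image (crv e) \<subseteq> closure F" using F by (intro edge_image_closure) (auto simp: ins_def)
      also have "\<dots> \<subseteq> closure (inside ?U)" using F by (intro closure_mono) (simp add: ins_def)
      also have "\<dots> = inside ?U \<union> ?U" using s(8) by (metis closure_Un_frontier)
      finally show ?thesis using s(6,7) by blast
    qed
    then show ?thesis unfolding curve_def by blast
  qed
  then have "outside ?U \<subseteq> outside ?W" using s(4,5) by (intro unbounded_subset_outside) auto
  then have disj: "inside ?W \<inter> outside ?U = {}" using inside_Int_outside by blast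
  fix F assume F: "F \<in> ins Z"
  then have "F \<in> Fcs" "F \<subseteq> inside ?W" by (auto simp: ins_def)
  moreover have "F \<noteq> {}" using face_props(3) calculation by blast
  ultimately show "F \<in> ins C" using face_side[OF C, of F] disj unfolding ins_def by blast
qed

end

sublocale plane_triangulated \<subseteq> T: sphere_triangulation V E Fcs tri ins
proof unfold_locales
  show "sgraph V E" by (rule graph)
  show "finite Fcs" by (rule finite_faces)
  show "card (tri F) = 3" "clique (tri F) E" if F: "F \<in> Fcs" for F
  proof -
    obtain a b c where abc: "tri F = {a, b, c}" "a \<noteq> b" "b \<noteq> c" "a \<noteq> c" "cyc [a, b, c]"
      using tri_obtain[OF F] by metis
    have ce: "cycle_edges [a, b, c] = {{a, b}, {b, c}, {c, a}}" by (simp add: cycle_edges_walk)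
    show "card (tri F) = 3" using abc by simp
    show "clique (tri F) E" using abc(5) unfolding abc(1) cyc_def ce by (auto simp: clique_def insert_commute)
  qed
  show "card {F \<in> Fcs. e \<subseteq> tri F} = 2" if "e \<in> E" for e by (rule two_faces[OF that])
  fix C :: "'a list" assume C': "is_cycle C" "cycle_edges C \<subseteq> E"
  then have C: "cyc C" by (simp add: cyc_def)
  show "ins C \<subseteq> Fcs" by (auto simp: ins_def)
  show "card {F \<in> ins C. e \<subseteq> tri F} = 1" if "e \<in> cycle_edges C" for e by (rule ins_edge[OF C that])
  show "G \<in> ins C" if "e \<in> E" "e \<notin> cycle_edges C" "F \<in> ins C" "e \<subseteq> tri F" "G \<in> Fcs" "e \<subseteq> tri G" for e F G
  proof -
    have FF: "F \<in> Fcs" using that by (simp add: ins_def)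
    obtain p where p: "p \<in> open_edge e" using open_edge_nonempty[OF \<open>e \<in> E\<close>] by blast
    show ?thesis
      by (rule closure_ins[OF C _ that(3) _ that(5)])
        (use that p open_edge_curve[OF that(1) C'(2) p] closure_face_edge[OF FF that(1) p]
          closure_face_edge[OF that(5) that(1) p] in auto)
  qed
  show "G \<in> ins C" if "v \<notin> set C" "F \<in> ins C" "v \<in> tri F" "G \<in> Fcs" "v \<in> tri G" for v F G
  proof -
    have FF: "F \<in> Fcs" using that by (simp add: ins_def)
    have "pos v \<notin> curve (cycle_edges C)"
    proof
      assume "pos v \<in> curve (cycle_edges C)"
      then have "\<exists>e\<in>cycle_edges C. v \<in> e" using vertex_curve vertex_closure(1)[OF FF that(3)] C'(2) by blast
      then show False using cycle_edges_subset that(1) by blast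
    qed
    then show ?thesis
      using closure_ins[OF C _ that(2) _ that(4)] vertex_closure(2)[OF FF that(3)] vertex_closure(2)[OF that(4,5)] by blast
  qed
  fix Z :: "'a list" assume Z: "is_cycle Z" "cycle_edges Z \<subseteq> E"
    and sub: "\<And>e. e \<in> cycle_edges Z \<Longrightarrow> e \<notin> cycle_edges C \<Longrightarrow> \<exists>F\<in>ins C. e \<subseteq> tri F"
  show "ins Z \<subseteq> ins C" by (rule ins_subset[OF C _ sub]) (use Z in \<open>auto simp: cyc_def\<close>)
qed

theorem theorem2:
  fixes V :: "'a::finite set" and E :: "'a set set"
    and pos :: "'a \<Rightarrow> complex" and crv :: "'a set \<Rightarrow> real \<Rightarrow> complex"
  assumes "plane_triangulation V E pos crv"
  shows "(t_perfect V E \<longleftrightarrow> \<not> has_induced_loose_odd_wheel V E) \<and>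
         (\<not> has_induced_loose_odd_wheel V E \<longleftrightarrow> perfect V E \<and> \<not> contains_K4 V E)"
proof -
  interpret plane_triangulated V E pos crv
    by unfold_locales (rule assms)
  have "t_perfect V E \<Longrightarrow> \<not> has_induced_loose_odd_wheel V E"
    using t_perfect_no_loose_odd_wheel[OF graph no_isolated_vertex] .
  moreover have "\<not> has_induced_loose_odd_wheel V E \<Longrightarrow> perfect V E \<and> \<not> contains_K4 V E"
    using T.perfect_if_no_loose_odd_wheel by blast
  moreover have "perfect V E \<Longrightarrow> \<not> contains_K4 V E \<Longrightarrow> t_perfect V E"
    using perfect_t_perfect[OF graph no_isolated_vertex] .
  moreover have "perfect V E \<Longrightarrow> \<not> contains_K4 V E \<Longrightarrow> \<not> has_induced_loose_odd_wheel V E"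
    using perfect_no_loose_odd_wheel[OF graph] .
  ultimately show ?thesis by blast
qed

end
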